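(* The finite-dimensional distributions of the Airy$_1$ process $\mathcal{A}_1$ are given by the following formula: for $x_1,\dots,x_n\in\mathbb{R}$ and $t_1<\dots<t_n$ in $\mathbb{R}$, $$\mathbb{P}\left(\mathcal{A}_1(t_1)\leq x_1,\dots,\mathcal{A}_1(t_n)\leq x_n\right)=\det\left(I-B_0+\bar P_{x_1}e^{-(t_1-t_2)\Delta}\bar P_{x_2}e^{-(t_2-t_3)\Delta}\cdots e^{-(t_{n-1}-t_n)\Delta}\bar P_{x_n}e^{-(t_n-t_1)\Delta}B_0\right)_{L^2(\mathbb{R})}.$$
   Context: The Airy$_1$ process $\mathcal{A}_1$ is the stationary real-valued process indexed by $\mathbb{R}$ defined through its finite-dimensional distributions: for $x_1,\dots,x_n\in\mathbb{R}$ and $t_1<\dots<t_n$ in $\mathbb{R}$, $$\mathbb{P}\left(\mathcal{A}_1(t_1)\le x_1,\dots,\mathcal{A}_1(t_n)\le x_n\right)=\det(I-\mathrm{f}^{1/2}K_1^{\mathrm{ext}}\mathrm{f}^{1/2})_{L^2(\{t_1,\dots,t_n\}\times\mathbb{R})},$$ with counting measure on $\{t_1,\dots,t_n\}$ and Lebesgue measure on $\mathbb{R}$, $\mathrm{f}(t_j,x)=\mathbf{1}_{x\in(x_j,\infty)}$, and $$K_1^{\mathrm{ext}}(t,x;t',x')=-\frac{1}{\sqrt{4\pi(t'-t)}}\exp\left(-\frac{(x'-x)^2}{4(t'-t)}\right)\mathbf{1}_{t'>t}+\mathrm{Ai}(x+x'+(t'-t)^2)\exp\left((t'-t)(x+x')+\tfrac23(t'-t)^3\right),$$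 where $\mathrm{Ai}$ is the Airy function. Notation. $\Delta=\partial_x^2$; for $s>0$, $e^{s\Delta}$ is the heat operator with kernel $e^{s\Delta}(x,y)=(4\pi s)^{-1/2}e^{-(x-y)^2/(4s)}$, and $e^{0\Delta}=I$. $\bar P_a$ is multiplication by $\mathbf{1}_{(-\infty,a]}$. $B_0$ is the integral operator with kernel $B_0(x,y)=\mathrm{Ai}(x+y)$. For $s\ge0$, $e^{-s\Delta}B_0$ denotes the integral operator with kernel $(e^{-s\Delta}B_0)(x,y)=e^{-2s^3/3-(x+y)s}\mathrm{Ai}(x+y+s^2)$; it satisfies $e^{s\Delta}(e^{-s\Delta}B_0)=B_0$. (For $n=1$ the operator in the determinant is $I-B_0+\bar P_{x_1}B_0$.) Convention on determinants. Determinants are Fredholm determinants on the indicated $L^2$ space. The operators as written need not be trace class; the determinants are understood through their Fredholm expansion series $\det(I+J)=\sum_{m\ge0}\frac1{m!}\int\det[J(\xi_i,\xi_j)]_{i,j=1}^m\,d\xi_1\cdots d\xi_m$, or equivalently as the Fredholm determinant of a trace class operator with kernel $u(\xi)J(\xi,\xi')u(\xi')^{-1}$ obtained by conjugating by multiplication by a suitable positive function $u$. For the operator on $L^2(\mathbb{R})$ with $n\ge2$ one may take $u(x)=e^{-2(t_n-t_1)x}$; for the extended kernel one may take $u(t_i,x)=(1+x^2)^{-2i}$. *)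

theory Defs
  imports "HOL-Probability.Probability" "Jordan_Normal_Form.Determinant"
begin

(* The defining integral converges only conditionally, hence the explicit limit. *)
definition airy_Ai :: "real \<Rightarrow> real" where
  "airy_Ai x = (1 / pi) * Lim at_top (\<lambda>T. integral {0..T} (\<lambda>s. cos (s ^ 3 / 3 + x * s)))"

subsection \<open>Fredholm determinants\<close>

definition fredholm_minor :: "('a \<Rightarrow> 'a \<Rightarrow> real) \<Rightarrow> nat \<Rightarrow> (nat \<Rightarrow> 'a) \<Rightarrow> real" where
  "fredholm_minor J m \<xi> = Determinant.det (Matrix.mat m m (\<lambda>(i, j). J (\<xi> i) (\<xi> j)))"

definition fredholm_term :: "'a measure \<Rightarrow> ('a \<Rightarrow> 'a \<Rightarrow> real) \<Rightarrow> nat \<Rightarrow> real" where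
  "fredholm_term M J m =
     (\<integral>\<xi>. fredholm_minor J m \<xi> \<partial>(\<Pi>\<^sub>M i\<in>{..<m}. M)) / fact m"

(* det (I + J) on L^2(M), as the Fredholm expansion of the kernel J. *)
definition fredholm_det :: "'a measure \<Rightarrow> ('a \<Rightarrow> 'a \<Rightarrow> real) \<Rightarrow> real" where
  "fredholm_det M J = (\<Sum>m. fredholm_term M J m)"

(* Bochner integrals and infinite sums are total in HOL; this says that the value above is not
   an artefact of a divergent integral or series. *)
definition fredholm_det_defined :: "'a measure \<Rightarrow> ('a \<Rightarrow> 'a \<Rightarrow> real) \<Rightarrow> bool" where
  "fredholm_det_defined M J \<longleftrightarrow>
     (\<forall>m. integrable (\<Pi>\<^sub>M i\<in>{..<m}. M) (fredholm_minor J m)) \<and> summable (fredholm_term M J)"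

subsection \<open>The Airy-1 process\<close>

definition K1_ext :: "real \<times> real \<Rightarrow> real \<times> real \<Rightarrow> real" where
  "K1_ext = (\<lambda>(t, x) (t', x').
     - (if t' > t then 1 / sqrt (4 * pi * (t' - t)) * exp (- ((x' - x)\<^sup>2 / (4 * (t' - t)))) else 0)
     + airy_Ai (x + x' + (t' - t)\<^sup>2) * exp ((t' - t) * (x + x') + 2 / 3 * (t' - t) ^ 3))"

(* f(t_j, y) = 1 if y > x_j, and 0 otherwise; the t_j are assumed distinct. *)
definition cutoff :: "nat \<Rightarrow> (nat \<Rightarrow> real) \<Rightarrow> (nat \<Rightarrow> real) \<Rightarrow> real \<times> real \<Rightarrow> real" where
  "cutoff n t x = indicator {(t j, y) | j y. j \<in> {1..n} \<and> y > x j}"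

definition airy1_ext_det :: "nat \<Rightarrow> (nat \<Rightarrow> real) \<Rightarrow> (nat \<Rightarrow> real) \<Rightarrow> real" where
  "airy1_ext_det n t x =
     fredholm_det (count_space (t ` {1..n}) \<Otimes>\<^sub>M lborel)
       (\<lambda>\<xi> \<xi>'. - (sqrt (cutoff n t x \<xi>) * K1_ext \<xi> \<xi>' * sqrt (cutoff n t x \<xi>')))"

(* Stationarity is not listed: the right-hand side depends on t only through its increments. *)
definition airy1_process :: "'w measure \<Rightarrow> (real \<Rightarrow> 'w \<Rightarrow> real) \<Rightarrow> bool" where
  "airy1_process M A \<longleftrightarrow>
     prob_space M \<and> (\<forall>s. A s \<in> borel_measurable M) \<and>
     (\<forall>n\<ge>1. \<forall>t x. strict_mono_on {1..n} t \<longrightarrow>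
        \<P>(\<omega> in M. \<forall>i\<in>{1..n}. A (t i) \<omega> \<le> x i) = airy1_ext_det n t x)"

subsection \<open>The operator on the line\<close>

(* The operator exp (s * Laplacian), for s >= 0. *)
definition heat_op :: "real \<Rightarrow> (real \<Rightarrow> real) \<Rightarrow> real \<Rightarrow> real" where
  "heat_op s f x =
     (if s = 0 then f x
      else (\<integral>z. 1 / sqrt (4 * pi * s) * exp (- ((x - z)\<^sup>2 / (4 * s))) * f z \<partial>lborel))"

definition Pbar :: "real \<Rightarrow> (real \<Rightarrow> real) \<Rightarrow> real \<Rightarrow> real" where
  "Pbar a f x = indicator {..a} x * f x"

definition B0 :: "real \<Rightarrow> real \<Rightarrow> real" where
  "B0 x y = airy_Ai (x + y)"

(* Kernel of exp (- s * Laplacian) B0, for s >= 0. *)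
definition heat_B0 :: "real \<Rightarrow> real \<Rightarrow> real \<Rightarrow> real" where
  "heat_B0 s x y = exp (- 2 * s ^ 3 / 3 - (x + y) * s) * airy_Ai (x + y + s\<^sup>2)"

(* Pbar (x 1) o heat_op (t 2 - t 1) o Pbar (x 2) o ... o heat_op (t n - t (n - 1)) o Pbar (x n) *)
definition barrier_op ::
    "nat \<Rightarrow> (nat \<Rightarrow> real) \<Rightarrow> (nat \<Rightarrow> real) \<Rightarrow> (real \<Rightarrow> real) \<Rightarrow> real \<Rightarrow> real" where
  "barrier_op n t x =
     foldr (\<lambda>i R. Pbar (x i) \<circ> heat_op (- (t i - t (Suc i))) \<circ> R) [1..<n] (Pbar (x n))"

(* A composition of an operator with an integral operator has as kernel the operator applied,
   for each fixed y, to the column of the kernel at y. *)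
definition airy1_kernel :: "nat \<Rightarrow> (nat \<Rightarrow> real) \<Rightarrow> (nat \<Rightarrow> real) \<Rightarrow> real \<Rightarrow> real \<Rightarrow> real" where
  "airy1_kernel n t x u y =
     - B0 u y + barrier_op n t x (\<lambda>z. heat_B0 (t n - t 1) z y) u"

end

theory Submission
  imports Defs "HOL-Complex_Analysis.Complex_Analysis"
begin

text \<open>
  Both sides of the theorem are Fredholm series \<open>\<Sum>m. 1/m! \<integral> det [J (\<xi> i) (\<xi> j)]\<close>.
  Write \<open>E s\<close> for the heat kernel at time \<open>s\<close>, \<open>Q j\<close> for multiplication by the indicator of
  \<open>(x j, \<infinity>)\<close>, and choose an auxiliary time \<open>t 0 = t 1 - 1\<close>. Let \<open>b i\<close> have the kernel
  \<open>exp (- (t i - t 0) \<Delta>) B0\<close>. With its cutoffs the extended kernel is \<open>N - B\<close>, where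
  \<open>N i j = Q i E (t j - t i) Q j\<close> for \<open>i < j\<close> (and 0 otherwise) is strictly triangular in time, and
  \<open>B i j = Q i b i E (t j - t 0) Q j\<close>.

  The key is a last-exceedance decomposition. Let \<open>V n = b n\<close> and
  \<open>V i = E (t (i+1) - t i) (1 - Q (i+1)) V (i+1)\<close>: the heat flow from time \<open>t i\<close> that stays below all
  later levels. Sorting by the last level that the flow exceeds gives
  \<open>b i = V i + \<Sum>j>i. E (t j - t i) Q j V j\<close> (lemma \<open>airy_shift_decomposition\<close>). With the column
  \<open>U i = Q i V i\<close> and the row \<open>W j = E (t j - t 0) Q j\<close> this says
  \<open>I + N - B = (I + N) (I - U W)\<close> (lemma \<open>source_factorisation\<close>). Hence the determinant on the left is
  \<open>det (I + N) det (I - U W) = det (I - W U)\<close>, because \<open>N\<close> is strictly triangular. By the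
  decomposition at \<open>i = 0\<close>, \<open>W U = b 0 - V 0 = E 1 (b 1 - (1 - Q 1) V 1)\<close>; moving \<open>E 1\<close> to the
  right gives the kernel \<open>B0 - (1 - Q 1) E (t 2 - t 1) (1 - Q 2) \<dots> (1 - Q n) exp (- (t n - t 1) \<Delta>) B0\<close>
  on the line. The auxiliary time makes every factor an integral kernel; with \<open>t 0 = t 1\<close> the first
  entry of \<open>W\<close> would be the identity restricted to a half line.

  Two facts on Fredholm series carry this: \<open>fredholm_det_multiplicative\<close> and
  \<open>fredholm_det_comp_commute\<close>. Both follow from one recursion. For a list of kernels \<open>A 0, \<dots>, A (m-1)\<close>
  let the mixed moment be \<open>\<integral> det [A i (\<xi> i) (\<xi> j)]\<close>. Laplace expansion along one row and Fubini's theorem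
  express it through traces and shorter moments (lemma \<open>moment_Cons\<close>):
  \<open>moment (A, As) = tr A moment As - \<Sum>k. moment (As with A k replaced by A \<circ> A k)\<close>.
  So mixed moments depend only on traces of products, and identities between determinants can be proved by
  induction on the length of the list. All series converge absolutely since the kernels satisfy
  \<open>\<bar>A x y\<bar> \<le> C a x b y\<close> with \<open>a b\<close> integrable, and Hadamard's inequality then bounds a moment of
  \<open>m\<close> kernels by \<open>m powr (m/2) c ^ m\<close>.

  The Airy function enters through three properties of \<open>exp (- s \<Delta>) B0\<close>, all read off from the absolutely
  convergent contour integral over \<open>Im \<zeta> = c\<close> (lemma \<open>airy_shift_contour\<close>): measurability, exponential
  bounds, and the fact that the heat kernel shifts \<open>s\<close>.
\<close>

section \<open>Determinants of real matrices and Hadamard's inequality\<close>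

text \<open>
  Matrices are functions of two indices here, so that rows can be replaced by function update.
\<close>

definition fdet_mat :: "nat \<Rightarrow> (nat \<Rightarrow> nat \<Rightarrow> real) \<Rightarrow> real" where
  "fdet_mat m E = Determinant.det (Matrix.mat m m (\<lambda>(i, j). E i j))"

lemma fdet_mat_leibniz:
  "fdet_mat m E = (\<Sum>p | p permutes {..<m}. of_int (sign p) * (\<Prod>i<m. E i (p i)))"
proof -
  have "fdet_mat m E = (\<Sum>p | p permutes {0..<m}. of_int (sign p) * (\<Prod>i=0..<m. E i (p i)))"
    unfolding fdet_mat_def by (subst det_def') (auto intro!: sum.cong prod.cong simp: permutes_in_image)
  then show ?thesis by (simp add: atLeast0LessThan)
qed

lemma fdet_mat_cong:
  assumes "\<And>i j. i < m \<Longrightarrow> j < m \<Longrightarrow> E i j = F i j"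
  shows "fdet_mat m E = fdet_mat m F"
  unfolding fdet_mat_def by (rule arg_cong[where f = Determinant.det], rule eq_matI) (auto simp: assms)

lemma fdet_mat_row_linear:
  assumes "k < m"
  obtains c where "\<And>r. fdet_mat m (E(k := r)) = (\<Sum>j<m. r j * c j)"
proof
  fix r
  let ?A = "Matrix.mat m m (\<lambda>(i, j). E i j)" and ?B = "Matrix.mat m m (\<lambda>(i, j). (E(k := r)) i j)"
  have "Determinant.det ?B = (\<Sum>j<m. ?B $$ (k, j) * Determinant.cofactor ?B k j)"
    by (rule laplace_expansion_row) (use assms in auto)
  also have "\<dots> = (\<Sum>j<m. r j * Determinant.cofactor ?A k j)"
  proof (intro sum.cong refl)
    fix j assume j: "j \<in> {..<m}"
    have "mat_delete ?B k j = mat_delete ?A k j"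
      using assms j by (intro eq_matI) (auto simp: mat_delete_def)
    then have "Determinant.cofactor ?B k j = Determinant.cofactor ?A k j"
      by (simp only: Determinant.cofactor_def)
    moreover have "?B $$ (k, j) = r j" using assms j by simp
    ultimately show "?B $$ (k, j) * Determinant.cofactor ?B k j = r j * Determinant.cofactor ?A k j"
      by (simp only:)
  qed
  finally show "fdet_mat m (E(k := r)) = (\<Sum>j<m. r j * Determinant.cofactor ?A k j)"
    unfolding fdet_mat_def .
qed

lemma fdet_mat_permute:
  assumes "p permutes {..<m}"
  shows "fdet_mat m (\<lambda>i j. E (p i) (p j)) = fdet_mat m E"
proof -
  have p: "p permutes {0..<m}" using assms by (simp add: atLeast0LessThan)
  let ?A = "Matrix.mat m m (\<lambda>(i, j). E i j)"
  let ?B = "Matrix.mat m m (\<lambda>(i, j). ?A $$ (p i, j))"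
  let ?C = "Matrix.mat m m (\<lambda>(i, j). E (p i) (p j))"
  have "Determinant.det ?B = of_int (sign p) * Determinant.det ?A"
    by (rule det_permute_rows[OF _ p]) auto
  moreover have "?C = transpose_mat (Matrix.mat m m (\<lambda>(i, j). transpose_mat ?B $$ (p i, j)))"
    using assms by (intro eq_matI) (auto simp: permutes_in_image[OF assms, unfolded lessThan_iff])
  then have "Determinant.det ?C
      = Determinant.det (Matrix.mat m m (\<lambda>(i, j). transpose_mat ?B $$ (p i, j)))"
    by (simp only: det_transpose[OF mat_carrier])
  moreover have "\<dots> = of_int (sign p) * Determinant.det (transpose_mat ?B)"
    by (rule det_permute_rows[OF _ p]) auto
  moreover have "Determinant.det (transpose_mat ?B) = Determinant.det ?B"
    by (rule det_transpose) auto
  ultimately show ?thesis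
    by (simp add: fdet_mat_def sign_def)
qed

text \<open>
  Laplace expansion along the last row. The minor for the column \<open>k < m\<close> is rewritten as a determinant on
  the index set \<open>{..<m}\<close> in which column \<open>m\<close> has taken the place of column \<open>k\<close>; this is what lets
  the point \<open>\<xi> m\<close> be integrated out later. The sign of the cofactor and that of the cyclic shift of columns
  multiply to \<open>-1\<close> for every \<open>k\<close>.
\<close>

lemma fdet_mat_expand_last:
  "fdet_mat (Suc m) E
    = E m m * fdet_mat m E - (\<Sum>k<m. E m k * fdet_mat m (\<lambda>i j. E i (if j = k then m else j)))"
proof -
  let ?A = "Matrix.mat (Suc m) (Suc m) (\<lambda>(i, j). E i j)"
  have "fdet_mat (Suc m) E = (\<Sum>j<Suc m. E m j * Determinant.cofactor ?A m j)"
    unfolding fdet_mat_def by (subst laplace_expansion_row[where n = "Suc m" and i = m]) auto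
  moreover have "mat_delete ?A m m = Matrix.mat m m (\<lambda>(i, j). E i j)"
    by (intro eq_matI) (auto simp: mat_delete_def)
  then have "Determinant.cofactor ?A m m = fdet_mat m E"
    by (simp add: Determinant.cofactor_def fdet_mat_def)
  moreover have "Determinant.cofactor ?A m k = - fdet_mat m (\<lambda>i j. E i (if j = k then m else j))"
    if k: "k < m" for k
  proof -
    \<comment> \<open>Replacing the last row by the unit vector at \<open>k\<close> turns the determinant into the cofactor;
      exchanging columns \<open>k\<close> and \<open>m\<close> then moves the pivot to the corner.\<close>
    let ?U = "Matrix.mat (Suc m) (Suc m) (\<lambda>(i, j). if i = m then (if j = k then 1 else 0) else E i j)"
    let ?V = "swapcols k m ?U"
    have "Determinant.det ?U = (\<Sum>j<Suc m. ?U $$ (m, j) * Determinant.cofactor ?U m j)"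
      by (rule laplace_expansion_row) auto
    also have "\<dots> = (\<Sum>j<Suc m. if j = k then Determinant.cofactor ?U m j else 0)"
      by (intro sum.cong) auto
    also have "\<dots> = Determinant.cofactor ?U m k" using k by simp
    also have "mat_delete ?U m k = mat_delete ?A m k"
      using k by (intro eq_matI) (auto simp: mat_delete_def)
    then have "Determinant.cofactor ?U m k = Determinant.cofactor ?A m k"
      by (simp add: Determinant.cofactor_def)
    finally have 1: "Determinant.det ?U = Determinant.cofactor ?A m k" .
    have "Determinant.det ?V = (\<Sum>j<Suc m. ?V $$ (m, j) * Determinant.cofactor ?V m j)"
      by (rule laplace_expansion_row) auto
    also have "\<dots> = (\<Sum>j<Suc m. if j = m then Determinant.cofactor ?V m j else 0)"
      using k by (intro sum.cong) (auto simp: mat_swapcols_def)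
    also have "\<dots> = Determinant.cofactor ?V m m" by simp
    also have "mat_delete ?V m m = Matrix.mat m m (\<lambda>(i, j). E i (if j = k then m else j))"
      using k by (intro eq_matI) (auto simp: mat_delete_def mat_swapcols_def)
    then have "Determinant.cofactor ?V m m = fdet_mat m (\<lambda>i j. E i (if j = k then m else j))"
      by (simp add: Determinant.cofactor_def fdet_mat_def)
    finally have 2: "Determinant.det ?V = fdet_mat m (\<lambda>i j. E i (if j = k then m else j))" .
    have "Determinant.det ?V = - Determinant.det ?U"
      using k by (intro det_swapcols[where n = "Suc m"]) auto
    with 1 2 show ?thesis by simp
  qed
  ultimately show ?thesis
    by (simp add: sum_negf)
qed

lemma fdet_mat_add:
  "fdet_mat m (\<lambda>i j. E i j + F i j) = (\<Sum>S\<in>Pow {..<m}. fdet_mat m (\<lambda>i. if i \<in> S then E i else F i))"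
proof -
  have "fdet_mat m (\<lambda>i j. E i j + F i j)
    = (\<Sum>p | p permutes {..<m}. \<Sum>S\<in>Pow {..<m}.
        of_int (sign p) * (\<Prod>i<m. (if i \<in> S then E i else F i) (p i)))"
    unfolding fdet_mat_leibniz
  proof (intro sum.cong refl)
    fix p
    have "(\<Prod>i\<in>S. E i (p i)) * (\<Prod>i\<in>{..<m} - S. F i (p i))
        = (\<Prod>i<m. (if i \<in> S then E i else F i) (p i))" if "S \<in> Pow {..<m}" for S
    proof -
      have "(\<Prod>i<m. (if i \<in> S then E i else F i) (p i))
          = (\<Prod>i\<in>S. (if i \<in> S then E i else F i) (p i)) * (\<Prod>i\<in>{..<m} - S. (if i \<in> S then E i else F i) (p i))"
        using that by (simp only: prod.subset_diff[of S "{..<m}"] finite_lessThan Pow_iff mult.commute)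
      also have "\<dots> = (\<Prod>i\<in>S. E i (p i)) * (\<Prod>i\<in>{..<m} - S. F i (p i))"
        by (intro arg_cong2[where f = "(*)"] prod.cong) auto
      finally show ?thesis by simp
    qed
    then show "of_int (sign p) * (\<Prod>i<m. E i (p i) + F i (p i))
        = (\<Sum>S\<in>Pow {..<m}. of_int (sign p) * (\<Prod>i<m. (if i \<in> S then E i else F i) (p i)))"
      by (simp add: prod_add sum_distrib_left)
  qed
  also have "\<dots> = (\<Sum>S\<in>Pow {..<m}. fdet_mat m (\<lambda>i. if i \<in> S then E i else F i))"
    unfolding fdet_mat_leibniz by (rule sum.swap)
  finally show ?thesis .
qed

lemma fdet_mat_row_replace:
  assumes "k < m" "i < m" "i \<noteq> k"
  shows "fdet_mat m (E(k := \<lambda>j. E k j - c * E i j)) = fdet_mat m E"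
proof -
  obtain d where d: "\<And>r. fdet_mat m (E(k := r)) = (\<Sum>j<m. r j * d j)"
    using fdet_mat_row_linear[OF assms(1)] by metis
  have "fdet_mat m (E(k := E i)) = 0"
    unfolding fdet_mat_def
    by (rule det_identical_rows[of _ m i k]) (use assms in \<open>auto intro!: eq_vecI\<close>)
  moreover have "fdet_mat m (E(k := \<lambda>j. E k j - c * E i j)) = fdet_mat m (E(k := E k)) - c * fdet_mat m (E(k := E i))"
    unfolding d by (simp add: algebra_simps sum_subtractf sum_distrib_left)
  ultimately show ?thesis by simp
qed

lemma fdet_mat_orthogonal_rows:
  assumes "\<And>i i'. i < m \<Longrightarrow> i' < m \<Longrightarrow> i \<noteq> i' \<Longrightarrow> (\<Sum>j<m. E i j * E i' j) = 0"
  shows "(fdet_mat m E)\<^sup>2 = (\<Prod>i<m. \<Sum>j<m. (E i j)\<^sup>2)"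
proof -
  let ?A = "Matrix.mat m m (\<lambda>(i, j). E i j)"
  let ?P = "?A * transpose_mat ?A"
  have ent: "?P $$ (i, i') = (\<Sum>j<m. E i j * E i' j)" if "i < m" "i' < m" for i i'
    using that by (simp add: scalar_prod_def atLeast0LessThan)
  have "(fdet_mat m E)\<^sup>2 = Determinant.det ?P"
    by (subst det_mult[where n = m]) (auto simp: det_transpose[of _ m] fdet_mat_def power2_eq_square)
  also have "\<dots> = prod_list (diag_mat ?P)"
    by (rule det_upper_triangular[of _ m]) (auto simp del: index_mult_mat(1) simp add: ent assms intro!: upper_triangularI)
  also have "\<dots> = (\<Prod>i<m. \<Sum>j<m. (E i j)\<^sup>2)"
    unfolding prod_list_diag_prod by (auto simp del: index_mult_mat(1) simp add: ent power2_eq_square atLeast0LessThan)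
  finally show ?thesis .
qed

text \<open>
  Gram-Schmidt without normalisation: subtracting from a row multiples of the earlier ones keeps the
  determinant and does not lengthen the row, and for orthogonal rows there is equality.
\<close>

lemma hadamard_inequality: "(fdet_mat m E)\<^sup>2 \<le> (\<Prod>i<m. \<Sum>j<m. (E i j)\<^sup>2)"
proof -
  let ?ip = "\<lambda>F i i'. (\<Sum>j<m. F i j * F i' j :: real)"
  define good where "good F \<longleftrightarrow> fdet_mat m F = fdet_mat m E \<and> (\<forall>i<m. ?ip F i i \<le> ?ip E i i)" for F
  have "\<exists>F. good F \<and> (\<forall>i<k. \<forall>i'<k. i \<noteq> i' \<longrightarrow> ?ip F i i' = 0)" if "k \<le> m" for k
    using that
  proof (induction k)
    case 0
    then show ?case by (auto simp: good_def)
  next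
    case (Suc k)
    then obtain F0 where F0: "good F0" "\<And>i i'. i < k \<Longrightarrow> i' < k \<Longrightarrow> i \<noteq> i' \<Longrightarrow> ?ip F0 i i' = 0"
      by auto
    have "\<exists>F. good F \<and> (\<forall>i<k. \<forall>i'<k. i \<noteq> i' \<longrightarrow> ?ip F i i' = 0) \<and> (\<forall>i<l. ?ip F k i = 0)"
      if "l \<le> k" for l
      using that
    proof (induction l)
      case 0
      then show ?case using F0 by auto
    next
      case (Suc l)
      then obtain F where F: "good F" "\<And>i i'. i < k \<Longrightarrow> i' < k \<Longrightarrow> i \<noteq> i' \<Longrightarrow> ?ip F i i' = 0"
        "\<And>i. i < l \<Longrightarrow> ?ip F k i = 0" by auto
      \<comment> \<open>The coefficient that makes row \<open>k\<close> orthogonal to row \<open>l\<close>. If row \<open>l\<close> vanishes then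
        \<open>c = 0\<close>, and the two rows are orthogonal anyway.\<close>
      define c where "c = ?ip F k l / ?ip F l l"
      define G where "G = F(k := \<lambda>j. F k j - c * F l j)"
      have l: "l < k" "k < m" using Suc.prems \<open>Suc k \<le> m\<close> by auto
      have cl: "c * ?ip F l l = ?ip F k l"
      proof (cases "?ip F l l = 0")
        case True
        then have "\<forall>j<m. F l j = 0"
          by (subst (asm) sum_nonneg_eq_0_iff) auto
        then show ?thesis by simp
      qed (simp add: c_def)
      have Gk: "?ip G k i = ?ip F k i - c * ?ip F l i" if "i \<noteq> k" for i
        using that by (simp add: G_def algebra_simps sum_subtractf sum_distrib_left)
      have Go: "?ip G i i' = ?ip F i i'" if "i \<noteq> k" "i' \<noteq> k" for i i'
        using that by (simp add: G_def)
      have "?ip G k k = ?ip F k k - 2 * c * ?ip F k l + c * (c * ?ip F l l)"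
        by (simp add: G_def algebra_simps sum_subtractf sum.distrib sum_distrib_left)
      also have "\<dots> = ?ip F k k - c\<^sup>2 * ?ip F l l"
        unfolding cl[symmetric] by (simp add: power2_eq_square)
      also have "\<dots> \<le> ?ip F k k" by (simp add: sum_nonneg)
      finally have "?ip G k k \<le> ?ip F k k" .
      then have le: "?ip G i i \<le> ?ip F i i" for i
        using Go[of i i] by (cases "i = k") auto
      have "fdet_mat m G = fdet_mat m F"
        unfolding G_def by (rule fdet_mat_row_replace) (use l in auto)
      then have "good G"
        using F(1) le unfolding good_def by (auto intro: order_trans)
      moreover have "\<forall>i<k. \<forall>i'<k. i \<noteq> i' \<longrightarrow> ?ip G i i' = 0" using F(2) Go by simp
      moreover have "?ip G k i = 0" if "i < Suc l" for i
        using that l F(2)[of l i] F(3)[of i] Gk[of i] cl by (cases "i = l") auto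
      ultimately show ?case by blast
    qed
    from this[of k] obtain F where F: "good F"
      "\<And>i i'. i < k \<Longrightarrow> i' < k \<Longrightarrow> i \<noteq> i' \<Longrightarrow> ?ip F i i' = 0" "\<And>i. i < k \<Longrightarrow> ?ip F k i = 0"
      by auto
    have "?ip F i k = ?ip F k i" for i by (simp add: mult.commute)
    with F(3) have F4: "?ip F i k = 0" if "i < k" for i using that by metis
    have "?ip F i i' = 0" if "i < Suc k" "i' < Suc k" "i \<noteq> i'" for i i'
    proof (cases "i < k")
      case True
      then show ?thesis using F(2)[of i i'] F4[of i] that by (cases "i' < k") (auto simp: less_Suc_eq)
    next
      case False
      then show ?thesis using F(3)[of i'] that by (auto simp: less_Suc_eq)
    qed
    with F(1) show ?case by blast
  qed
  from this[of m] obtain F where F: "good F" "\<And>i i'. i < m \<Longrightarrow> i' < m \<Longrightarrow> i \<noteq> i' \<Longrightarrow> ?ip F i i' = 0"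
    by auto
  have "(fdet_mat m E)\<^sup>2 = (\<Prod>i<m. \<Sum>j<m. (F i j)\<^sup>2)"
    using F fdet_mat_orthogonal_rows[of m F] by (simp add: good_def)
  also have "\<dots> \<le> (\<Prod>i<m. \<Sum>j<m. (E i j)\<^sup>2)"
    using F(1) by (intro prod_mono) (auto simp: good_def power2_eq_square sum_nonneg)
  finally show ?thesis .
qed

text \<open>
  Rescaling rows and columns reduces this to entries bounded by 1. The factor \<open>sqrt (m ^ m)\<close>, which is smaller
  than \<open>m!\<close>, is what makes Fredholm series converge.
\<close>

lemma fdet_mat_bound:
  assumes "\<And>i j. i < m \<Longrightarrow> j < m \<Longrightarrow> \<bar>E i j\<bar> \<le> \<alpha> i * \<beta> j"
    and "\<And>i. i < m \<Longrightarrow> \<alpha> i > 0" "\<And>i. i < m \<Longrightarrow> \<beta> i > 0"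
  shows "\<bar>fdet_mat m E\<bar> \<le> sqrt (real m ^ m) * (\<Prod>i<m. \<alpha> i * \<beta> i)"
proof -
  define G where "G i j = E i j / (\<alpha> i * \<beta> j)" for i j
  have "fdet_mat m E = (\<Prod>i<m. \<alpha> i * \<beta> i) * fdet_mat m G"
    unfolding fdet_mat_leibniz sum_distrib_left
  proof (intro sum.cong refl)
    fix p assume "p \<in> {p. p permutes {..<m}}"
    then have p: "p permutes {..<m}" by simp
    then have pi: "p i < m" if "i < m" for i using that permutes_in_image[OF p] by auto
    have "(\<Prod>i<m. E i (p i)) = (\<Prod>i<m. \<alpha> i * \<beta> (p i) * G i (p i))"
      using assms(2,3) pi by (intro prod.cong refl) (auto simp: G_def less_imp_neq[THEN not_sym])
    also have "\<dots> = (\<Prod>i<m. \<alpha> i) * (\<Prod>i<m. \<beta> (p i)) * (\<Prod>i<m. G i (p i))"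
      by (simp add: prod.distrib)
    also have "(\<Prod>i<m. \<beta> (p i)) = (\<Prod>i<m. \<beta> i)"
      using prod.permute[OF p, of \<beta>] by (simp add: o_def)
    finally show "of_int (sign p) * (\<Prod>i<m. E i (p i))
        = (\<Prod>i<m. \<alpha> i * \<beta> i) * (of_int (sign p) * (\<Prod>i<m. G i (p i)))"
      by (simp add: prod.distrib)
  qed
  moreover have "\<bar>fdet_mat m G\<bar> \<le> sqrt (real m ^ m)"
  proof -
    have "(G i j)\<^sup>2 \<le> 1" if "i < m" "j < m" for i j
    proof -
      have "\<alpha> i * \<beta> j > 0" using that assms by simp
      then have "\<bar>G i j\<bar> \<le> 1"
        using assms(1)[OF that] by (simp add: G_def pos_divide_le_eq del: mult_pos_pos)
      then show ?thesis by (simp add: abs_square_le_1)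
    qed
    then have "(\<Prod>i<m. \<Sum>j<m. (G i j)\<^sup>2) \<le> (\<Prod>i<m. \<Sum>j<m. 1)"
      by (intro prod_mono conjI sum_mono sum_nonneg) auto
    then have "(fdet_mat m G)\<^sup>2 \<le> real m ^ m"
      using hadamard_inequality[of m G] by simp
    then show ?thesis by (simp add: real_le_rsqrt)
  qed
  moreover have "(\<Prod>i<m. \<alpha> i * \<beta> i) \<ge> 0"
    using assms by (intro prod_nonneg) (auto intro: less_imp_le)
  ultimately show ?thesis
    by (simp add: abs_mult mult.commute mult_right_mono)
qed

lemma borel_measurable_fdet_mat:
  assumes "\<And>i j. i < m \<Longrightarrow> j < m \<Longrightarrow> (\<lambda>\<xi>. E \<xi> i j) \<in> borel_measurable M"
  shows "(\<lambda>\<xi>. fdet_mat m (E \<xi>)) \<in> borel_measurable M"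
  unfolding fdet_mat_leibniz
  by (intro borel_measurable_sum borel_measurable_times borel_measurable_const borel_measurable_prod assms)
     (auto simp: permutes_in_image[of _ "{..<m}", unfolded lessThan_iff])

section \<open>Dominated integral kernels and mixed Fredholm moments\<close>

definition kcomp :: "'b measure \<Rightarrow> ('a \<Rightarrow> 'b \<Rightarrow> real) \<Rightarrow> ('b \<Rightarrow> 'c \<Rightarrow> real) \<Rightarrow> 'a \<Rightarrow> 'c \<Rightarrow> real" where
  "kcomp N A B x y = (\<integral>z. A x z * B z y \<partial>N)"

text \<open>
  The class of kernels in which all Fredholm series are formed: a bound by a rank-one kernel \<open>a \<otimes> b\<close>. If
  \<open>a * b\<close> is integrable, traces, compositions and determinants converge, however fast one of the two
  weights grows.
\<close>

abbreviation bounded_by :: "'a measure \<Rightarrow> 'b measure \<Rightarrow> ('a \<Rightarrow> real) \<Rightarrow> ('b \<Rightarrow> real) \<Rightarrow> real \<Rightarrow> ('a \<Rightarrow> 'b \<Rightarrow> real) \<Rightarrow> bool"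
  where
  "bounded_by M N a b C A \<equiv> \<forall>x\<in>space M. \<forall>y\<in>space N. \<bar>A x y\<bar> \<le> C * (a x * b y)"

definition dominated :: "'a measure \<Rightarrow> 'b measure \<Rightarrow> ('a \<Rightarrow> real) \<Rightarrow> ('b \<Rightarrow> real) \<Rightarrow> ('a \<Rightarrow> 'b \<Rightarrow> real) \<Rightarrow> bool"
  where
  "dominated M N a b A \<longleftrightarrow> (\<lambda>(x, y). A x y) \<in> borel_measurable (M \<Otimes>\<^sub>M N) \<and>
     (\<exists>C>0. bounded_by M N a b C A)"

text \<open>
  The polarisation of the Fredholm minor: row \<open>i\<close> is taken from the \<open>i\<close>-th kernel of the list.
\<close>

definition mixed_minor :: "('a \<Rightarrow> 'a \<Rightarrow> real) list \<Rightarrow> (nat \<Rightarrow> 'a) \<Rightarrow> real" where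
  "mixed_minor As \<xi> = fdet_mat (length As) (\<lambda>i j. (As ! i) (\<xi> i) (\<xi> j))"

definition moment :: "'a measure \<Rightarrow> ('a \<Rightarrow> 'a \<Rightarrow> real) list \<Rightarrow> real" where
  "moment M As = (\<integral>\<xi>. mixed_minor As \<xi> \<partial>(\<Pi>\<^sub>M i\<in>{..<length As}. M))"

lemma dominatedI:
  assumes "(\<lambda>(x, y). A x y) \<in> borel_measurable (M \<Otimes>\<^sub>M N)"
    and "\<And>x y. x \<in> space M \<Longrightarrow> y \<in> space N \<Longrightarrow> \<bar>A x y\<bar> \<le> C * (a x * b y)"
    and "\<And>x. a x > 0" "\<And>x. b x > 0"
  shows "dominated M N a b A"
proof -
  have "\<bar>A x y\<bar> \<le> (\<bar>C\<bar> + 1) * (a x * b y)" if "x \<in> space M" "y \<in> space N" for x y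
  proof -
    have "\<bar>A x y\<bar> \<le> C * (a x * b y)" using assms(2) that by blast
    also have "\<dots> \<le> (\<bar>C\<bar> + 1) * (a x * b y)"
      using assms(3)[of x] assms(4)[of y] by (intro mult_right_mono) auto
    finally show ?thesis .
  qed
  then show ?thesis unfolding dominated_def using assms(1) by (intro conjI exI[of _ "\<bar>C\<bar> + 1"]) auto
qed

lemma dominatedE:
  assumes "dominated M N a b A"
  obtains C where "C > 0" "bounded_by M N a b C A"
  using assms unfolding dominated_def by auto

lemma dominated_measurable[measurable_dest]:
  "dominated M N a b A \<Longrightarrow> (\<lambda>(x, y). A x y) \<in> borel_measurable (M \<Otimes>\<^sub>M N)"
  by (simp add: dominated_def)

lemma dominated_app:
  assumes "dominated M N a b A" "f \<in> measurable L M" "g \<in> measurable L N"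
  shows "(\<lambda>w. A (f w) (g w)) \<in> borel_measurable L"
  using measurable_compose[OF measurable_Pair[OF assms(2,3)] dominated_measurable[OF assms(1)]] by simp

lemma dominated_add:
  assumes "dominated M N a b A" "dominated M N a b B" "\<And>x. a x > 0" "\<And>x. b x > 0"
  shows "dominated M N a b (\<lambda>x y. A x y + B x y)"
proof -
  obtain C where C: "C > 0" "bounded_by M N a b C A"
    by (rule dominatedE[OF assms(1)])
  obtain D where D: "D > 0" "bounded_by M N a b D B"
    by (rule dominatedE[OF assms(2)])
  note [measurable] = dominated_measurable[OF assms(1)] dominated_measurable[OF assms(2)]
  show ?thesis
  proof (rule dominatedI[where C = "C + D"])
    show "\<bar>A x y + B x y\<bar> \<le> (C + D) * (a x * b y)" if "x \<in> space M" "y \<in> space N" for x y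
      using C(2)[rule_format, OF that] D(2)[rule_format, OF that] by (simp add: distrib_right)
  qed (use assms in measurable)
qed

lemma dominated_uminus:
  "dominated M N a b A \<Longrightarrow> dominated M N a b (\<lambda>x y. - A x y)"
  unfolding dominated_def by (auto simp: case_prod_beta)

locale weighted_space = sigma_finite_measure M for M :: "'a measure" +
  fixes a b :: "'a \<Rightarrow> real"
  assumes weight_measurable[measurable]: "a \<in> borel_measurable M" "b \<in> borel_measurable M"
    and weight_pos: "\<And>x. a x > 0" "\<And>x. b x > 0"
    and weight_integrable: "integrable M (\<lambda>x. a x * b x)"

lemma integrable_real_bound:
  fixes f g :: "'a \<Rightarrow> real"
  assumes "integrable M g" "f \<in> borel_measurable M" "\<And>x. x \<in> space M \<Longrightarrow> \<bar>f x\<bar> \<le> g x"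
  shows "integrable M f"
  by (rule Bochner_Integration.integrable_bound[OF assms(1,2)])
     (use assms(3) in \<open>auto intro!: AE_I2 order_trans[OF _ abs_ge_self]\<close>)

lemma integrable_pair_product_bound:
  fixes f g :: "_ \<Rightarrow> real"
  assumes "sigma_finite_measure M" "sigma_finite_measure N"
    and "F \<in> borel_measurable (M \<Otimes>\<^sub>M N)" and f: "integrable M f" and g: "integrable N g"
    and le: "\<And>x y. x \<in> space M \<Longrightarrow> y \<in> space N \<Longrightarrow> \<bar>F (x, y)\<bar> \<le> C * (f x * g y)"
  shows "integrable (M \<Otimes>\<^sub>M N) (F :: _ \<Rightarrow> real)"
proof -
  interpret pair_sigma_finite M N using assms(1,2) by (simp add: pair_sigma_finite_def)
  have "integrable (M \<Otimes>\<^sub>M N) (\<lambda>(x, y). f x * g y)"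
    using f g by (intro Fubini_integrable) (auto simp: abs_mult)
  then have "integrable (M \<Otimes>\<^sub>M N) (\<lambda>z. C * (case z of (x, y) \<Rightarrow> f x * g y))" by simp
  then show ?thesis
    by (rule integrable_real_bound) (use assms(3) le in \<open>auto simp: space_pair_measure\<close>)
qed

text \<open>
  The middle weights are integrated out and leave a constant, so domination is stable under composition.
\<close>

lemma dominated_kcomp:
  assumes "dominated M N a b A" "dominated N L a' b' B" "\<And>x. a x > 0" "\<And>x. b' x > 0"
    and "integrable N (\<lambda>z. b z * a' z)" "sigma_finite_measure N"
  shows "dominated M L a b' (kcomp N A B)"
    and "x \<in> space M \<Longrightarrow> y \<in> space L \<Longrightarrow> integrable N (\<lambda>z. A x z * B z y)"
proof -
  interpret sigma_finite_measure N by fact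
  obtain C where C: "C > 0" "bounded_by M N a b C A"
    by (rule dominatedE[OF assms(1)])
  obtain D where D: "D > 0" "bounded_by N L a' b' D B"
    by (rule dominatedE[OF assms(2)])
  note [measurable] = dominated_measurable[OF assms(1)] dominated_measurable[OF assms(2)]
  have le: "\<bar>A x z * B z y\<bar> \<le> (C * D * (a x * b' y)) * (b z * a' z)"
    if "x \<in> space M" "y \<in> space L" "z \<in> space N" for x y z
  proof -
    have "\<bar>A x z * B z y\<bar> \<le> (C * (a x * b z)) * (D * (a' z * b' y))"
      unfolding abs_mult using C(2)[rule_format, of x z] D(2)[rule_format, of z y] that by (intro mult_mono) auto
    then show ?thesis by (simp add: algebra_simps)
  qed
  have i1: "integrable N (\<lambda>z. (C * D * (a x * b' y)) * (b z * a' z))" for x y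
    using assms(5) by simp
  show int: "integrable N (\<lambda>z. A x z * B z y)" if "x \<in> space M" "y \<in> space L" for x y
    by (rule integrable_real_bound[OF i1[of x y] _ le[OF that]])
       (use that in \<open>auto intro!: borel_measurable_times dominated_app[OF assms(1)] dominated_app[OF assms(2)]\<close>)
  show "dominated M L a b' (kcomp N A B)"
  proof (rule dominatedI)
    have "(\<lambda>w. \<integral>z. A (fst w) z * B z (snd w) \<partial>N) \<in> borel_measurable (M \<Otimes>\<^sub>M L)"
      by (intro borel_measurable_lebesgue_integral)
         (auto simp: split_beta intro!: borel_measurable_times dominated_app[OF assms(1)] dominated_app[OF assms(2)])
    then show "(\<lambda>(x, y). kcomp N A B x y) \<in> borel_measurable (M \<Otimes>\<^sub>M L)"
      by (simp add: kcomp_def case_prod_beta)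
  next
    fix x y assume xy: "x \<in> space M" "y \<in> space L"
    have "\<bar>kcomp N A B x y\<bar> \<le> (\<integral>z. \<bar>A x z * B z y\<bar> \<partial>N)"
      unfolding kcomp_def by (rule integral_abs_bound)
    also have "\<dots> \<le> (\<integral>z. (C * D * (a x * b' y)) * (b z * a' z) \<partial>N)"
      by (intro integral_mono i1 integrable_abs int xy le) auto
    also have "\<dots> = C * D * (\<integral>z. b z * a' z \<partial>N) * (a x * b' y)" by simp
    finally show "\<bar>kcomp N A B x y\<bar> \<le> C * D * (\<integral>z. b z * a' z \<partial>N) * (a x * b' y)" .
  qed (use assms in auto)
qed

lemma kcomp_assoc:
  assumes "sigma_finite_measure N" "sigma_finite_measure L"
    and "integrable (N \<Otimes>\<^sub>M L) (\<lambda>(z, w). A x z * V z w * B w y)"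
  shows "kcomp L (kcomp N A V) B x y = kcomp N A (kcomp L V B) x y"
proof -
  interpret pair_sigma_finite N L using assms(1,2) by (simp add: pair_sigma_finite_def)
  have "kcomp L (kcomp N A V) B x y = (\<integral>w. \<integral>z. A x z * V z w * B w y \<partial>N \<partial>L)"
    by (simp add: kcomp_def)
  also have "\<dots> = (\<integral>z. \<integral>w. A x z * V z w * B w y \<partial>L \<partial>N)"
    using assms(3) by (intro Fubini_integral) auto
  also have "\<dots> = kcomp N A (kcomp L V B) x y"
    by (simp add: kcomp_def mult.assoc)
  finally show ?thesis .
qed

lemma dominated_assoc:
  assumes A: "dominated M N a b A" and B: "dominated N L a' b' B" and C: "dominated L K a'' b'' C"
    and N: "sigma_finite_measure N" "integrable N (\<lambda>z. b z * a' z)"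
    and L: "sigma_finite_measure L" "integrable L (\<lambda>w. b' w * a'' w)"
    and pos: "\<And>z. b z > 0" "\<And>z. a' z > 0" "\<And>w. b' w > 0" "\<And>x. a x > 0"
    and xy: "x \<in> space M" "y \<in> space K"
  shows "kcomp L (kcomp N A B) C x y = kcomp N A (kcomp L B C) x y"
proof (rule kcomp_assoc[OF N(1) L(1)])
  obtain P where P: "P > 0" "bounded_by M N a b P A" by (rule dominatedE[OF A])
  obtain Q where Q: "Q > 0" "bounded_by N L a' b' Q B" by (rule dominatedE[OF B])
  obtain R where R: "R > 0" "\<forall>x\<in>space L. \<forall>y\<in>space K. \<bar>C x y\<bar> \<le> R * (a'' x * b'' y)" by (rule dominatedE[OF C])
  show "integrable (N \<Otimes>\<^sub>M L) (\<lambda>(z, w). A x z * B z w * C w y)"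
  proof (rule integrable_pair_product_bound[OF N(1) L(1) _ N(2) L(2), where C = "P * Q * R * a x * b'' y"])
    show "(\<lambda>(z, w). A x z * B z w * C w y) \<in> borel_measurable (N \<Otimes>\<^sub>M L)"
      unfolding case_prod_beta using xy
      by (intro borel_measurable_times dominated_app[OF A] dominated_app[OF B]
          dominated_app[OF C]) auto
    fix z w assume zw: "z \<in> space N" "w \<in> space L"
    have "\<bar>A x z * B z w * C w y\<bar> \<le> (P * (a x * b z)) * (Q * (a' z * b' w)) * (R * (a'' w * b'' y))"
      unfolding abs_mult using P Q R zw xy pos by (intro mult_mono) (auto simp: less_imp_le)
    then show "\<bar>case (z, w) of (z, w) \<Rightarrow> A x z * B z w * C w y\<bar> \<le> P * Q * R * a x * b'' y * (b z * a' z * (b' w * a'' w))"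
      by (simp add: algebra_simps)
  qed
qed

lemma moment_cong:
  assumes "length As = length Bs"
    and "\<And>i x y. i < length As \<Longrightarrow> x \<in> space M \<Longrightarrow> y \<in> space M \<Longrightarrow> (As ! i) x y = (Bs ! i) x y"
  shows "moment M As = moment M Bs"
  unfolding moment_def assms(1)[symmetric]
  by (intro Bochner_Integration.integral_cong refl)
     (auto simp: mixed_minor_def assms(1)[symmetric] space_PiM PiE_iff intro!: fdet_mat_cong assms(2))

text \<open>
  Relabelling the coordinates maps boxes to boxes of the same measure.
\<close>

lemma (in sigma_finite_measure) PiM_permute:
  fixes f :: "(nat \<Rightarrow> 'a) \<Rightarrow> real"
  assumes p: "p permutes {..<m}" and f[measurable]: "f \<in> borel_measurable (\<Pi>\<^sub>M i\<in>{..<m}. M)"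
  shows "(\<integral>\<xi>. f (\<lambda>i\<in>{..<m}. \<xi> (p i)) \<partial>(\<Pi>\<^sub>M i\<in>{..<m}. M)) = (\<integral>\<xi>. f \<xi> \<partial>(\<Pi>\<^sub>M i\<in>{..<m}. M))"
    and "integrable (\<Pi>\<^sub>M i\<in>{..<m}. M) (\<lambda>\<xi>. f (\<lambda>i\<in>{..<m}. \<xi> (p i))) \<longleftrightarrow> integrable (\<Pi>\<^sub>M i\<in>{..<m}. M) f"
proof -
  interpret product_sigma_finite "\<lambda>_::nat. M" by unfold_locales
  let ?P = "\<Pi>\<^sub>M i\<in>{..<m}. M"
  let ?T = "\<lambda>\<xi>. \<lambda>i\<in>{..<m}. \<xi> (p i)"
  have pm: "p i < m" if "i < m" for i using that permutes_in_image[OF p] by auto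
  have T[measurable]: "?T \<in> measurable ?P ?P"
    by (intro measurable_restrict measurable_component_singleton) (auto simp: pm)
  have dist: "distr ?P ?P ?T = ?P"
  proof (rule PiM_eqI)
    fix A assume A: "\<And>i. i \<in> {..<m} \<Longrightarrow> A i \<in> sets M"
    have "emeasure (distr ?P ?P ?T) (Pi\<^sub>E {..<m} A) = emeasure ?P (?T -` (Pi\<^sub>E {..<m} A) \<inter> space ?P)"
      using A by (intro emeasure_distr T sets_PiM_I_finite) auto
    also have "?T -` (Pi\<^sub>E {..<m} A) \<inter> space ?P = Pi\<^sub>E {..<m} (\<lambda>i. A (inv_into UNIV p i))"
    proof (intro Set.set_eqI iffI)
      fix \<xi> assume \<xi>: "\<xi> \<in> ?T -` (Pi\<^sub>E {..<m} A) \<inter> space ?P"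
      have "\<xi> i \<in> A (inv_into UNIV p i)" if "i < m" for i
      proof -
        have "inv_into UNIV p i < m" using that permutes_in_image[OF permutes_inv[OF p]] by auto
        then show ?thesis
          using \<xi> by (auto simp: PiE_iff permutes_inverses[OF p])
            (metis lessThan_iff permutes_inverses(1)[OF p])
      qed
      then show "\<xi> \<in> Pi\<^sub>E {..<m} (\<lambda>i. A (inv_into UNIV p i))"
        using \<xi> by (auto simp: space_PiM PiE_iff)
    next
      fix \<xi> assume \<xi>: "\<xi> \<in> Pi\<^sub>E {..<m} (\<lambda>i. A (inv_into UNIV p i))"
      have "\<xi> (p i) \<in> A i" if "i < m" for i
        using \<xi> pm[OF that] permutes_inverses(2)[OF p, of i] by (metis PiE_mem lessThan_iff)
      moreover have "\<xi> i \<in> space M" if "i < m" for i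
      proof -
        have "inv_into UNIV p i < m" using that permutes_in_image[OF permutes_inv[OF p]] by auto
        then show ?thesis using \<xi> A[of "inv_into UNIV p i"] that sets.sets_into_space by (fastforce simp: PiE_iff)
      qed
      ultimately show "\<xi> \<in> ?T -` (Pi\<^sub>E {..<m} A) \<inter> space ?P"
        using \<xi> by (auto simp: space_PiM PiE_iff)
    qed
    also have "emeasure ?P (Pi\<^sub>E {..<m} (\<lambda>i. A (inv_into UNIV p i))) = (\<Prod>i<m. emeasure M (A (inv_into UNIV p i)))"
    proof (rule emeasure_PiM)
      show "A (inv_into UNIV p i) \<in> sets M" if "i \<in> {..<m}" for i
        using that A permutes_in_image[OF permutes_inv[OF p]] by auto
    qed auto
    also have "\<dots> = (\<Prod>i<m. emeasure M (A i))"
      using prod.permute[OF permutes_inv[OF p], of "\<lambda>i. emeasure M (A i)"] by (simp add: o_def)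
    finally show "emeasure (distr ?P ?P ?T) (Pi\<^sub>E {..<m} A) = (\<Prod>i<m. emeasure M (A i))" .
  qed auto
  show "(\<integral>\<xi>. f (?T \<xi>) \<partial>?P) = (\<integral>\<xi>. f \<xi> \<partial>?P)"
    using integral_distr[OF T f] by (simp only: dist)
  show "integrable ?P (\<lambda>\<xi>. f (?T \<xi>)) \<longleftrightarrow> integrable ?P f"
    using integrable_distr_eq[OF T f] by (simp only: dist)
qed

context weighted_space
begin

sublocale PM: product_sigma_finite "\<lambda>_::nat. M" by unfold_locales

abbreviation "adm \<equiv> dominated M M a b"

lemmas adm_add = dominated_add[where M = M and N = M and a = a and b = b, OF _ _ weight_pos]

lemma adm_kcomp:
  assumes "adm A" "adm B"
  shows "adm (kcomp M A B)"
    and "x \<in> space M \<Longrightarrow> y \<in> space M \<Longrightarrow> integrable M (\<lambda>z. A x z * B z y)"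
  using dominated_kcomp[OF assms weight_pos] weight_integrable sigma_finite_measure_axioms
  by (auto simp: mult.commute)

lemma adm_list_const:
  assumes "\<And>A. A \<in> set As \<Longrightarrow> adm A"
  obtains C where "C > 0" "\<forall>A\<in>set As. bounded_by M M a b C A"
proof -
  have "\<exists>C>0. \<forall>A\<in>set As. bounded_by M M a b C A"
    using assms
  proof (induction As)
    case Nil
    then show ?case by (auto intro: exI[of _ 1])
  next
    case (Cons A As)
    then obtain C where C: "C > 0" "\<And>B x y. B \<in> set As \<Longrightarrow> x \<in> space M \<Longrightarrow> y \<in> space M \<Longrightarrow> \<bar>B x y\<bar> \<le> C * (a x * b y)"
      by auto
    have "adm A" using Cons.prems by simp
    obtain D where D: "D > 0" "bounded_by M M a b D A"
      by (rule dominatedE[OF \<open>adm A\<close>])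
    have mono: "X * (a x * b y) \<le> max C D * (a x * b y)" if "X \<le> max C D" for X x y
      using that weight_pos[of x] weight_pos[of y] by (intro mult_right_mono) auto
    show ?case
    proof (intro exI[of _ "max C D"] conjI ballI)
      fix B x y assume "B \<in> set (A # As)" "x \<in> space M" "y \<in> space M"
      then show "\<bar>B x y\<bar> \<le> max C D * (a x * b y)"
        using C(2)[of B x y] D(2)[rule_format, of x y] mono[of C x y] mono[of D x y] by fastforce
    qed (use C(1) in simp)
  qed
  then show thesis using that by auto
qed

lemma integrable_PiM_weight_bound:
  fixes f :: "(nat \<Rightarrow> 'a) \<Rightarrow> real"
  assumes "f \<in> borel_measurable (\<Pi>\<^sub>M i\<in>{..<m}. M)"
    and le: "\<And>\<xi>. \<xi> \<in> space (\<Pi>\<^sub>M i\<in>{..<m}. M) \<Longrightarrow> \<bar>f \<xi>\<bar> \<le> K * (\<Prod>i<m. a (\<xi> i) * b (\<xi> i))"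
  shows "integrable (\<Pi>\<^sub>M i\<in>{..<m}. M) f"
    and "\<bar>\<integral>\<xi>. f \<xi> \<partial>(\<Pi>\<^sub>M i\<in>{..<m}. M)\<bar> \<le> K * (\<integral>x. a x * b x \<partial>M) ^ m"
proof -
  let ?P = "\<Pi>\<^sub>M i\<in>{..<m}. M" and ?g = "\<lambda>\<xi>. K * (\<Prod>i<m. a (\<xi> i) * b (\<xi> i))"
  have g: "integrable ?P ?g"
    using PM.product_integrable_prod[of "{..<m}" "\<lambda>_ x. a x * b x"] weight_integrable by simp
  show f: "integrable ?P f"
    by (rule integrable_real_bound[OF g assms(1) le])
  have "\<bar>\<integral>\<xi>. f \<xi> \<partial>?P\<bar> \<le> (\<integral>\<xi>. \<bar>f \<xi>\<bar> \<partial>?P)" by (rule integral_abs_bound)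
  also have "\<dots> \<le> (\<integral>\<xi>. ?g \<xi> \<partial>?P)" by (intro integral_mono integrable_abs f g le)
  also have "\<dots> = K * (\<integral>x. a x * b x \<partial>M) ^ m"
    using PM.product_integral_prod[of "{..<m}" "\<lambda>_ x. a x * b x"] weight_integrable by simp
  finally show "\<bar>\<integral>\<xi>. f \<xi> \<partial>?P\<bar> \<le> K * (\<integral>x. a x * b x \<partial>M) ^ m" .
qed

lemma mixed_minor_measurable:
  assumes "\<And>A. A \<in> set As \<Longrightarrow> adm A"
  shows "mixed_minor As \<in> borel_measurable (\<Pi>\<^sub>M i\<in>{..<length As}. M)"
  unfolding mixed_minor_def[abs_def]
  by (intro borel_measurable_fdet_mat dominated_app[of M M a b] assms measurable_component_singleton) auto

lemma mixed_minor_bound: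
  assumes "\<And>A x y. A \<in> set As \<Longrightarrow> x \<in> space M \<Longrightarrow> y \<in> space M \<Longrightarrow> \<bar>A x y\<bar> \<le> C * (a x * b y)"
    and "C > 0" and "\<xi> \<in> space (\<Pi>\<^sub>M i\<in>{..<length As}. M)"
  shows "\<bar>mixed_minor As \<xi>\<bar> \<le> (sqrt (real (length As) ^ length As) * C ^ length As) * (\<Prod>i<length As. a (\<xi> i) * b (\<xi> i))"
proof -
  have \<xi>: "\<xi> i \<in> space M" if "i < length As" for i using assms(3) that by (auto simp: space_PiM PiE_iff)
  have "\<bar>mixed_minor As \<xi>\<bar> \<le> sqrt (real (length As) ^ length As) * (\<Prod>i<length As. (C * a (\<xi> i)) * b (\<xi> i))"
    unfolding mixed_minor_def
    by (rule fdet_mat_bound) (use assms(1,2) \<xi> weight_pos in \<open>auto simp: mult.assoc\<close>)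
  then show ?thesis by (simp add: prod.distrib mult.assoc)
qed

lemma moment_integrable:
  assumes "\<And>A. A \<in> set As \<Longrightarrow> adm A"
  shows "integrable (\<Pi>\<^sub>M i\<in>{..<length As}. M) (mixed_minor As)"
proof -
  obtain C where "C > 0" "\<forall>A\<in>set As. bounded_by M M a b C A"
    by (rule adm_list_const[OF assms])
  then show ?thesis
    by (intro integrable_PiM_weight_bound(1)[OF mixed_minor_measurable[OF assms], where
          K = "sqrt (real (length As) ^ length As) * C ^ length As"] mixed_minor_bound) auto
qed

lemma moment_bound:
  assumes "\<And>A. A \<in> set As \<Longrightarrow> adm A"
    and "\<And>A x y. A \<in> set As \<Longrightarrow> x \<in> space M \<Longrightarrow> y \<in> space M \<Longrightarrow> \<bar>A x y\<bar> \<le> C * (a x * b y)"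
    and "C > 0"
  shows "\<bar>moment M As\<bar>
    \<le> sqrt (real (length As) ^ length As) * (C * (\<integral>x. a x * b x \<partial>M)) ^ length As"
  using integrable_PiM_weight_bound(2)[where f = "mixed_minor As" and m = "length As"
      and K = "sqrt (real (length As) ^ length As) * C ^ length As"]
    mixed_minor_measurable[of As] mixed_minor_bound[of As C] assms
  by (simp add: moment_def power_mult_distrib mult.assoc)

text \<open>
  Permuting the kernels amounts to permuting rows and columns simultaneously and relabelling the integration
  variables.
\<close>

lemma moment_mset:
  assumes "mset As = mset Bs" "\<And>A. A \<in> set As \<Longrightarrow> adm A"
  shows "moment M As = moment M Bs"
proof -
  obtain p where p: "p permutes {..<length Bs}" "permute_list p Bs = As"
    using mset_eq_permutation[OF assms(1)] by blast
  define m where "m = length Bs"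
  have len: "length As = m" using assms(1) mset_eq_length m_def by metis
  have Bs: "adm B" if "B \<in> set Bs" for B using assms that by (metis set_mset_mset)
  have pm: "p i < m" "inv_into UNIV p i < m" if "i < m" for i
    using that permutes_in_image[OF p(1)] permutes_in_image[OF permutes_inv[OF p(1)]] by (auto simp: m_def)
  have "mixed_minor As \<xi> = mixed_minor Bs (\<lambda>i\<in>{..<m}. \<xi> (inv_into UNIV p i))" for \<xi>
  proof -
    let ?\<zeta> = "\<lambda>i\<in>{..<m}. \<xi> (inv_into UNIV p i)"
    have "mixed_minor As \<xi> = fdet_mat m (\<lambda>i j. (Bs ! p i) (?\<zeta> (p i)) (?\<zeta> (p j)))"
      unfolding mixed_minor_def len
    proof (rule fdet_mat_cong)
      fix i j assume "i < m" "j < m"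
      then show "(As ! i) (\<xi> i) (\<xi> j) = (Bs ! p i) (?\<zeta> (p i)) (?\<zeta> (p j))"
        using permute_list_nth[OF p(1), of i] pm[of i] pm[of j]
        by (simp add: p(2) m_def permutes_inverses[OF p(1)])
    qed
    also have "\<dots> = mixed_minor Bs ?\<zeta>"
      unfolding mixed_minor_def m_def[symmetric] by (rule fdet_mat_permute) (use p(1) m_def in simp)
    finally show ?thesis .
  qed
  then have "moment M As = (\<integral>\<xi>. mixed_minor Bs (\<lambda>i\<in>{..<m}. \<xi> (inv_into UNIV p i)) \<partial>(\<Pi>\<^sub>M i\<in>{..<m}. M))"
    by (simp add: moment_def len)
  also have "\<dots> = moment M Bs"
    unfolding moment_def m_def
    by (rule PiM_permute(1)[OF permutes_inv[OF p(1)] mixed_minor_measurable[OF Bs]])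
  finally show ?thesis .
qed

end

section \<open>The recursion for mixed moments\<close>

context weighted_space
begin

text \<open>
  In the Laplace expansion along the row of \<open>A\<close> the diagonal entry contributes the trace of \<open>A\<close>. The
  entry in column \<open>k\<close> contains \<open>A (\<xi> m) (\<xi> k)\<close> times a determinant in which row \<open>k\<close> starts at
  \<open>\<xi> k\<close> and column \<open>k\<close> ends at \<open>\<xi> m\<close>. After the variables \<open>\<xi> k\<close> and \<open>\<xi> m\<close> are exchanged, the only
  dependence on \<open>\<xi> m\<close> is through \<open>A (\<xi> k) (\<xi> m)\<close> and row \<open>k\<close>, and integrating over \<open>\<xi> m\<close> turns
  row \<open>k\<close> into a row of the composition of \<open>A\<close> with the \<open>k\<close>-th kernel.
\<close>

lemma moment_snoc:
  assumes A: "adm A" and As: "\<And>B. B \<in> set As \<Longrightarrow> adm B"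
  shows "moment M (As @ [A]) = (\<integral>x. A x x \<partial>M) * moment M As
    - (\<Sum>k<length As. moment M (As[k := kcomp M A (As ! k)]))"
proof -
  define m where "m = length As"
  let ?P = "\<Pi>\<^sub>M i\<in>{..<Suc m}. M" and ?Q = "\<Pi>\<^sub>M i\<in>{..<m}. M"
  define f0 where "f0 \<xi> = A (\<xi> m) (\<xi> m) * mixed_minor As \<xi>" for \<xi>
  define f where "f k \<xi> = A (\<xi> m) (\<xi> k) * fdet_mat m (\<lambda>i j. (As ! i) (\<xi> i) (\<xi> (if j = k then m else j)))"
    for k \<xi>
  define E where "E \<xi> i j = (As ! i) (\<xi> i) (\<xi> j)" for \<xi> i j
  \<comment> \<open>\<open>f k\<close> is the summand of column \<open>k\<close>, and \<open>g k\<close> is the same summand after the exchange of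
    \<open>\<xi> k\<close> and \<open>\<xi> m\<close>.\<close>
  define g where "g k \<xi> = A (\<xi> k) (\<xi> m) * fdet_mat m ((E \<xi>)(k := \<lambda>j. (As ! k) (\<xi> m) (\<xi> j)))" for k \<xi>
  have Asi: "adm (As ! i)" if "i < m" for i using that As by (simp add: m_def)
  have "\<And>B. B \<in> set (A # As) \<Longrightarrow> adm B" using A As by auto
  then obtain C where C: "C > 0" "\<forall>B\<in>set (A # As). bounded_by M M a b C B"
    by (rule adm_list_const)
  have CA: "\<bar>A x y\<bar> \<le> C * (a x * b y)" if "x \<in> space M" "y \<in> space M" for x y
    using C(2) that by simp
  have Ci: "\<bar>(As ! i) x y\<bar> \<le> C * (a x * b y)" if "i < m" "x \<in> space M" "y \<in> space M" for i x y
    using C(2) that by (simp add: m_def)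
  have sp: "\<xi> i \<in> space M" if "\<xi> \<in> space ?P" "i \<le> m" for \<xi> i
    using that by (auto simp: space_PiM PiE_iff)
  let ?K = "sqrt (real m ^ m) * C ^ Suc m"

  have split: "mixed_minor (As @ [A]) \<xi> = f0 \<xi> - (\<Sum>k<m. f k \<xi>)" for \<xi>
    unfolding mixed_minor_def f0_def f_def length_append_singleton m_def[symmetric] fdet_mat_expand_last
    by (intro arg_cong2[where f = "(-)"] arg_cong2[where f = "(*)"] sum.cong refl fdet_mat_cong)
       (auto simp: nth_append m_def)

  have f0: "integrable ?P f0"
  proof (rule integrable_PiM_weight_bound(1))
    show "f0 \<in> borel_measurable ?P"
      unfolding f0_def[abs_def] mixed_minor_def[abs_def] m_def[symmetric]
      by (intro borel_measurable_times borel_measurable_fdet_mat dominated_app[OF A]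
          dominated_app[OF Asi] measurable_component_singleton) auto
    show "\<bar>f0 \<xi>\<bar> \<le> ?K * (\<Prod>i<Suc m. a (\<xi> i) * b (\<xi> i))" if \<xi>: "\<xi> \<in> space ?P" for \<xi>
    proof -
      have "\<bar>mixed_minor As \<xi>\<bar> \<le> sqrt (real m ^ m) * (\<Prod>i<m. (C * a (\<xi> i)) * b (\<xi> i))"
        unfolding mixed_minor_def m_def[symmetric]
        by (rule fdet_mat_bound) (use C(1) weight_pos Ci[OF _ sp[OF \<xi>] sp[OF \<xi>]] in \<open>auto simp: mult.assoc\<close>)
      then have "\<bar>f0 \<xi>\<bar> \<le> (C * (a (\<xi> m) * b (\<xi> m))) * (sqrt (real m ^ m) * (\<Prod>i<m. (C * a (\<xi> i)) * b (\<xi> i)))"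
        unfolding f0_def abs_mult using C(1) weight_pos[of "\<xi> m"] CA[OF sp[OF \<xi>] sp[OF \<xi>], of m m]
        by (intro mult_mono) auto
      then show ?thesis by (simp add: prod.distrib algebra_simps)
    qed
  qed

  have f_meas: "f k \<in> borel_measurable ?P" if k: "k < m" for k
    unfolding f_def[abs_def] using k
    by (intro borel_measurable_times borel_measurable_fdet_mat dominated_app[OF A]
        dominated_app[OF Asi] measurable_component_singleton) auto

  have swap: "(\<integral>\<xi>. f k \<xi> \<partial>?P) = (\<integral>\<xi>. g k \<xi> \<partial>?P)" and g: "integrable ?P (g k)" and f: "integrable ?P (f k)"
    if k: "k < m" for k
  proof -
    let ?p = "Transposition.transpose k m"
    have p: "?p permutes {..<Suc m}" using k by (intro permutes_swap_id) auto
    have fg: "f k (\<lambda>i\<in>{..<Suc m}. \<xi> (?p i)) = g k \<xi>" for \<xi>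
      unfolding f_def g_def E_def using k
      by (intro arg_cong2[where f = "(*)"] fdet_mat_cong) (auto simp: transpose_def)
    show g: "integrable ?P (g k)"
    proof (rule integrable_PiM_weight_bound(1))
      have "(\<lambda>\<xi>. ((E \<xi>)(k := \<lambda>j. (As ! k) (\<xi> m) (\<xi> j))) i j) \<in> borel_measurable ?P" if "i < m" "j < m" for i j
        using that k by (cases "i = k")
          (auto simp: E_def intro!: dominated_app[OF Asi] measurable_component_singleton)
      then show "g k \<in> borel_measurable ?P"
        unfolding g_def[abs_def] using k
        by (intro borel_measurable_times borel_measurable_fdet_mat dominated_app[OF A]
            measurable_component_singleton) auto
      fix \<xi> assume \<xi>: "\<xi> \<in> space ?P"
      let ?\<alpha> = "\<lambda>i. a (\<xi> (if i = k then m else i))"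
      have "\<bar>fdet_mat m ((E \<xi>)(k := \<lambda>j. (As ! k) (\<xi> m) (\<xi> j)))\<bar>
          \<le> sqrt (real m ^ m) * (\<Prod>i<m. (C * ?\<alpha> i) * b (\<xi> i))"
        by (rule fdet_mat_bound) (use C(1) weight_pos Ci[OF _ sp[OF \<xi>] sp[OF \<xi>]] in \<open>auto simp: E_def mult.assoc\<close>)
      then have "\<bar>g k \<xi>\<bar> \<le> (C * (a (\<xi> k) * b (\<xi> m))) * (sqrt (real m ^ m) * (\<Prod>i<m. (C * ?\<alpha> i) * b (\<xi> i)))"
        unfolding g_def abs_mult using C(1) weight_pos(1)[of "\<xi> k"] weight_pos(2)[of "\<xi> m"] CA[OF sp[OF \<xi>] sp[OF \<xi>], of k m] k
        by (intro mult_mono) auto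
      also have "\<dots> = sqrt (real m ^ m) * C ^ Suc m * ((b (\<xi> m) * (\<Prod>i<m. b (\<xi> i))) * (a (\<xi> k) * (\<Prod>j<m. ?\<alpha> j)))"
        by (simp add: prod.distrib algebra_simps)
      also have "a (\<xi> k) * (\<Prod>j<m. ?\<alpha> j) = (\<Prod>j<Suc m. a (\<xi> j))"
      proof -
        have "(\<Prod>j<m. ?\<alpha> j) = ?\<alpha> k * (\<Prod>j\<in>{..<m} - {k}. ?\<alpha> j)"
          using k by (subst prod.remove[of _ k]) auto
        moreover have "(\<Prod>j\<in>{..<m} - {k}. ?\<alpha> j) = (\<Prod>j\<in>{..<m} - {k}. a (\<xi> j))"
          by (rule prod.cong) auto
        moreover have "(\<Prod>j<m. a (\<xi> j)) = a (\<xi> k) * (\<Prod>j\<in>{..<m} - {k}. a (\<xi> j))"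
          using k by (subst prod.remove[of _ k]) auto
        ultimately show ?thesis by simp
      qed
      finally show "\<bar>g k \<xi>\<bar> \<le> ?K * (\<Prod>i<Suc m. a (\<xi> i) * b (\<xi> i))" by (simp add: prod.distrib algebra_simps)
    qed
    show "(\<integral>\<xi>. f k \<xi> \<partial>?P) = (\<integral>\<xi>. g k \<xi> \<partial>?P)" "integrable ?P (f k)"
      using PiM_permute[OF p f_meas[OF k]] g by (simp_all only: fg)
  qed

  have int_f0: "(\<integral>\<xi>. f0 \<xi> \<partial>?P) = (\<integral>x. A x x \<partial>M) * moment M As"
  proof -
    have "(\<integral>\<xi>. f0 \<xi> \<partial>?P) = (\<integral>\<xi>. \<integral>y. f0 (\<xi>(m := y)) \<partial>M \<partial>?Q)"
      using PM.product_integral_insert[of "{..<m}" m f0] f0 by (simp add: lessThan_Suc)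
    also have "\<dots> = (\<integral>\<xi>. (\<integral>y. A y y \<partial>M) * mixed_minor As \<xi> \<partial>?Q)"
    proof (intro Bochner_Integration.integral_cong refl)
      fix \<xi>
      have "mixed_minor As (\<xi>(m := y)) = mixed_minor As \<xi>" for y
        unfolding mixed_minor_def by (rule fdet_mat_cong) (auto simp: m_def)
      then show "(\<integral>y. f0 (\<xi>(m := y)) \<partial>M) = (\<integral>y. A y y \<partial>M) * mixed_minor As \<xi>"
        by (simp add: f0_def)
    qed
    finally show ?thesis by (simp add: moment_def m_def)
  qed

  have int_f: "(\<integral>\<xi>. f k \<xi> \<partial>?P) = moment M (As[k := kcomp M A (As ! k)])" if k: "k < m" for k
  proof -
    have "(\<integral>\<xi>. f k \<xi> \<partial>?P) = (\<integral>\<xi>. \<integral>y. g k (\<xi>(m := y)) \<partial>M \<partial>?Q)"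
      unfolding swap[OF k]
      using PM.product_integral_insert[of "{..<m}" m "g k"] g[OF k] by (simp add: lessThan_Suc)
    also have "\<dots> = (\<integral>\<xi>. mixed_minor (As[k := kcomp M A (As ! k)]) \<xi> \<partial>?Q)"
    proof (intro Bochner_Integration.integral_cong refl)
      fix \<xi> assume \<xi>: "\<xi> \<in> space ?Q"
      have sp': "\<xi> i \<in> space M" if "i < m" for i using \<xi> that by (auto simp: space_PiM PiE_iff)
      obtain c where c: "\<And>r. fdet_mat m ((E \<xi>)(k := r)) = (\<Sum>j<m. r j * c j)"
        using fdet_mat_row_linear[OF k, of "E \<xi>"] by metis
      have "g k (\<xi>(m := y)) = A (\<xi> k) y * fdet_mat m ((E \<xi>)(k := \<lambda>j. (As ! k) y (\<xi> j)))" for y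
        unfolding g_def E_def using k
        by (intro arg_cong2[where f = "(*)"] fdet_mat_cong) auto
      also have "\<dots> y = (\<Sum>j<m. (A (\<xi> k) y * (As ! k) y (\<xi> j)) * c j)" for y
        unfolding c by (simp add: sum_distrib_left mult.assoc)
      finally have "(\<integral>y. g k (\<xi>(m := y)) \<partial>M) = (\<integral>y. (\<Sum>j<m. (A (\<xi> k) y * (As ! k) y (\<xi> j)) * c j) \<partial>M)"
        by simp
      also have "\<dots> = (\<Sum>j<m. kcomp M A (As ! k) (\<xi> k) (\<xi> j) * c j)"
        unfolding kcomp_def
        by (subst Bochner_Integration.integral_sum)
           (auto intro!: integrable_mult_left adm_kcomp(2)[OF A Asi[OF k]] sp' k)
      also have "\<dots> = fdet_mat m ((E \<xi>)(k := \<lambda>j. kcomp M A (As ! k) (\<xi> k) (\<xi> j)))"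
        by (rule c[symmetric])
      also have "\<dots> = mixed_minor (As[k := kcomp M A (As ! k)]) \<xi>"
        unfolding mixed_minor_def length_list_update m_def[symmetric]
        by (rule fdet_mat_cong) (auto simp: E_def m_def)
      finally show "(\<integral>y. g k (\<xi>(m := y)) \<partial>M) = mixed_minor (As[k := kcomp M A (As ! k)]) \<xi>" .
    qed
    finally show ?thesis by (simp add: moment_def m_def)
  qed

  have "moment M (As @ [A]) = (\<integral>\<xi>. f0 \<xi> - (\<Sum>k<m. f k \<xi>) \<partial>?P)"
    by (simp add: moment_def split m_def)
  also have "\<dots> = (\<integral>\<xi>. f0 \<xi> \<partial>?P) - (\<Sum>k<m. \<integral>\<xi>. f k \<xi> \<partial>?P)"
    using f0 f by (subst Bochner_Integration.integral_diff) (auto simp: Bochner_Integration.integral_sum)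
  also have "\<dots> = (\<integral>x. A x x \<partial>M) * moment M As
      - (\<Sum>k<m. moment M (As[k := kcomp M A (As ! k)]))"
    using int_f0 int_f by simp
  finally show ?thesis by (simp add: m_def)
qed

lemma moment_Cons:
  assumes A: "adm A" and As: "\<And>B. B \<in> set As \<Longrightarrow> adm B"
  shows "moment M (A # As) = (\<integral>x. A x x \<partial>M) * moment M As
    - (\<Sum>k<length As. moment M (As[k := kcomp M A (As ! k)]))"
  using moment_mset[of "A # As" "As @ [A]"] moment_snoc[OF assms] assms by auto

lemma moment_Nil: "moment M [] = 1"
proof -
  have "Determinant.det (Matrix.mat 0 0 (\<lambda>(i, j). ([] ! i) (\<xi> i) (\<xi> j))) = (1 :: real)" for \<xi> :: "nat \<Rightarrow> 'a"
    by (subst det_def') auto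
  then show ?thesis
    by (simp add: moment_def mixed_minor_def fdet_mat_leibniz PiM_empty integral_count_space_nat
      lebesgue_integral_count_space_finite)
qed

lemma moment_update_add:
  assumes "\<And>C. C \<in> set As \<Longrightarrow> adm C" "adm B" "adm B'" "k < length As"
  shows "moment M (As[k := \<lambda>x y. B x y + B' x y])
    = moment M (As[k := B]) + moment M (As[k := B'])"
proof -
  have "mixed_minor (As[k := \<lambda>x y. B x y + B' x y]) \<xi>
      = mixed_minor (As[k := B]) \<xi> + mixed_minor (As[k := B']) \<xi>" for \<xi>
  proof -
    define m where "m = length As"
    let ?E = "\<lambda>i j. (As ! i) (\<xi> i) (\<xi> j)"
    obtain c where c: "\<And>r. fdet_mat m (?E(k := r)) = (\<Sum>j<m. r j * c j)"
      using fdet_mat_row_linear[of k m ?E] assms(4) by (metis m_def)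
    have *: "mixed_minor (As[k := D]) \<xi> = (\<Sum>j<m. D (\<xi> k) (\<xi> j) * c j)" for D
      unfolding c[symmetric] mixed_minor_def length_list_update m_def[symmetric]
      by (rule fdet_mat_cong) (auto simp: m_def assms(4))
    show ?thesis unfolding * by (simp add: algebra_simps sum.distrib)
  qed
  moreover have "adm D \<Longrightarrow> C \<in> set (As[k := D]) \<Longrightarrow> adm C" for C D
    using assms(1) set_update_subset_insert[of As k D] by auto
  ultimately show ?thesis
    using moment_integrable[of "As[k := B]"] moment_integrable[of "As[k := B']"] assms(2,3)
    by (simp add: moment_def)
qed

end

section \<open>Multiplicativity of the Fredholm determinant\<close>

lemma infsum_eq_suminf:
  fixes f :: "nat \<Rightarrow> real"
  assumes "f summable_on UNIV"
  shows "infsum f UNIV = suminf f"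
  using has_sum_imp_sums[OF has_sum_infsum[OF assms]] by (simp add: sums_iff)

lemma suminf_antidiagonal:
  fixes f :: "nat \<Rightarrow> nat \<Rightarrow> real"
  assumes "summable (\<lambda>m. \<Sum>k\<le>m. \<bar>f (m - k) k\<bar>)"
  shows "(\<Sum>m. \<Sum>k\<le>m. f (m - k) k) = (\<Sum>k. \<Sum>l. f l k)"
proof -
  let ?D = "Sigma (UNIV :: nat set) (\<lambda>m. {..m})"
  let ?F = "\<lambda>(m, k). f (m - k) k" and ?G = "\<lambda>(k, l). f l k"
  have abs: "(\<lambda>z. norm (?F z)) summable_on ?D"
    unfolding Infinite_Sum.abs_summable_on_Sigma_iff
    using assms by (auto simp: summable_on_UNIV_nonneg_real_iff sum_nonneg)
  then have D: "?F summable_on ?D" by (rule Infinite_Sum.abs_summable_summable)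
  have bij: "bij_betw (\<lambda>(m, k). (k, m - k)) ?D (UNIV \<times> UNIV)"
    by (rule bij_betwI[where g = "\<lambda>(k, l). (k + l, k)"]) auto
  have FG: "?G (case z of (m, k) \<Rightarrow> (k, m - k)) = ?F z" for z by (cases z) simp
  have G: "?G summable_on UNIV \<times> UNIV"
    using summable_on_reindex_bij_betw[OF bij, of ?G] D by (simp only: FG)
  have "(\<Sum>m. \<Sum>k\<le>m. f (m - k) k) = infsum (\<lambda>m. infsum (\<lambda>k. f (m - k) k) {..m}) UNIV"
  proof -
    have "(\<lambda>m. infsum (\<lambda>k. f (m - k) k) {..m}) summable_on UNIV"
      using summable_on_Sigma_banach[of "\<lambda>m k. f (m - k) k" UNIV "\<lambda>m. {..m}"] D by simp
    from infsum_eq_suminf[OF this] show ?thesis by simp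
  qed
  also have "\<dots> = infsum ?F ?D"
    using infsum_Sigma'_banach[of "\<lambda>m k. f (m - k) k" UNIV "\<lambda>m. {..m}"] D by simp
  also have "\<dots> = infsum ?G (UNIV \<times> UNIV)"
    using infsum_reindex_bij_betw[OF bij, of ?G] by (simp only: FG)
  also have "\<dots> = infsum (\<lambda>k. infsum (\<lambda>l. f l k) UNIV) UNIV"
    using infsum_Sigma'_banach[of "\<lambda>k l. f l k" UNIV "\<lambda>_. UNIV"] G by simp
  also have "\<dots> = (\<Sum>k. \<Sum>l. f l k)"
  proof -
    have "(\<lambda>k. infsum (\<lambda>l. f l k) UNIV) summable_on UNIV"
      using summable_on_Sigma_banach[of "\<lambda>k l. f l k" UNIV "\<lambda>_. UNIV"] G by simp
    moreover have "(\<lambda>l. f l k) summable_on UNIV" for k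
      using summable_on_SigmaD1[of "\<lambda>k l. f l k" UNIV "\<lambda>_. UNIV" k] G by simp
    ultimately show ?thesis by (simp add: infsum_eq_suminf)
  qed
  finally show ?thesis .
qed

text \<open>
  By \<open>m ^ m \<le> exp m * m!\<close> the terms are at most \<open>(D * exp (1/2)) ^ m / sqrt (m!)\<close>. The square root is removed by
  \<open>x \<le> 1 + x\<^sup>2\<close>, applied after a factor \<open>2 ^ m\<close> has been set aside for a geometric series.
\<close>

lemma summable_hadamard:
  assumes "D \<ge> 0"
  shows "summable (\<lambda>m. sqrt (real m ^ m) * D ^ m / fact m)"
proof -
  have pow: "real m ^ m \<le> exp 1 ^ m * fact m" for m
  proof -
    have "(\<lambda>n. real m ^ n /\<^sub>R fact n) sums exp (real m)" by (rule exp_converges)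
    then have "(\<Sum>n\<in>{m}. real m ^ n /\<^sub>R fact n) \<le> exp (real m)"
      by (intro sum_le_suminf[THEN order_trans]) (auto simp: sums_iff)
    then show ?thesis
      by (simp add: exp_of_nat_mult[symmetric] field_simps)
  qed
  have "summable (\<lambda>m. inverse (fact m) * (4 * D\<^sup>2 * exp 1) ^ m)"
    by (rule summable_exp)
  then have "summable (\<lambda>m. (4 * D\<^sup>2 * exp 1) ^ m / fact m)"
    by (simp only: divide_inverse mult.commute)
  then have "summable (\<lambda>m. (1 / 2) ^ m + (4 * D\<^sup>2 * exp 1) ^ m / fact m)"
    by (intro summable_add summable_geometric) auto
  then show ?thesis
  proof (rule summable_comparison_test'[where N = 0])
    fix m :: nat
    define x where "x = 2 ^ m * (sqrt (real m ^ m) * D ^ m / fact m)"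
    have "x\<^sup>2 = (2 ^ m)\<^sup>2 * (sqrt (real m ^ m))\<^sup>2 * (D ^ m)\<^sup>2 / (fact m)\<^sup>2"
      by (simp only: x_def power_mult_distrib power_divide times_divide_eq_right mult.assoc)
    also have "\<dots> = (4 * D\<^sup>2) ^ m * real m ^ m / (fact m)\<^sup>2"
    proof -
      have sq: "(y ^ m)\<^sup>2 = (y\<^sup>2) ^ m" for y :: real
        by (simp only: power_mult[symmetric] mult.commute)
      show ?thesis by (simp add: sq power_mult_distrib)
    qed
    also have "\<dots> \<le> (4 * D\<^sup>2) ^ m * (exp 1 ^ m * fact m) / (fact m)\<^sup>2"
      using pow by (intro divide_right_mono mult_left_mono) auto
    also have "\<dots> = (4 * D\<^sup>2 * exp 1) ^ m / fact m"
      by (simp add: power2_eq_square power_mult_distrib)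
    finally have x2: "x\<^sup>2 \<le> (4 * D\<^sup>2 * exp 1) ^ m / fact m" .
    have "0 \<le> (x - 1)\<^sup>2" by simp
    then have "2 * x \<le> 1 + x\<^sup>2" by (simp add: power2_eq_square algebra_simps)
    moreover have "x\<^sup>2 \<ge> 0" by simp
    ultimately have "x \<le> 1 + x\<^sup>2" by linarith
    moreover have "x / 2 ^ m = sqrt (real m ^ m) * D ^ m / fact m" by (simp add: x_def)
    ultimately have "sqrt (real m ^ m) * D ^ m / fact m \<le> (1 + x\<^sup>2) / 2 ^ m"
      by (metis divide_right_mono zero_le_numeral zero_le_power)
    also have "\<dots> \<le> 1 / 2 ^ m + x\<^sup>2 / 1"
      unfolding add_divide_distrib by (intro add_left_mono divide_left_mono) auto
    also have "\<dots> \<le> (1 / 2) ^ m + (4 * D\<^sup>2 * exp 1) ^ m / fact m"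
      using x2 by (simp add: power_one_over)
    finally show "norm (sqrt (real m ^ m) * D ^ m / fact m) \<le> (1 / 2) ^ m + (4 * D\<^sup>2 * exp 1) ^ m / fact m"
      using assms by simp
  qed
qed

lemma fredholm_minor_eq_mixed: "fredholm_minor J m \<xi> = mixed_minor (replicate m J) \<xi>"
  unfolding fredholm_minor_def mixed_minor_def fdet_mat_def
  by (rule arg_cong[where f = Determinant.det], rule eq_matI) auto

lemma fredholm_term_eq_moment: "fredholm_term M J m = moment M (replicate m J) / fact m"
  unfolding fredholm_term_def moment_def fredholm_minor_eq_mixed by simp

lemma fredholm_det_eq_moments: "fredholm_det M J = (\<Sum>m. moment M (replicate m J) / fact m)"
  unfolding fredholm_det_def fredholm_term_eq_moment ..

lemma fredholm_det_cong:
  assumes "\<And>x y. x \<in> space M \<Longrightarrow> y \<in> space M \<Longrightarrow> J x y = J' x y"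
  shows "fredholm_det M J = fredholm_det M J'"
  unfolding fredholm_det_eq_moments
  by (intro suminf_cong arg_cong2[where f = "(/)"] moment_cong) (auto simp: assms)

lemma mset_map_indicator:
  assumes "S \<subseteq> {..<m}"
  shows "mset (map (\<lambda>i. if i \<in> S then B else A) [0..<m]) = mset (replicate (m - card S) A @ replicate (card S) B)"
proof -
  have fin: "finite S" using assms finite_subset by blast
  have "mset_set {0..<m} = mset_set ({..<m} - S) + mset_set S"
    using assms fin by (subst mset_set_Union[symmetric]) (auto simp: atLeast0LessThan intro!: arg_cong[where f = mset_set])
  then have "mset (map (\<lambda>i. if i \<in> S then B else A) [0..<m])
      = image_mset (\<lambda>i. if i \<in> S then B else A) (mset_set ({..<m} - S)) + image_mset (\<lambda>i. if i \<in> S then B else A) (mset_set S)"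
    by simp
  also have "image_mset (\<lambda>i. if i \<in> S then B else A) (mset_set ({..<m} - S)) = image_mset (\<lambda>i. A) (mset_set ({..<m} - S))"
    by (rule image_mset_cong) auto
  also have "image_mset (\<lambda>i. if i \<in> S then B else A) (mset_set S) = image_mset (\<lambda>i. B) (mset_set S)"
    using fin by (intro image_mset_cong) auto
  finally show ?thesis
    using assms fin by (simp add: image_mset_const_eq card_Diff_subset)
qed

lemma sum_lessThan_plus:
  fixes g :: "nat \<Rightarrow> real"
  shows "(\<Sum>k<l + j. g k) = (\<Sum>k<l. g k) + (\<Sum>k<j. g (l + k))"
  by (induction j) (auto simp: add.assoc)

lemma sum_Pow_card:
  fixes g :: "nat \<Rightarrow> real"
  shows "(\<Sum>S\<in>Pow {..<m}. g (card S)) = (\<Sum>k\<le>m. real (m choose k) * g k)"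
proof -
  have "(\<Sum>S\<in>Pow {..<m}. g (card S)) = (\<Sum>k\<le>m. \<Sum>S | S \<in> Pow {..<m} \<and> card S = k. g (card S))"
    by (rule sum.group[symmetric]) (auto dest!: card_mono[OF finite_lessThan])
  also have "\<dots> = (\<Sum>k\<le>m. real (m choose k) * g k)"
    using n_subsets[of "{..<m}"] by (intro sum.cong refl) (simp add: Pow_def)
  finally show ?thesis .
qed

text \<open>
  The Fredholm determinant of \<open>A\<close> with the kernels \<open>Bs\<close> inserted; the empty list gives the determinant itself.
\<close>

definition moment_series :: "'a measure \<Rightarrow> ('a \<Rightarrow> 'a \<Rightarrow> real) \<Rightarrow> ('a \<Rightarrow> 'a \<Rightarrow> real) list \<Rightarrow> real" where
  "moment_series M A Bs = (\<Sum>l. moment M (replicate l A @ Bs) / fact l)"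

context weighted_space
begin

lemma moment_list_bound:
  assumes "\<And>A. A \<in> set As \<Longrightarrow> adm A"
  obtains q where "q \<ge> 0" "\<forall>Bs. set Bs \<subseteq> set As \<longrightarrow>
    \<bar>moment M Bs\<bar> \<le> sqrt (real (length Bs) ^ length Bs) * q ^ length Bs"
proof -
  obtain C where C: "C > 0" "\<forall>A\<in>set As. bounded_by M M a b C A"
    by (rule adm_list_const[OF assms])
  have "(\<integral>x. a x * b x \<partial>M) \<ge> 0"
    using weight_pos by (intro integral_nonneg_AE AE_I2) (simp add: less_imp_le)
  moreover have "\<bar>moment M Bs\<bar> \<le> sqrt (real (length Bs) ^ length Bs) * (C * (\<integral>x. a x * b x \<partial>M)) ^ length Bs"
    if "set Bs \<subseteq> set As" for Bs
    by (rule moment_bound) (use that C assms in auto)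
  ultimately show ?thesis using C(1) by (intro that[of "C * (\<integral>x. a x * b x \<partial>M)"]) auto
qed

lemma fredholm_det_defined_adm:
  assumes "adm J"
  shows "fredholm_det_defined M J"
  unfolding fredholm_det_defined_def
proof (intro conjI allI)
  fix m
  show "integrable (\<Pi>\<^sub>M i\<in>{..<m}. M) (fredholm_minor J m)"
    using moment_integrable[of "replicate m J"] assms
    by (simp add: fredholm_minor_eq_mixed[abs_def])
next
  have "\<And>A. A \<in> set [J] \<Longrightarrow> adm A" using assms by simp
  then obtain q where q: "q \<ge> 0" "\<forall>Bs. set Bs \<subseteq> set [J] \<longrightarrow>
    \<bar>moment M Bs\<bar> \<le> sqrt (real (length Bs) ^ length Bs) * q ^ length Bs"
    by (rule moment_list_bound)
  show "summable (fredholm_term M J)"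
  proof (rule summable_comparison_test'[OF summable_hadamard[OF q(1)]])
    fix m
    show "norm (fredholm_term M J m) \<le> sqrt (real m ^ m) * q ^ m / fact m"
      using q(2)[rule_format, of "replicate m J"]
      by (auto simp: fredholm_term_eq_moment set_replicate_conv_if intro: divide_right_mono)
  qed
qed

text \<open>
  A moment of \<open>l + length Bs\<close> kernels is divided by \<open>fact l\<close> only; the missing part of the factorial costs at
  most \<open>fact (length Bs) * 2 ^ (l + length Bs)\<close>.
\<close>

lemma moment_series_summable:
  assumes A: "adm A" and Bs: "\<And>B. B \<in> set Bs \<Longrightarrow> adm B"
  shows "summable (\<lambda>l. moment M (replicate l A @ Bs) / fact l)"
proof -
  have "\<And>B. B \<in> set (A # Bs) \<Longrightarrow> adm B" using assms by auto
  then obtain q where q: "q \<ge> 0" "\<forall>Cs. set Cs \<subseteq> set (A # Bs) \<longrightarrow>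
    \<bar>moment M Cs\<bar> \<le> sqrt (real (length Cs) ^ length Cs) * q ^ length Cs"
    by (rule moment_list_bound)
  define j where "j = length Bs"
  define u where "u m = sqrt (real m ^ m) * (2 * q) ^ m / fact m" for m
  have "summable (\<lambda>l. fact j * u (l + j))"
    unfolding u_def using q(1)
    by (intro summable_mult summable_ignore_initial_segment[of _ j] summable_hadamard) auto
  then show ?thesis
  proof (rule summable_comparison_test'[where N = 0])
    fix l
    let ?n = "l + j"
    have "real (?n choose j) \<le> 2 ^ ?n"
      using binomial_le_pow2[of ?n j] by (metis of_nat_le_iff of_nat_numeral of_nat_power)
    then have "fact ?n / (fact j * fact l) \<le> (2 ^ ?n :: real)"
      by (simp add: binomial_fact)
    then have le: "1 / fact l \<le> fact j * 2 ^ ?n / (fact ?n :: real)"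
      by (simp add: field_simps)
    have "\<bar>moment M (replicate l A @ Bs)\<bar> \<le> sqrt (real ?n ^ ?n) * q ^ ?n"
      using q(2)[rule_format, of "replicate l A @ Bs", OF subsetI] by (auto simp: j_def)
    then have "\<bar>moment M (replicate l A @ Bs)\<bar> * (1 / fact l)
        \<le> (sqrt (real ?n ^ ?n) * q ^ ?n) * (fact j * 2 ^ ?n / fact ?n)"
      using le q(1) by (intro mult_mono) auto
    also have "\<dots> = fact j * u ?n" by (simp add: u_def power_mult_distrib)
    finally show "norm (moment M (replicate l A @ Bs) / fact l) \<le> fact j * u ?n" by simp
  qed
qed

text \<open>
  Expanding at \<open>B\<close>, each of the \<open>l\<close> copies of \<open>A\<close> is replaced by \<open>B \<circ> A\<close> in turn. These \<open>l\<close> terms are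
  equal by symmetry and turn \<open>1 / fact l\<close> into \<open>1 / fact (l - 1)\<close>, so they add up to another moment series.
\<close>

lemma moment_series_Cons:
  assumes A: "adm A" and B: "adm B" and Bs: "\<And>B. B \<in> set Bs \<Longrightarrow> adm B"
  shows "moment_series M A (B # Bs) = (\<integral>x. B x x \<partial>M) * moment_series M A Bs
    - moment_series M A (kcomp M B A # Bs)
    - (\<Sum>k<length Bs. moment_series M A (Bs[k := kcomp M B (Bs ! k)]))"
proof -
  have BA: "adm (kcomp M B A)" by (rule adm_kcomp(1)[OF B A])
  have upd: "adm D" if "D \<in> set (Bs[k := kcomp M B (Bs ! k)])" "k < length Bs" for D k
  proof -
    have "D \<in> insert (kcomp M B (Bs ! k)) (set Bs)"
      using that set_update_subset_insert[of Bs k "kcomp M B (Bs ! k)"] by blast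
    moreover have "adm (kcomp M B (Bs ! k))" using that(2) by (intro adm_kcomp(1) B Bs) simp
    ultimately show ?thesis using Bs by blast
  qed
  let ?f = "\<lambda>Cs l. moment M (replicate l A @ Cs) / fact l"
  define g where "g l = (case l of 0 \<Rightarrow> 0 | Suc l \<Rightarrow> ?f (kcomp M B A # Bs) l)" for l
  have S: "?f Cs sums moment_series M A Cs" if "\<And>C. C \<in> set Cs \<Longrightarrow> adm C" for Cs
    unfolding moment_series_def using moment_series_summable[OF A that] by (rule summable_sums)
  have g: "g sums moment_series M A (kcomp M B A # Bs)"
  proof -
    have "(\<lambda>l. g (Suc l)) sums moment_series M A (kcomp M B A # Bs)"
      unfolding g_def nat.case by (rule S) (use BA Bs in auto)
    from sums_Suc[OF this] show ?thesis by (simp add: g_def[abs_def])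
  qed
  have step: "?f (B # Bs) l = (\<integral>x. B x x \<partial>M) * ?f Bs l - g l
      - (\<Sum>k<length Bs. ?f (Bs[k := kcomp M B (Bs ! k)]) l)" for l
  proof -
    let ?R = "replicate l A @ Bs"
    have R: "adm C" if "C \<in> set ?R" for C using that A Bs by auto
    have "moment M (replicate l A @ B # Bs) = moment M (B # ?R)"
      by (rule moment_mset) (use A B Bs in auto)
    also have "\<dots> = (\<integral>x. B x x \<partial>M) * moment M ?R
        - (\<Sum>k<l + length Bs. moment M (?R[k := kcomp M B (?R ! k)]))"
    proof -
      have "moment M (B # ?R) = (\<integral>x. B x x \<partial>M) * moment M ?R
          - (\<Sum>k<length ?R. moment M (?R[k := kcomp M B (?R ! k)]))"
        by (rule moment_Cons[OF B]) (rule R)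
      then show ?thesis by simp
    qed
    also have "(\<Sum>k<l + length Bs. moment M (?R[k := kcomp M B (?R ! k)]))
        = (\<Sum>k<l. moment M (?R[k := kcomp M B (?R ! k)]))
        + (\<Sum>k<length Bs. moment M (?R[l + k := kcomp M B (?R ! (l + k))]))"
      by (rule sum_lessThan_plus)
    also have "(\<Sum>k<l. moment M (?R[k := kcomp M B (?R ! k)])) = fact l * g l"
    proof (cases l)
      case (Suc l')
      have "moment M (?R[k := kcomp M B (?R ! k)]) = moment M (replicate l' A @ kcomp M B A # Bs)"
        if "k < l" for k
      proof (rule moment_mset)
        have "k < length ?R" "?R ! k = A" using that by (auto simp: nth_append)
        then have "mset (?R[k := kcomp M B (?R ! k)]) = add_mset (kcomp M B A) (mset ?R - {#A#})"
          by (simp add: mset_update)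
        also have "\<dots> = mset (replicate l' A @ kcomp M B A # Bs)" by (simp add: Suc)
        finally show m: "mset (?R[k := kcomp M B (?R ! k)]) = mset (replicate l' A @ kcomp M B A # Bs)" .
        show "adm D" if "D \<in> set (?R[k := kcomp M B (?R ! k)])" for D
        proof -
          have "D \<in> set (replicate l' A @ kcomp M B A # Bs)" using that m by (metis set_mset_mset)
          then show ?thesis using A BA Bs by auto
        qed
      qed
      then have "(\<Sum>k<l. moment M (?R[k := kcomp M B (?R ! k)]))
          = l * moment M (replicate l' A @ kcomp M B A # Bs)" by simp
      then show ?thesis by (simp add: g_def Suc)
    qed (simp add: g_def)
    also have "(\<Sum>k<length Bs. moment M (?R[l + k := kcomp M B (?R ! (l + k))]))
        = (\<Sum>k<length Bs. moment M (replicate l A @ Bs[k := kcomp M B (Bs ! k)]))"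
      by (intro sum.cong refl arg_cong[where f = "moment M"]) (auto simp: nth_append list_update_append)
    finally show ?thesis
      by (simp add: diff_divide_distrib sum_divide_distrib add_divide_distrib)
  qed
  have "(\<lambda>l. (\<integral>x. B x x \<partial>M) * ?f Bs l - g l - (\<Sum>k<length Bs. ?f (Bs[k := kcomp M B (Bs ! k)]) l))
      sums ((\<integral>x. B x x \<partial>M) * moment_series M A Bs - moment_series M A (kcomp M B A # Bs)
        - (\<Sum>k<length Bs. moment_series M A (Bs[k := kcomp M B (Bs ! k)])))"
    by (intro sums_diff sums_mult g sums_sum S Bs upd) auto
  then show ?thesis
    unfolding step[symmetric] using S[of "B # Bs"] B Bs by (auto intro: sums_unique2)
qed

lemma moment_series_cong:
  assumes "length Bs = length Cs"
    and "\<And>i x y. i < length Bs \<Longrightarrow> x \<in> space M \<Longrightarrow> y \<in> space M \<Longrightarrow> (Bs ! i) x y = (Cs ! i) x y"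
  shows "moment_series M A Bs = moment_series M A Cs"
  unfolding moment_series_def
  by (intro suminf_cong arg_cong2[where f = "(/)"] moment_cong)
     (auto simp: nth_append assms)

lemma moment_series_add_head:
  assumes A: "adm A" and B: "adm B" "adm B'" and Bs: "\<And>B. B \<in> set Bs \<Longrightarrow> adm B"
  shows "moment_series M A ((\<lambda>x y. B x y + B' x y) # Bs) = moment_series M A (B # Bs) + moment_series M A (B' # Bs)"
proof -
  have "moment M (replicate l A @ (\<lambda>x y. B x y + B' x y) # Bs)
      = moment M (replicate l A @ B # Bs) + moment M (replicate l A @ B' # Bs)" for l
    using moment_update_add[of "replicate l A @ B # Bs" B B' l] A B Bs
    by (auto simp: list_update_append)
  then show ?thesis
    unfolding moment_series_def
    using B Bs by (subst suminf_add) (auto simp: add_divide_distrib intro!: moment_series_summable A)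
qed

lemma adm_kcomp_assoc:
  assumes "adm A" "adm B" "adm C" "x \<in> space M" "y \<in> space M"
  shows "kcomp M (kcomp M A B) C x y = kcomp M A (kcomp M B C) x y"
  by (rule dominated_assoc[OF assms(1-3) sigma_finite_measure_axioms _ sigma_finite_measure_axioms _ weight_pos(2,1,2,1) assms(4,5)])
     (use weight_integrable in \<open>simp_all add: mult.commute\<close>)

lemma kcomp_add_right:
  assumes "adm A" "adm B" "adm C" "x \<in> space M" "y \<in> space M"
  shows "kcomp M A (\<lambda>x y. B x y + C x y) x y = kcomp M A B x y + kcomp M A C x y"
  using adm_kcomp(2)[OF assms(1,2)] adm_kcomp(2)[OF assms(1,3)] assms(4,5)
  by (simp add: kcomp_def distrib_left)

text \<open>
  The kernel \<open>C + C \<circ> A\<close> is \<open>C (I + A)\<close>. In the expansion at such a kernel the term with \<open>C \<circ> A\<close>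
  cancels, and \<open>C \<circ> (C' (I + A)) = (C \<circ> C') (I + A)\<close>. So the left-hand side obeys the recursion
  of the mixed moments of \<open>Cs\<close>, with the determinant of \<open>A\<close> as initial value.
\<close>

lemma moment_series_multiplicative:
  assumes A: "adm A" and Cs: "\<And>C. C \<in> set Cs \<Longrightarrow> adm C"
  shows "moment_series M A (map (\<lambda>C x y. C x y + kcomp M C A x y) Cs) = fredholm_det M A * moment M Cs"
  using Cs
proof (induction "length Cs" arbitrary: Cs)
  case 0
  then show ?case
    by (simp add: moment_series_def fredholm_det_eq_moments moment_Nil)
next
  case (Suc n Ds)
  then obtain C Cs where D: "Ds = C # Cs" by (cases Ds) auto
  let ?t = "\<lambda>C x y. C x y + kcomp M C A x y"
  let ?Bs = "map ?t Cs"
  have C: "adm C" and Cs: "\<And>D. D \<in> set Cs \<Longrightarrow> adm D" and n: "length Cs = n" using Suc D by auto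
  have CA: "adm (kcomp M C A)" by (rule adm_kcomp(1)[OF C A])
  have t: "adm (?t D)" if "adm D" for D by (intro adm_add that adm_kcomp(1) A)
  have Bs: "adm B" if "B \<in> set ?Bs" for B using that t Cs by auto
  have "moment_series M A (map ?t Ds) = moment_series M A (C # ?Bs) + moment_series M A (kcomp M C A # ?Bs)"
    unfolding D list.map by (rule moment_series_add_head[OF A C CA]) (rule Bs)
  also have "\<dots> = (\<integral>x. C x x \<partial>M) * moment_series M A ?Bs
      - (\<Sum>k<length Cs. moment_series M A (?Bs[k := kcomp M C (?Bs ! k)]))"
  proof -
    have "moment_series M A (C # ?Bs) = (\<integral>x. C x x \<partial>M) * moment_series M A ?Bs
        - moment_series M A (kcomp M C A # ?Bs)
        - (\<Sum>k<length ?Bs. moment_series M A (?Bs[k := kcomp M C (?Bs ! k)]))"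
      by (rule moment_series_Cons[OF A C]) (rule Bs)
    then show ?thesis by simp
  qed
  also have "moment_series M A ?Bs = fredholm_det M A * moment M Cs"
    by (rule Suc.hyps(1)) (use n Cs in auto)
  also have "(\<Sum>k<length Cs. moment_series M A (?Bs[k := kcomp M C (?Bs ! k)]))
      = (\<Sum>k<length Cs. fredholm_det M A * moment M (Cs[k := kcomp M C (Cs ! k)]))"
  proof (intro sum.cong refl)
    fix k assume "k \<in> {..<length Cs}"
    then have k: "k < length Cs" by simp
    then have Ck: "adm (Cs ! k)" using Cs by simp
    have "moment_series M A (?Bs[k := kcomp M C (?Bs ! k)])
        = moment_series M A (map ?t (Cs[k := kcomp M C (Cs ! k)]))"
    proof (rule moment_series_cong)
      fix i x y assume i: "i < length (?Bs[k := kcomp M C (?Bs ! k)])" and xy: "x \<in> space M" "y \<in> space M"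
      show "(?Bs[k := kcomp M C (?Bs ! k)] ! i) x y = (map ?t (Cs[k := kcomp M C (Cs ! k)]) ! i) x y"
      proof (cases "i = k")
        case True
        have "kcomp M C (?t (Cs ! k)) x y = kcomp M C (Cs ! k) x y + kcomp M (kcomp M C (Cs ! k)) A x y"
          using kcomp_add_right[OF C Ck adm_kcomp(1)[OF Ck A] xy] adm_kcomp_assoc[OF C Ck A xy] by simp
        then show ?thesis using k True by simp
      qed (use i in simp)
    qed simp
    also have "\<dots> = fredholm_det M A * moment M (Cs[k := kcomp M C (Cs ! k)])"
    proof (rule Suc.hyps(1))
      show "adm D" if "D \<in> set (Cs[k := kcomp M C (Cs ! k)])" for D
        using that Cs adm_kcomp(1)[OF C Ck] set_update_subset_insert[of Cs k "kcomp M C (Cs ! k)"] by auto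
    qed (use n in simp)
    finally show "moment_series M A (?Bs[k := kcomp M C (?Bs ! k)])
        = fredholm_det M A * moment M (Cs[k := kcomp M C (Cs ! k)])" .
  qed
  also have "(\<integral>x. C x x \<partial>M) * (fredholm_det M A * moment M Cs)
      - (\<Sum>k<length Cs. fredholm_det M A * moment M (Cs[k := kcomp M C (Cs ! k)]))
      = fredholm_det M A * moment M Ds"
  proof -
    have "moment M (C # Cs) = (\<integral>x. C x x \<partial>M) * moment M Cs
        - (\<Sum>k<length Cs. moment M (Cs[k := kcomp M C (Cs ! k)]))"
      by (rule moment_Cons[OF C]) (rule Cs)
    note expand = this
    show ?thesis unfolding D expand by (simp add: algebra_simps sum_distrib_left)
  qed
  finally show ?case .
qed

lemma moment_replicate_add:
  assumes A: "adm A" and B: "adm B"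
  shows "moment M (replicate m (\<lambda>x y. A x y + B x y))
    = (\<Sum>k\<le>m. real (m choose k) * moment M (replicate (m - k) A @ replicate k B))"
proof -
  let ?L = "\<lambda>S. map (\<lambda>i. if i \<in> S then B else A) [0..<m]"
  have minor: "mixed_minor (replicate m (\<lambda>x y. A x y + B x y)) \<xi> = (\<Sum>S\<in>Pow {..<m}. mixed_minor (?L S) \<xi>)" for \<xi>
  proof -
    have "mixed_minor (replicate m (\<lambda>x y. A x y + B x y)) \<xi>
        = fdet_mat m (\<lambda>i j. B (\<xi> i) (\<xi> j) + A (\<xi> i) (\<xi> j))"
      unfolding mixed_minor_def length_replicate by (rule fdet_mat_cong) (simp add: add.commute)
    also have "\<dots> = (\<Sum>S\<in>Pow {..<m}. fdet_mat m (\<lambda>i. if i \<in> S then (\<lambda>j. B (\<xi> i) (\<xi> j)) else (\<lambda>j. A (\<xi> i) (\<xi> j))))"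
      by (rule fdet_mat_add)
    also have "\<dots> = (\<Sum>S\<in>Pow {..<m}. mixed_minor (?L S) \<xi>)"
      unfolding mixed_minor_def length_map length_upt diff_zero
      by (intro sum.cong refl fdet_mat_cong) auto
    finally show ?thesis .
  qed
  have L: "adm C" if "C \<in> set (?L S)" for C S using that A B by (auto split: if_splits)
  have int: "integrable (\<Pi>\<^sub>M i\<in>{..<m}. M) (mixed_minor (?L S))" for S
    using moment_integrable[of "?L S", OF L[of _ S]] by simp
  have "moment M (replicate m (\<lambda>x y. A x y + B x y)) = (\<integral>\<xi>. (\<Sum>S\<in>Pow {..<m}. mixed_minor (?L S) \<xi>) \<partial>(\<Pi>\<^sub>M i\<in>{..<m}. M))"
    by (simp add: moment_def minor)
  also have "\<dots> = (\<Sum>S\<in>Pow {..<m}. moment M (?L S))"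
    by (simp add: Bochner_Integration.integral_sum int moment_def)
  also have "\<dots> = (\<Sum>S\<in>Pow {..<m}. moment M (replicate (m - card S) A @ replicate (card S) B))"
    by (intro sum.cong refl moment_mset mset_map_indicator) (simp, erule L)
  also have "\<dots> = (\<Sum>k\<le>m. real (m choose k) * moment M (replicate (m - k) A @ replicate k B))"
    by (rule sum_Pow_card)
  finally show ?thesis .
qed

text \<open>
  Here \<open>I + A + C + C \<circ> A = (I + C) (I + A)\<close>. The moments of \<open>A + B\<close> with \<open>B = C (I + A)\<close> expand
  binomially, and summing over the number of factors \<open>A\<close> first gives the moment series of copies of \<open>B\<close>.
\<close>

theorem fredholm_det_multiplicative:
  assumes A: "adm A" and C: "adm C"
  shows "fredholm_det M (\<lambda>x y. A x y + C x y + kcomp M C A x y) = fredholm_det M A * fredholm_det M C"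
proof -
  define B where "B = (\<lambda>x y. C x y + kcomp M C A x y)"
  have B: "adm B" unfolding B_def by (intro adm_add C adm_kcomp(1) A)
  define f where "f l k = moment M (replicate l A @ replicate k B) / (fact l * fact k)" for l k
  have "\<And>D. D \<in> set [A, B] \<Longrightarrow> adm D" using A B by auto
  then obtain q where q: "q \<ge> 0" "\<forall>Cs. set Cs \<subseteq> set [A, B] \<longrightarrow>
    \<bar>moment M Cs\<bar> \<le> sqrt (real (length Cs) ^ length Cs) * q ^ length Cs"
    by (rule moment_list_bound)
  have f: "f (m - k) k = real (m choose k) * moment M (replicate (m - k) A @ replicate k B) / fact m"
    if "k \<le> m" for m k
    using that by (simp add: f_def binomial_fact mult.commute)
  have "summable (\<lambda>m. \<Sum>k\<le>m. \<bar>f (m - k) k\<bar>)"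
  proof (rule summable_comparison_test'[where N = 0])
    show "summable (\<lambda>m. sqrt (real m ^ m) * (2 * q) ^ m / fact m)"
      using q(1) by (intro summable_hadamard) auto
    fix m
    have "(\<Sum>k\<le>m. \<bar>f (m - k) k\<bar>) \<le> (\<Sum>k\<le>m. real (m choose k) * (sqrt (real m ^ m) * q ^ m) / fact m)"
    proof (intro sum_mono)
      fix k assume k: "k \<in> {..m}"
      have "\<bar>moment M (replicate (m - k) A @ replicate k B)\<bar> \<le> sqrt (real m ^ m) * q ^ m"
        using q(2)[rule_format, of "replicate (m - k) A @ replicate k B", OF subsetI] k by auto
      then show "\<bar>f (m - k) k\<bar> \<le> real (m choose k) * (sqrt (real m ^ m) * q ^ m) / fact m"
        using k by (simp add: f abs_mult divide_right_mono mult_left_mono)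
    qed
    also have "\<dots> = (\<Sum>k\<le>m. real (m choose k)) * (sqrt (real m ^ m) * q ^ m) / fact m"
      by (simp add: sum_divide_distrib sum_distrib_right)
    also have "(\<Sum>k\<le>m. real (m choose k)) = 2 ^ m"
      using choose_row_sum[of m] by (metis of_nat_numeral of_nat_power of_nat_sum)
    finally show "norm (\<Sum>k\<le>m. \<bar>f (m - k) k\<bar>) \<le> sqrt (real m ^ m) * (2 * q) ^ m / fact m"
      by (simp add: sum_nonneg power_mult_distrib mult.left_commute)
  qed
  then have swap: "(\<Sum>m. \<Sum>k\<le>m. f (m - k) k) = (\<Sum>k. \<Sum>l. f l k)"
    by (rule suminf_antidiagonal)
  have "fredholm_det M (\<lambda>x y. A x y + C x y + kcomp M C A x y) = fredholm_det M (\<lambda>x y. A x y + B x y)"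
    by (simp add: B_def add.assoc)
  also have "\<dots> = (\<Sum>m. \<Sum>k\<le>m. f (m - k) k)"
    unfolding fredholm_det_eq_moments moment_replicate_add[OF A B]
    by (intro suminf_cong) (simp add: f sum_divide_distrib)
  also note swap
  also have "(\<lambda>k. \<Sum>l. f l k) = (\<lambda>k. fredholm_det M A * (moment M (replicate k C) / fact k))"
  proof
    fix k
    have "summable (\<lambda>l. moment M (replicate l A @ replicate k B) / fact l)"
      by (rule moment_series_summable[OF A]) (use B in auto)
    from suminf_divide[OF this, of "fact k"]
    have "(\<Sum>l. f l k) = moment_series M A (replicate k B) / fact k"
      by (simp add: f_def moment_series_def)
    also have "moment_series M A (replicate k B) = fredholm_det M A * moment M (replicate k C)"
      using moment_series_multiplicative[OF A, of "replicate k C"] C by (auto simp: B_def map_replicate)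
    finally show "(\<Sum>l. f l k) = fredholm_det M A * (moment M (replicate k C) / fact k)" by simp
  qed
  also have "(\<Sum>k. fredholm_det M A * (moment M (replicate k C) / fact k)) = fredholm_det M A * fredholm_det M C"
  proof -
    have "summable (fredholm_term M C)"
      using fredholm_det_defined_adm[OF C] by (simp add: fredholm_det_defined_def)
    then have "summable (\<lambda>k. moment M (replicate k C) / fact k)"
      by (simp add: fredholm_term_eq_moment[abs_def])
    from suminf_mult[OF this] show ?thesis by (simp only: fredholm_det_eq_moments[of M C])
  qed
  finally show ?thesis .
qed

end

section \<open>Commuting two factors inside a Fredholm determinant\<close>

text \<open>
  A fixed kernel \<open>V\<close> from \<open>N\<close> to \<open>M\<close> is composed with kernels dominated by \<open>a \<otimes> b\<close>. It only has to map
  the weights into each other, because it will also be the heat kernel, which is translation invariant and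
  hence not bounded by a product of two weights whose pointwise product is integrable.
\<close>

locale weighted_space_pair = X: weighted_space M a b' + Y: weighted_space N a' b
  for M :: "'a measure" and N :: "'b measure" and a b' a' b +
  fixes V :: "'b \<Rightarrow> 'a \<Rightarrow> real" and K :: real
  assumes V_measurable: "(\<lambda>(y, x). V y x) \<in> borel_measurable (N \<Otimes>\<^sub>M M)"
    and V_left_integrable: "\<And>y. y \<in> space N \<Longrightarrow> integrable M (\<lambda>x. \<bar>V y x\<bar> * a x)"
    and V_left: "\<And>y. y \<in> space N \<Longrightarrow> (\<integral>x. \<bar>V y x\<bar> * a x \<partial>M) \<le> K * a' y"
    and V_right_integrable: "\<And>x. x \<in> space M \<Longrightarrow> integrable N (\<lambda>y. b y * \<bar>V y x\<bar>)"
    and V_right: "\<And>x. x \<in> space M \<Longrightarrow> (\<integral>y. b y * \<bar>V y x\<bar> \<partial>N) \<le> K * b' x"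
begin

lemma V_measurable_app:
  assumes "f \<in> measurable L N" "g \<in> measurable L M"
  shows "(\<lambda>w. V (f w) (g w)) \<in> borel_measurable L"
  using measurable_compose[OF measurable_Pair[OF assms] V_measurable] by simp

abbreviation "rect \<equiv> dominated M N a b"

lemma dominated_comp_right:
  assumes H: "rect H"
  shows "X.adm (kcomp N H V)"
proof -
  obtain C where C: "C > 0" "bounded_by M N a b C H"
    by (rule dominatedE[OF H])
  show ?thesis
  proof (rule dominatedI)
    have "(\<lambda>w. \<integral>y. H (fst w) y * V y (snd w) \<partial>N) \<in> borel_measurable (M \<Otimes>\<^sub>M M)"
      by (rule Y.borel_measurable_lebesgue_integral, unfold case_prod_beta)
         (intro borel_measurable_times dominated_app[OF H] V_measurable_app; measurable)
    then show "(\<lambda>(x, y). kcomp N H V x y) \<in> borel_measurable (M \<Otimes>\<^sub>M M)"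
      by (simp add: kcomp_def case_prod_beta)
    fix x x' assume x: "x \<in> space M" "x' \<in> space M"
    have "\<bar>kcomp N H V x x'\<bar> \<le> (\<integral>y. \<bar>H x y * V y x'\<bar> \<partial>N)"
      unfolding kcomp_def by (rule integral_abs_bound)
    also have "\<dots> \<le> (\<integral>y. C * a x * (b y * \<bar>V y x'\<bar>) \<partial>N)"
    proof (rule integral_mono')
      show "integrable N (\<lambda>y. C * a x * (b y * \<bar>V y x'\<bar>))" using V_right_integrable[OF x(2)] by simp
      show "\<bar>H x y * V y x'\<bar> \<le> C * a x * (b y * \<bar>V y x'\<bar>)" if "y \<in> space N" for y
        using mult_right_mono[of "\<bar>H x y\<bar>" "C * (a x * b y)" "\<bar>V y x'\<bar>"] C(2) x that
        by (simp add: abs_mult mult.assoc)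
      show "0 \<le> C * a x * (b y * \<bar>V y x'\<bar>)" for y
        using C(1) X.weight_pos(1)[of x] Y.weight_pos(2)[of y] by simp
    qed
    also have "\<dots> = C * a x * (\<integral>y. b y * \<bar>V y x'\<bar> \<partial>N)" by simp
    also have "\<dots> \<le> C * a x * (K * b' x')"
      using V_right[OF x(2)] C(1) X.weight_pos(1)[of x] by (intro mult_left_mono) auto
    finally show "\<bar>kcomp N H V x x'\<bar> \<le> (C * K) * (a x * b' x')" by (simp add: algebra_simps)
  qed (fact X.weight_pos)+
qed

lemma dominated_comp_left:
  assumes H: "rect H"
  shows "Y.adm (kcomp M V H)"
proof -
  obtain C where C: "C > 0" "bounded_by M N a b C H"
    by (rule dominatedE[OF H])
  show ?thesis
  proof (rule dominatedI)
    have "(\<lambda>w. \<integral>x. V (fst w) x * H x (snd w) \<partial>M) \<in> borel_measurable (N \<Otimes>\<^sub>M N)"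
      by (rule X.borel_measurable_lebesgue_integral, unfold case_prod_beta)
         (intro borel_measurable_times dominated_app[OF H] V_measurable_app; measurable)
    then show "(\<lambda>(x, y). kcomp M V H x y) \<in> borel_measurable (N \<Otimes>\<^sub>M N)"
      by (simp add: kcomp_def case_prod_beta)
    fix y y' assume y: "y \<in> space N" "y' \<in> space N"
    have "\<bar>kcomp M V H y y'\<bar> \<le> (\<integral>x. \<bar>V y x * H x y'\<bar> \<partial>M)"
      unfolding kcomp_def by (rule integral_abs_bound)
    also have "\<dots> \<le> (\<integral>x. C * b y' * (\<bar>V y x\<bar> * a x) \<partial>M)"
    proof (rule integral_mono')
      show "integrable M (\<lambda>x. C * b y' * (\<bar>V y x\<bar> * a x))" using V_left_integrable[OF y(1)] by simp
      show "\<bar>V y x * H x y'\<bar> \<le> C * b y' * (\<bar>V y x\<bar> * a x)" if "x \<in> space M" for x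
        using mult_right_mono[of "\<bar>H x y'\<bar>" "C * (a x * b y')" "\<bar>V y x\<bar>"] C(2) y that
        by (simp add: abs_mult algebra_simps)
      show "0 \<le> C * b y' * (\<bar>V y x\<bar> * a x)" for x
        using C(1) X.weight_pos(1)[of x] Y.weight_pos(2)[of y'] by simp
    qed
    also have "\<dots> = C * b y' * (\<integral>x. \<bar>V y x\<bar> * a x \<partial>M)" by simp
    also have "\<dots> \<le> C * b y' * (K * a' y)"
      using V_left[OF y(1)] C(1) Y.weight_pos(2)[of y'] by (intro mult_left_mono) auto
    finally show "\<bar>kcomp M V H y y'\<bar> \<le> (C * K) * (a' y * b y')" by (simp add: algebra_simps)
  qed (fact Y.weight_pos)+
qed

lemma dominated_comp_middle:
  assumes H: "rect H" and H': "rect H'"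
  shows "rect (kcomp N H (kcomp M V H'))"
  by (rule dominated_kcomp(1)[OF H dominated_comp_left[OF H'] X.weight_pos(1) Y.weight_pos(2)])
     (use Y.weight_integrable in \<open>simp_all add: mult.commute Y.sigma_finite_measure_axioms\<close>)

lemma weighted_V_integrable: "integrable (N \<Otimes>\<^sub>M M) (\<lambda>(y, x). b y * \<bar>V y x\<bar> * a x)"
proof -
  interpret P: pair_sigma_finite N M ..
  have pos: "b y * \<bar>V y x\<bar> * a x \<ge> 0" for x y
    using X.weight_pos(1)[of x] Y.weight_pos(2)[of y] by simp
  show ?thesis
  proof (rule P.Fubini_integrable)
    show "(\<lambda>(y, x). b y * \<bar>V y x\<bar> * a x) \<in> borel_measurable (N \<Otimes>\<^sub>M M)"
      unfolding case_prod_beta by (intro borel_measurable_times borel_measurable_abs V_measurable_app) auto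
    then have meas: "(\<lambda>y. \<integral>x. b y * \<bar>V y x\<bar> * a x \<partial>M) \<in> borel_measurable N"
      by (intro X.borel_measurable_lebesgue_integral) (simp add: case_prod_beta)
    show "AE y in N. integrable M (\<lambda>x. case (y, x) of (y, x) \<Rightarrow> b y * \<bar>V y x\<bar> * a x)"
      using V_left_integrable by (auto intro!: AE_I2 simp: mult.assoc)
    have "integrable N (\<lambda>y. K * (a' y * b y))" using Y.weight_integrable by simp
    then have "integrable N (\<lambda>y. \<integral>x. b y * \<bar>V y x\<bar> * a x \<partial>M)"
    proof (rule integrable_real_bound[OF _ meas])
      fix y assume y: "y \<in> space N"
      have "(\<integral>x. b y * \<bar>V y x\<bar> * a x \<partial>M) = b y * (\<integral>x. \<bar>V y x\<bar> * a x \<partial>M)"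
        by (simp add: mult.assoc)
      also have "\<dots> \<le> b y * (K * a' y)"
        using V_left[OF y] Y.weight_pos(2)[of y] by (intro mult_left_mono) auto
      finally have "(\<integral>x. b y * \<bar>V y x\<bar> * a x \<partial>M) \<le> K * (a' y * b y)" by (simp add: algebra_simps)
      moreover have "(\<integral>x. b y * \<bar>V y x\<bar> * a x \<partial>M) \<ge> 0" by (intro integral_nonneg_AE AE_I2 pos)
      ultimately show "\<bar>\<integral>x. b y * \<bar>V y x\<bar> * a x \<partial>M\<bar> \<le> K * (a' y * b y)" by simp
    qed
    then show "integrable N (\<lambda>y. \<integral>x. norm (case (y, x) of (y, x) \<Rightarrow> b y * \<bar>V y x\<bar> * a x) \<partial>M)"
      using pos by simp
  qed
qed

lemma integrable_V_bound:
  assumes "F \<in> borel_measurable (N \<Otimes>\<^sub>M M)"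
    and le: "\<And>x y. x \<in> space M \<Longrightarrow> y \<in> space N \<Longrightarrow> \<bar>F (y, x)\<bar> \<le> C * (b y * \<bar>V y x\<bar> * a x)"
  shows "integrable (N \<Otimes>\<^sub>M M) (F :: _ \<Rightarrow> real)"
proof -
  have "integrable (N \<Otimes>\<^sub>M M) (\<lambda>w. C * (case w of (y, x) \<Rightarrow> b y * \<bar>V y x\<bar> * a x))"
    using weighted_V_integrable by simp
  then show ?thesis
    by (rule integrable_real_bound[OF _ assms(1)]) (use le in \<open>auto simp: space_pair_measure\<close>)
qed

lemma trace_comp_commute:
  assumes H: "rect H"
  shows "(\<integral>x. kcomp N H V x x \<partial>M) = (\<integral>y. kcomp M V H y y \<partial>N)"
proof -
  interpret P: pair_sigma_finite N M ..
  obtain C where C: "C > 0" "bounded_by M N a b C H"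
    by (rule dominatedE[OF H])
  have "integrable (N \<Otimes>\<^sub>M M) (\<lambda>(y, x). H x y * V y x)"
  proof (rule integrable_V_bound)
    show "(\<lambda>(y, x). H x y * V y x) \<in> borel_measurable (N \<Otimes>\<^sub>M M)"
      unfolding case_prod_beta by (intro borel_measurable_times dominated_app[OF H] V_measurable_app) auto
    show "\<bar>case (y, x) of (y, x) \<Rightarrow> H x y * V y x\<bar> \<le> C * (b y * \<bar>V y x\<bar> * a x)"
      if "x \<in> space M" "y \<in> space N" for x y
      using mult_right_mono[of "\<bar>H x y\<bar>" "C * (a x * b y)" "\<bar>V y x\<bar>"] C(2) that
      by (simp add: abs_mult algebra_simps)
  qed
  then have "(\<integral>x. \<integral>y. H x y * V y x \<partial>N \<partial>M) = (\<integral>y. \<integral>x. H x y * V y x \<partial>M \<partial>N)"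
    by (rule P.Fubini_integral)
  then show ?thesis by (simp add: kcomp_def mult.commute)
qed

lemma comp_assoc_middle:
  assumes H: "rect H" and H': "rect H'" and x: "x \<in> space M" and y': "y' \<in> space N"
  shows "kcomp M (kcomp N H V) H' x y' = kcomp N H (kcomp M V H') x y'"
proof (rule kcomp_assoc)
  obtain C where C: "C > 0" "bounded_by M N a b C H"
    by (rule dominatedE[OF H])
  obtain C' where C': "C' > 0" "bounded_by M N a b C' H'"
    by (rule dominatedE[OF H'])
  show "integrable (N \<Otimes>\<^sub>M M) (\<lambda>(y, x'). H x y * V y x' * H' x' y')"
  proof (rule integrable_V_bound[where C = "C * C' * a x * b y'"])
    show "(\<lambda>(y, x'). H x y * V y x' * H' x' y') \<in> borel_measurable (N \<Otimes>\<^sub>M M)"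
      unfolding case_prod_beta using x y'
      by (intro borel_measurable_times dominated_app[OF H] dominated_app[OF H'] V_measurable_app) auto
    fix x' y assume "x' \<in> space M" "y \<in> space N"
    then have "\<bar>H x y * V y x' * H' x' y'\<bar> \<le> (C * (a x * b y)) * \<bar>V y x'\<bar> * (C' * (a x' * b y'))"
      unfolding abs_mult using C C' x y' X.weight_pos(1)[of x] Y.weight_pos(2)[of y]
      by (intro mult_mono) auto
    then show "\<bar>case (y, x') of (y, x') \<Rightarrow> H x y * V y x' * H' x' y'\<bar>
        \<le> C * C' * a x * b y' * (b y * \<bar>V y x'\<bar> * a x')"
      by (simp add: algebra_simps)
  qed
qed unfold_locales

lemma comp_assoc_right:
  assumes H: "rect H" and H': "rect H'" and x: "x \<in> space M" "x' \<in> space M"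
  shows "kcomp M (kcomp N H V) (kcomp N H' V) x x' = kcomp N (kcomp N H (kcomp M V H')) V x x'"
proof -
  obtain C where C: "C > 0" "bounded_by M M a b' C (kcomp N H V)"
    by (rule dominatedE[OF dominated_comp_right[OF H]])
  obtain C' where C': "C' > 0" "bounded_by M N a b C' H'"
    by (rule dominatedE[OF H'])
  have "kcomp N (kcomp M (kcomp N H V) H') V x x' = kcomp M (kcomp N H V) (kcomp N H' V) x x'"
  proof (rule kcomp_assoc)
    show "integrable (M \<Otimes>\<^sub>M N) (\<lambda>(z, y). kcomp N H V x z * H' z y * V y x')"
    proof (rule integrable_pair_product_bound[OF _ _ _ X.weight_integrable V_right_integrable[OF x(2)],
          where C = "C * C' * a x"])
      show "(\<lambda>(z, y). kcomp N H V x z * H' z y * V y x') \<in> borel_measurable (M \<Otimes>\<^sub>M N)"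
        unfolding case_prod_beta using x
        by (intro borel_measurable_times dominated_app[OF dominated_comp_right[OF H]]
            dominated_app[OF H'] V_measurable_app) auto
      fix z y assume "z \<in> space M" "y \<in> space N"
      then have "\<bar>kcomp N H V x z * H' z y * V y x'\<bar> \<le> (C * (a x * b' z)) * (C' * (a z * b y)) * \<bar>V y x'\<bar>"
        unfolding abs_mult using C C' x X.weight_pos[of x] X.weight_pos[of z] Y.weight_pos(2)[of y]
        by (intro mult_mono) auto
      then show "\<bar>case (z, y) of (z, y) \<Rightarrow> kcomp N H V x z * H' z y * V y x'\<bar>
          \<le> C * C' * a x * (a z * b' z * (b y * \<bar>V y x'\<bar>))"
        by (simp add: algebra_simps)
    qed unfold_locales
  qed unfold_locales
  moreover have "kcomp N (kcomp M (kcomp N H V) H') V x x' = kcomp N (kcomp N H (kcomp M V H')) V x x'"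
    unfolding kcomp_def[of N "kcomp M (kcomp N H V) H'" V] kcomp_def[of N "kcomp N H (kcomp M V H')" V]
    by (intro Bochner_Integration.integral_cong refl) (simp add: comp_assoc_middle[OF H H' x(1)])
  ultimately show ?thesis by simp
qed

lemma comp_assoc_left:
  assumes H: "rect H" and H': "rect H'" and y: "y \<in> space N" "y' \<in> space N"
  shows "kcomp N (kcomp M V H) (kcomp M V H') y y' = kcomp M V (kcomp N H (kcomp M V H')) y y'"
proof (rule kcomp_assoc)
  obtain C where C: "C > 0" "bounded_by M N a b C H"
    by (rule dominatedE[OF H])
  obtain C' where C': "C' > 0" "bounded_by N N a' b C' (kcomp M V H')"
    by (rule dominatedE[OF dominated_comp_left[OF H']])
  show "integrable (M \<Otimes>\<^sub>M N) (\<lambda>(x, z). V y x * H x z * kcomp M V H' z y')"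
  proof (rule integrable_pair_product_bound[OF _ _ _ V_left_integrable[OF y(1)] Y.weight_integrable,
        where C = "C * C' * b y'"])
    show "(\<lambda>(x, z). V y x * H x z * kcomp M V H' z y') \<in> borel_measurable (M \<Otimes>\<^sub>M N)"
      unfolding case_prod_beta using y
      by (intro borel_measurable_times dominated_app[OF dominated_comp_left[OF H']]
          dominated_app[OF H] V_measurable_app) auto
    fix x z assume "x \<in> space M" "z \<in> space N"
    then have "\<bar>V y x * H x z * kcomp M V H' z y'\<bar> \<le> \<bar>V y x\<bar> * (C * (a x * b z)) * (C' * (a' z * b y'))"
      unfolding abs_mult using C C' y X.weight_pos(1)[of x] Y.weight_pos(2)[of z]
      by (intro mult_mono) auto
    then show "\<bar>case (x, z) of (x, z) \<Rightarrow> V y x * H x z * kcomp M V H' z y'\<bar>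
        \<le> C * C' * b y' * (\<bar>V y x\<bar> * a x * (a' z * b z))"
      by (simp add: algebra_simps)
  qed unfold_locales
qed unfold_locales

text \<open>
  Both sides satisfy the same recursion: \<open>tr (H V) = tr (V H)\<close>, and replacing \<open>H'\<close> by
  \<open>H V H'\<close> turns \<open>H' V\<close> into \<open>(H V) (H' V)\<close> and \<open>V H'\<close> into \<open>(V H) (V H')\<close>.
\<close>

lemma moment_comp_commute:
  assumes "\<And>H. H \<in> set Hs \<Longrightarrow> rect H"
  shows "moment M (map (\<lambda>H. kcomp N H V) Hs) = moment N (map (\<lambda>H. kcomp M V H) Hs)"
  using assms
proof (induction "length Hs" arbitrary: Hs)
  case 0
  then show ?case by (simp add: X.moment_Nil Y.moment_Nil)
next
  case (Suc n Gs)
  then obtain H Hs where G: "Gs = H # Hs" by (cases Gs) auto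
  let ?R = "\<lambda>H. kcomp N H V" and ?L = "\<lambda>H. kcomp M V H"
  have H: "rect H" and Hs: "\<And>H. H \<in> set Hs \<Longrightarrow> rect H" and n: "length Hs = n" using Suc G by auto
  have step: "moment M ((map ?R Hs)[k := kcomp M (?R H) (map ?R Hs ! k)])
      = moment N ((map ?L Hs)[k := kcomp N (?L H) (map ?L Hs ! k)])" if k: "k < length Hs" for k
  proof -
    let ?G = "kcomp N H (kcomp M V (Hs ! k))"
    have Hk: "rect (Hs ! k)" using Hs k by simp
    have "moment M ((map ?R Hs)[k := kcomp M (?R H) (map ?R Hs ! k)]) = moment M (map ?R (Hs[k := ?G]))"
    proof (rule moment_cong)
      fix i x y assume i: "i < length ((map ?R Hs)[k := kcomp M (?R H) (map ?R Hs ! k)])"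
        and xy: "x \<in> space M" "y \<in> space M"
      show "((map ?R Hs)[k := kcomp M (?R H) (map ?R Hs ! k)] ! i) x y = (map ?R (Hs[k := ?G]) ! i) x y"
        using comp_assoc_right[OF H Hk xy] i k by (cases "i = k") auto
    qed simp
    also have "\<dots> = moment N (map ?L (Hs[k := ?G]))"
    proof (rule Suc.hyps(1))
      show "rect D" if "D \<in> set (Hs[k := ?G])" for D
        using that Hs dominated_comp_middle[OF H Hk] set_update_subset_insert[of Hs k ?G] by blast
    qed (use n in simp)
    also have "\<dots> = moment N ((map ?L Hs)[k := kcomp N (?L H) (map ?L Hs ! k)])"
    proof (rule moment_cong)
      fix i x y assume i: "i < length (map ?L (Hs[k := ?G]))" and xy: "x \<in> space N" "y \<in> space N"
      show "(map ?L (Hs[k := ?G]) ! i) x y = ((map ?L Hs)[k := kcomp N (?L H) (map ?L Hs ! k)] ! i) x y"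
        using comp_assoc_left[OF H Hk xy] i k by (cases "i = k") auto
    qed simp
    finally show ?thesis .
  qed
  have "moment M (?R H # map ?R Hs) = (\<integral>x. ?R H x x \<partial>M) * moment M (map ?R Hs)
      - (\<Sum>k<length (map ?R Hs). moment M ((map ?R Hs)[k := kcomp M (?R H) (map ?R Hs ! k)]))"
    by (rule X.moment_Cons[OF dominated_comp_right[OF H]]) (use Hs dominated_comp_right in auto)
  also have "\<dots> = (\<integral>y. ?L H y y \<partial>N) * moment N (map ?L Hs)
      - (\<Sum>k<length (map ?L Hs). moment N ((map ?L Hs)[k := kcomp N (?L H) (map ?L Hs ! k)]))"
    using Suc.hyps(1)[of Hs] n Hs step by (simp add: trace_comp_commute[OF H])
  also have "\<dots> = moment N (?L H # map ?L Hs)"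
    by (rule Y.moment_Cons[OF dominated_comp_left[OF H], symmetric]) (use Hs dominated_comp_left in auto)
  finally show ?case by (simp add: G)
qed

theorem fredholm_det_comp_commute:
  assumes "rect H"
  shows "fredholm_det M (kcomp N H V) = fredholm_det N (kcomp M V H)"
  unfolding fredholm_det_eq_moments
  using moment_comp_commute[of "replicate m H" for m] assms
  by (intro suminf_cong) (simp add: map_replicate)

end

section \<open>The Airy function on a shifted contour\<close>

definition heat :: "real \<Rightarrow> real \<Rightarrow> real \<Rightarrow> real" where
  "heat s x y = 1 / sqrt (4 * pi * s) * exp (- ((x - y)\<^sup>2 / (4 * s)))"

text \<open>
  The integrand of the contour integral for the kernel of \<open>exp (- b \<Delta>) B0\<close> at \<open>x + y = w\<close>: as a function
  of \<open>w\<close>, \<open>exp (\<i> w \<zeta>)\<close> is an eigenfunction of \<open>exp (- b \<Delta>)\<close> with eigenvalue \<open>exp (b \<zeta>\<^sup>2)\<close>.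
\<close>

definition airy_exp :: "real \<Rightarrow> real \<Rightarrow> complex \<Rightarrow> complex" where
  "airy_exp b w \<zeta> = exp (\<i> * \<zeta> ^ 3 / 3 + of_real b * \<zeta>\<^sup>2 + \<i> * of_real w * \<zeta>)"

text \<open>
  The kernel of \<open>exp (- b \<Delta>) B0\<close> as a function of \<open>w = x + y\<close>, for every real \<open>b\<close>.
\<close>

definition airy_shift :: "real \<Rightarrow> real \<Rightarrow> real" where
  "airy_shift b w = exp (- 2 * b ^ 3 / 3 - w * b) * airy_Ai (w + b\<^sup>2)"

lemma heat_B0_eq_airy_shift: "heat_B0 b x y = airy_shift b (x + y)"
  by (simp add: heat_B0_def airy_shift_def)

lemma airy_Ai_eq_airy_shift: "airy_Ai w = airy_shift 0 w"
  by (simp add: airy_shift_def)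

lemma heat_eq_normal_density:
  assumes "s > 0"
  shows "heat s x y = normal_density x (sqrt (2 * s)) y"
  using assms by (simp add: heat_def normal_density_def power2_commute)

lemma heat_sym: "heat s x y = heat s y x"
  by (simp add: heat_def power2_commute)

lemma heat_nonneg: "heat s x y \<ge> 0" if "s > 0"
  using that by (simp add: heat_def)

lemma heat_measurable[measurable]:
  "(\<lambda>w. heat s (f w) (g w)) \<in> borel_measurable M"
  if [measurable]: "f \<in> borel_measurable M" "g \<in> borel_measurable M"
  unfolding heat_def by measurable

lemma integrable_heat: "s > 0 \<Longrightarrow> integrable lborel (heat s x)"
proof -
  assume "s > 0"
  then have "heat s x = normal_density x (sqrt (2 * s))"
    by (intro ext heat_eq_normal_density)
  then show ?thesis using \<open>s > 0\<close> by simp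
qed

lemma norm_airy_exp:
  "norm (airy_exp b w (of_real s + \<i> * of_real c)) = exp (- (c - b) * s\<^sup>2 + c ^ 3 / 3 - b * c\<^sup>2 - c * w)"
  unfolding airy_exp_def norm_exp_eq_Re
  by (simp add: power3_eq_cube power2_eq_square algebra_simps diff_divide_distrib add_divide_distrib)

lemma integrable_gaussian:
  assumes "k > 0"
  shows "integrable lborel (\<lambda>s::real. exp (- k * s\<^sup>2))"
proof -
  have "integrable lborel (\<lambda>s. sqrt (4 * pi * (1 / (4 * k))) * heat (1 / (4 * k)) 0 s)"
    using assms by (intro integrable_mult_right integrable_heat) auto
  then show ?thesis using assms by (simp add: heat_def mult.commute)
qed

lemma airy_exp_measurable[measurable]:
  "(\<lambda>x. airy_exp b (f x) (of_real (g x) + \<i> * of_real c)) \<in> borel_measurable M"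
  if [measurable]: "f \<in> borel_measurable M" "g \<in> borel_measurable M"
proof -
  have "continuous_on UNIV (\<lambda>z::real \<times> real. airy_exp b (fst z) (of_real (snd z) + \<i> * of_real c))"
    unfolding airy_exp_def by (intro continuous_intros) auto
  then have "(\<lambda>z::real \<times> real. airy_exp b (fst z) (of_real (snd z) + \<i> * of_real c)) \<in> borel_measurable borel"
    by (rule borel_measurable_continuous_onI)
  then have "(\<lambda>z::real \<times> real. airy_exp b (fst z) (of_real (snd z) + \<i> * of_real c)) \<in> borel_measurable (borel \<Otimes>\<^sub>M borel)"
    by (simp add: borel_prod)
  from measurable_compose[OF measurable_Pair[OF that] this] show ?thesis by simp
qed

lemma integrable_airy_exp:
  assumes "c > b"
  shows "integrable lborel (\<lambda>s. airy_exp b w (of_real s + \<i> * of_real c))"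
proof (rule Bochner_Integration.integrable_bound)
  show "integrable lborel (\<lambda>s. exp (c ^ 3 / 3 - b * c\<^sup>2 - c * w) * exp (- (c - b) * s\<^sup>2))"
    using assms by (intro integrable_mult_right integrable_gaussian) auto
  show "AE s in lborel. norm (airy_exp b w (of_real s + \<i> * of_real c))
      \<le> norm (exp (c ^ 3 / 3 - b * c\<^sup>2 - c * w) * exp (- (c - b) * s\<^sup>2))"
    by (simp add: norm_airy_exp flip: exp_add)
qed measurable

text \<open>
  Shifting the contour from the half line \<open>{0..}\<close> to height \<open>c\<close> turns the oscillating integral into an
  absolutely convergent one. The two vertical sides of the rectangle do not matter: on the left one the
  contribution is purely imaginary, and the right one tends to 0 as the rectangle grows.
\<close>

lemma airy_Ai_contour:
  assumes c: "c > 0"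
  shows "airy_Ai x = 1 / pi * Re (LINT s:{0..}|lborel. airy_exp 0 x (of_real s + \<i> * of_real c))"
proof -
  define f where "f = airy_exp 0 x"
  have "f holomorphic_on UNIV"
    unfolding f_def airy_exp_def by (intro holomorphic_intros) auto
  then obtain F where F: "\<And>z. (F has_field_derivative f z) (at z)"
    by (rule holomorphic_convex_primitive'[OF convex_UNIV open_UNIV]) auto
  have cont: "continuous_on A (\<lambda>s. f (g s))" if "continuous_on A g" for A :: "real set" and g
    unfolding f_def airy_exp_def by (intro continuous_intros that) auto
  have nf: "norm (f (of_real s + \<i> * of_real \<tau>)) = exp (- \<tau> * s\<^sup>2 + \<tau> ^ 3 / 3 - \<tau> * x)" for s \<tau>
    by (simp add: f_def norm_airy_exp)
  have hor: "((\<lambda>s. f (of_real s + \<i> * of_real \<tau>)) has_integral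
      (F (of_real T + \<i> * of_real \<tau>) - F (\<i> * of_real \<tau>))) {0..T}" if "T \<ge> 0" for T \<tau>
  proof -
    have "((\<lambda>s. f (of_real s + \<i> * of_real \<tau>)) has_integral
        (F (of_real T + \<i> * of_real \<tau>) - F (of_real 0 + \<i> * of_real \<tau>))) {0..T}"
    proof (rule fundamental_theorem_of_calculus[OF that])
      fix s
      have "((\<lambda>z. F (z + \<i> * of_real \<tau>)) has_field_derivative f (of_real s + \<i> * of_real \<tau>) * 1) (at (of_real s))"
        by (rule DERIV_chain2[OF F]) (auto intro!: derivative_eq_intros)
      then have "((\<lambda>z. F (z + \<i> * of_real \<tau>)) has_field_derivative f (of_real s + \<i> * of_real \<tau>)) (at (of_real s))"
        by simp
      then show "((\<lambda>s. F (of_real s + \<i> * of_real \<tau>)) has_vector_derivative f (of_real s + \<i> * of_real \<tau>)) (at s within {0..T})"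
        by (rule has_vector_derivative_real_field)
    qed
    then show ?thesis by simp
  qed
  have ver: "((\<lambda>\<tau>. \<i> * f (of_real T + \<i> * of_real \<tau>)) has_integral
      (F (of_real T + \<i> * of_real c) - F (of_real T))) {0..c}" for T
  proof -
    have "((\<lambda>\<tau>. \<i> * f (of_real T + \<i> * of_real \<tau>)) has_integral
        (F (of_real T + \<i> * of_real c) - F (of_real T + \<i> * of_real 0))) {0..c}"
    proof (rule fundamental_theorem_of_calculus)
      fix \<tau>
      have "((\<lambda>z. F (of_real T + \<i> * z)) has_field_derivative f (of_real T + \<i> * of_real \<tau>) * \<i>) (at (of_real \<tau>))"
        by (rule DERIV_chain2[OF F]) (auto intro!: derivative_eq_intros)
      then have "((\<lambda>z. F (of_real T + \<i> * z)) has_field_derivative \<i> * f (of_real T + \<i> * of_real \<tau>)) (at (of_real \<tau>))"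
        by (simp only: mult.commute)
      then show "((\<lambda>\<tau>. F (of_real T + \<i> * of_real \<tau>)) has_vector_derivative \<i> * f (of_real T + \<i> * of_real \<tau>)) (at \<tau> within {0..c})"
        by (rule has_vector_derivative_real_field)
    qed (use c in simp)
    then show ?thesis by simp
  qed
  \<comment> \<open>On the imaginary axis the integrand is real, so that side of the rectangle has no real part.\<close>
  have left: "Re (F (\<i> * of_real c) - F 0) = 0"
  proof -
    have arg: "\<i> * (\<i> * of_real \<tau>) ^ 3 / 3 + \<i> * of_real x * (\<i> * of_real \<tau>) = of_real (\<tau> ^ 3 / 3 - x * \<tau>)" for \<tau>
      by (simp add: power3_eq_cube complex_eq_iff)
    have "Re (\<i> * f (of_real 0 + \<i> * of_real \<tau>)) = 0" for \<tau>
    proof -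
      have "f (of_real 0 + \<i> * of_real \<tau>) = exp (\<i> * (\<i> * of_real \<tau>) ^ 3 / 3 + \<i> * of_real x * (\<i> * of_real \<tau>))"
        by (simp add: f_def airy_exp_def)
      also have "\<dots> = of_real (exp (\<tau> ^ 3 / 3 - x * \<tau>))"
        unfolding arg exp_of_real ..
      finally show ?thesis by simp
    qed
    then have "((\<lambda>\<tau>. 0) has_integral Re (F (of_real 0 + \<i> * of_real c) - F (of_real 0))) {0..c}"
      using has_integral_linear[OF ver[of 0] bounded_linear_Re] by (simp add: o_def)
    from has_integral_unique[OF this has_integral_0] show ?thesis by simp
  qed
  have right: "((\<lambda>T. F (of_real T + \<i> * of_real c) - F (of_real T)) \<longlongrightarrow> 0) at_top"
  proof (rule Lim_null_comparison)
    define K where "K = exp (c ^ 3 / 3 + \<bar>x\<bar> * c)"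
    have der: "((\<lambda>\<tau>. - K * exp (- \<tau> * d) / d) has_real_derivative K * exp (- \<tau> * d)) (at \<tau> within S)"
      if "d \<noteq> 0" for d \<tau> S
      using that by (auto intro!: derivative_eq_intros)
    show "\<forall>\<^sub>F T in at_top. norm (F (of_real T + \<i> * of_real c) - F (of_real T)) \<le> K / T\<^sup>2"
    proof (rule eventually_at_top_linorderI[of 1])
      fix T :: real assume T: "T \<ge> 1"
      have I: "((\<lambda>\<tau>. K * exp (- \<tau> * T\<^sup>2)) has_integral (- K * exp (- c * T\<^sup>2) / T\<^sup>2 - (- K * exp (- 0 * T\<^sup>2) / T\<^sup>2))) {0..c}"
      proof (rule fundamental_theorem_of_calculus)
        fix \<tau>
        show "((\<lambda>\<tau>. - K * exp (- \<tau> * T\<^sup>2) / T\<^sup>2) has_vector_derivative K * exp (- \<tau> * T\<^sup>2)) (at \<tau> within {0..c})"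
          unfolding has_real_derivative_iff_has_vector_derivative[symmetric]
          using T by (intro der) auto
      qed (use c in simp)
      have "norm (F (of_real T + \<i> * of_real c) - F (of_real T)) = norm (integral {0..c} (\<lambda>\<tau>. \<i> * f (of_real T + \<i> * of_real \<tau>)))"
        by (simp only: integral_unique[OF ver[of T]])
      also have "\<dots> \<le> integral {0..c} (\<lambda>\<tau>. K * exp (- \<tau> * T\<^sup>2))"
      proof (rule Henstock_Kurzweil_Integration.integral_norm_bound_integral)
        fix \<tau> assume \<tau>: "\<tau> \<in> {0..c}"
        have "\<tau> ^ 3 \<le> c ^ 3" using \<tau> by (intro power_mono) auto
        moreover have "- (\<tau> * x) \<le> \<bar>x\<bar> * c"
        proof -
          have "\<tau> * (- x) \<le> \<tau> * \<bar>x\<bar>" using \<tau> by (intro mult_left_mono) auto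
          moreover have "\<tau> * \<bar>x\<bar> \<le> c * \<bar>x\<bar>" using \<tau> by (intro mult_right_mono) auto
          ultimately show ?thesis by (simp add: mult.commute)
        qed
        ultimately show "norm (\<i> * f (of_real T + \<i> * of_real \<tau>)) \<le> K * exp (- \<tau> * T\<^sup>2)"
          unfolding K_def exp_add[symmetric] by (simp add: norm_mult nf)
      qed (use ver[of T] I in \<open>auto intro: has_integral_integrable\<close>)
      also have "\<dots> \<le> K / T\<^sup>2"
        using integral_unique[OF I] by (simp add: K_def)
      finally show "norm (F (of_real T + \<i> * of_real c) - F (of_real T)) \<le> K / T\<^sup>2" .
    qed
    show "((\<lambda>T. K / T\<^sup>2) \<longlongrightarrow> 0) at_top"
      by (intro tendsto_divide_0[OF tendsto_const] filterlim_at_top_imp_at_infinity filterlim_pow_at_top filterlim_ident) auto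
  qed
  let ?I = "LINT s:{0..}|lborel. f (of_real s + \<i> * of_real c)"
  have int: "integrable lborel (\<lambda>s. f (of_real s + \<i> * of_real c))"
    unfolding f_def using c by (rule integrable_airy_exp)
  have top: "((\<lambda>T. F (of_real T + \<i> * of_real c) - F (\<i> * of_real c)) \<longlongrightarrow> ?I) at_top"
  proof -
    have "set_integrable lborel {0..} (\<lambda>s. f (of_real s + \<i> * of_real c))"
      unfolding set_integrable_def using integrable_mult_indicator[OF _ int] by simp
    then have "((\<lambda>T. LINT s:{0..T}|lborel. f (of_real s + \<i> * of_real c)) \<longlongrightarrow> ?I) at_top"
      by (intro tendsto_set_lebesgue_integral_at_top) auto
    moreover have "\<forall>\<^sub>F T in at_top. (LINT s:{0..T}|lborel. f (of_real s + \<i> * of_real c))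
        = F (of_real T + \<i> * of_real c) - F (\<i> * of_real c)"
    proof (rule eventually_at_top_linorderI[of 0])
      fix T :: real assume T: "T \<ge> 0"
      have "set_integrable lborel {0..T} (\<lambda>s. f (of_real s + \<i> * of_real c))"
        unfolding set_integrable_def using integrable_mult_indicator[OF _ int] by simp
      from set_borel_integral_eq_integral(2)[OF this] integral_unique[OF hor[OF T]]
      show "(LINT s:{0..T}|lborel. f (of_real s + \<i> * of_real c)) = F (of_real T + \<i> * of_real c) - F (\<i> * of_real c)"
        by simp
    qed
    ultimately show ?thesis by (rule Lim_transform_eventually)
  qed
  have osc: "integral {0..T} (\<lambda>s. cos (s ^ 3 / 3 + x * s))
      = Re (F (of_real T + \<i> * of_real c) - F (\<i> * of_real c)) - Re (F (of_real T + \<i> * of_real c) - F (of_real T))"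
    if "T \<ge> 0" for T
  proof -
    have "Re (f (of_real s)) = cos (s ^ 3 / 3 + x * s)" for s
      unfolding f_def airy_exp_def by (simp add: Re_exp)
    then have "((\<lambda>s. cos (s ^ 3 / 3 + x * s)) has_integral Re (F (of_real T) - F 0)) {0..T}"
      using has_integral_linear[OF hor[OF that, of 0] bounded_linear_Re] by (simp add: o_def)
    then show ?thesis using left by (simp add: integral_unique)
  qed
  have "((\<lambda>T. Re (F (of_real T + \<i> * of_real c) - F (\<i> * of_real c)) - Re (F (of_real T + \<i> * of_real c) - F (of_real T)))
      \<longlongrightarrow> Re ?I - Re 0) at_top"
    by (intro tendsto_diff tendsto_Re top right)
  moreover have "\<forall>\<^sub>F T in at_top. Re (F (of_real T + \<i> * of_real c) - F (\<i> * of_real c)) - Re (F (of_real T + \<i> * of_real c) - F (of_real T))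
      = integral {0..T} (\<lambda>s. cos (s ^ 3 / 3 + x * s))"
    by (rule eventually_at_top_linorderI[of 0]) (simp add: osc)
  ultimately have "((\<lambda>T. integral {0..T} (\<lambda>s. cos (s ^ 3 / 3 + x * s))) \<longlongrightarrow> Re ?I - Re 0) at_top"
    by (rule Lim_transform_eventually)
  then show ?thesis
    unfolding airy_Ai_def f_def by (simp add: tendsto_Lim)
qed

text \<open>
  The prefactor in the definition of \<open>airy_shift\<close> is what the substitution \<open>\<zeta> \<mapsto> \<zeta> - \<i> b\<close> in the cubic exponent
  produces, so the height has to exceed \<open>b\<close>.
\<close>

lemma airy_shift_contour:
  assumes c: "c > b"
  shows "airy_shift b w = 1 / pi * Re (LINT s:{0..}|lborel. airy_exp b w (of_real s + \<i> * of_real c))"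
proof -
  let ?k = "exp (- 2 * b ^ 3 / 3 - w * b)"
  have eq: "of_real ?k * airy_exp 0 (w + b\<^sup>2) (of_real s + \<i> * of_real (c - b)) = airy_exp b w (of_real s + \<i> * of_real c)" for s
    unfolding airy_exp_def exp_of_real[symmetric] exp_add[symmetric]
    by (rule arg_cong[where f = exp])
       (simp add: complex_eq_iff power3_eq_cube power2_eq_square field_simps)
  have "airy_shift b w = ?k * (1 / pi * Re (LINT s:{0..}|lborel. airy_exp 0 (w + b\<^sup>2) (of_real s + \<i> * of_real (c - b))))"
    unfolding airy_shift_def using c by (subst airy_Ai_contour[of "c - b"]) auto
  also have "\<dots> = 1 / pi * Re (of_real ?k * (LINT s:{0..}|lborel. airy_exp 0 (w + b\<^sup>2) (of_real s + \<i> * of_real (c - b))))"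
    by simp
  also have "of_real ?k * (LINT s:{0..}|lborel. airy_exp 0 (w + b\<^sup>2) (of_real s + \<i> * of_real (c - b)))
      = (LINT s:{0..}|lborel. of_real ?k * airy_exp 0 (w + b\<^sup>2) (of_real s + \<i> * of_real (c - b)))"
    by (rule set_integral_mult_right[symmetric])
  finally show ?thesis unfolding eq .
qed

text \<open>
  On the line \<open>Im \<zeta> = c\<close> the integrand has modulus \<open>exp (- c w)\<close> times a Gaussian.
\<close>

lemma airy_shift_bound:
  assumes c: "c > b"
  obtains C where "C > 0" "\<forall>w. \<bar>airy_shift b w\<bar> \<le> C * exp (- c * w)"
proof -
  define G where "G = (\<integral>s. exp (- (c - b) * s\<^sup>2) \<partial>lborel)"
  define C where "C = 1 / pi * exp (c ^ 3 / 3 - b * c\<^sup>2) * G"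
  have "\<bar>airy_shift b w\<bar> \<le> (C + 1) * exp (- c * w)" for w
  proof -
    let ?f = "\<lambda>s. airy_exp b w (of_real s + \<i> * of_real c)"
    have "\<bar>Re (LINT s:{0..}|lborel. ?f s)\<bar> \<le> norm (LINT s:{0..}|lborel. ?f s)" by (rule abs_Re_le_cmod)
    also have "\<dots> \<le> (\<integral>s. norm (indicator {0..} s *\<^sub>R ?f s) \<partial>lborel)"
      unfolding set_lebesgue_integral_def by (rule integral_norm_bound)
    also have "\<dots> \<le> (\<integral>s. norm (?f s) \<partial>lborel)"
      by (intro integral_mono' integrable_norm integrable_airy_exp[OF c]) (auto simp: indicator_def)
    also have "\<dots> = (\<integral>s. exp (c ^ 3 / 3 - b * c\<^sup>2) * exp (- c * w) * exp (- (c - b) * s\<^sup>2) \<partial>lborel)"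
      unfolding norm_airy_exp exp_add[symmetric] by (simp add: algebra_simps)
    also have "\<dots> = exp (c ^ 3 / 3 - b * c\<^sup>2) * exp (- c * w) * G" by (simp add: G_def)
    finally have "1 / pi * \<bar>Re (LINT s:{0..}|lborel. ?f s)\<bar> \<le> 1 / pi * (exp (c ^ 3 / 3 - b * c\<^sup>2) * exp (- c * w) * G)"
      by (intro mult_left_mono) auto
    also have "\<dots> = C * exp (- c * w)" by (simp add: C_def)
    finally have "1 / pi * \<bar>Re (LINT s:{0..}|lborel. ?f s)\<bar> \<le> C * exp (- c * w)" .
    then show ?thesis
      unfolding airy_shift_contour[OF c] abs_mult by (simp add: distrib_right add_increasing2)
  qed
  moreover have "C \<ge> 0" unfolding C_def G_def by (auto intro!: mult_nonneg_nonneg integral_nonneg_AE)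
  ultimately show ?thesis by (intro that[of "C + 1"]) auto
qed

lemma airy_shift_measurable[measurable]: "airy_shift b \<in> borel_measurable borel"
proof -
  define c where "c = b + 1"
  have "(\<lambda>w. \<integral>s. indicator {0..} s *\<^sub>R airy_exp b w (of_real s + \<i> * of_real c) \<partial>lborel) \<in> borel_measurable borel"
    by (intro lborel.borel_measurable_lebesgue_integral) measurable
  then have "(\<lambda>w. 1 / pi * Re (\<integral>s. indicator {0..} s *\<^sub>R airy_exp b w (of_real s + \<i> * of_real c) \<partial>lborel)) \<in> borel_measurable borel"
    by measurable
  moreover have "airy_shift b = (\<lambda>w. 1 / pi * Re (\<integral>s. indicator {0..} s *\<^sub>R airy_exp b w (of_real s + \<i> * of_real c) \<partial>lborel))"
    by (rule ext, rule airy_shift_contour[unfolded set_lebesgue_integral_def]) (simp add: c_def)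
  ultimately show ?thesis by simp
qed

text \<open>
  Completing the square: an exponential tilt moves the centre of the Gaussian by \<open>- 2 a c\<close>.
\<close>

lemma heat_exp_tilt:
  assumes "a > 0"
  shows "heat a x z * exp (- c * z) = exp (- c * x + a * c\<^sup>2) * heat a (x - 2 * a * c) z"
proof -
  have "- ((x - z)\<^sup>2 / (4 * a)) - c * z = (- c * x + a * c\<^sup>2) - ((x - 2 * a * c - z)\<^sup>2 / (4 * a))"
    using assms by (simp add: field_simps power2_eq_square)
  then have "exp (- ((x - z)\<^sup>2 / (4 * a))) * exp (- c * z) = exp (- c * x + a * c\<^sup>2) * exp (- ((x - 2 * a * c - z)\<^sup>2 / (4 * a)))"
    by (simp flip: exp_add)
  then show ?thesis by (simp add: heat_def algebra_simps)
qed

lemma integrable_heat_exp: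
  assumes "a > 0"
  shows "integrable lborel (\<lambda>z. heat a x z * exp (- c * z))"
  unfolding heat_exp_tilt[OF assms] using assms
  by (intro integrable_mult_right integrable_heat)

lemma heat_exp_integral:
  assumes "a > 0"
  shows "(\<integral>z. heat a x z * exp (- c * z) \<partial>lborel) = exp (- c * x + a * c\<^sup>2)"
  unfolding heat_exp_tilt[OF assms] using assms
  by (simp add: heat_eq_normal_density)

lemma heat_fourier:
  assumes a: "a > 0"
  shows "(\<integral>z. heat a x z *\<^sub>R exp (\<i> * of_real (t * z)) \<partial>lborel) = exp (\<i> * of_real (t * x) - of_real (a * t\<^sup>2))"
proof -
  define \<sigma> where "\<sigma> = sqrt (2 * a)"
  have \<sigma>: "\<sigma> > 0" "\<sigma>\<^sup>2 = 2 * a" using a by (auto simp: \<sigma>_def)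
  have dens: "\<sigma> * heat a x (x + \<sigma> * u) = std_normal_density u" for u
  proof -
    have "\<sigma> * sqrt (2 * pi) = sqrt (4 * pi * a)"
      unfolding \<sigma>_def real_sqrt_mult[symmetric] by (simp add: algebra_simps)
    then have "\<sigma> * (1 / sqrt (4 * pi * a)) = 1 / sqrt (2 * pi)"
      using \<sigma>(1) by (metis divide_self_if less_irrefl mult.right_neutral nonzero_mult_divide_mult_cancel_left times_divide_eq_right)
    moreover have "(\<sigma> * u)\<^sup>2 / (4 * a) = u\<^sup>2 / 2"
      using a by (simp add: power_mult_distrib \<sigma>(2))
    ultimately have "\<sigma> * (1 / sqrt (4 * pi * a)) * exp (- ((\<sigma> * u)\<^sup>2 / (4 * a))) = 1 / sqrt (2 * pi) * exp (- (u\<^sup>2 / 2))"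
      by (simp only:)
    then show ?thesis by (simp add: heat_def normal_density_def)
  qed
  have "(\<integral>z. heat a x z *\<^sub>R exp (\<i> * of_real (t * z)) \<partial>lborel)
      = \<bar>\<sigma>\<bar> *\<^sub>R (\<integral>u. heat a x (x + \<sigma> * u) *\<^sub>R exp (\<i> * of_real (t * (x + \<sigma> * u))) \<partial>lborel)"
    using \<sigma> by (intro lborel_integral_real_affine) auto
  also have "\<dots> = (\<integral>u. \<bar>\<sigma>\<bar> *\<^sub>R (heat a x (x + \<sigma> * u) *\<^sub>R exp (\<i> * of_real (t * (x + \<sigma> * u)))) \<partial>lborel)"
    by (rule integral_scaleR_right[symmetric])
  also have "\<dots> = (\<integral>u. exp (\<i> * of_real (t * x)) * (std_normal_density u *\<^sub>R exp (\<i> * of_real (t * \<sigma> * u))) \<partial>lborel)"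
    using \<sigma> by (intro Bochner_Integration.integral_cong refl)
      (simp add: dens[symmetric] scaleR_conv_of_real exp_add[symmetric] algebra_simps)
  also have "\<dots> = exp (\<i> * of_real (t * x)) * (\<integral>u. std_normal_density u *\<^sub>R exp (\<i> * of_real (t * \<sigma> * u)) \<partial>lborel)"
    by (rule integral_mult_right_zero)
  also have "(\<integral>u. std_normal_density u *\<^sub>R exp (\<i> * of_real (t * \<sigma> * u)) \<partial>lborel) = char std_normal_distribution (t * \<sigma>)"
    unfolding char_def by (rule integral_density[symmetric]) (auto simp: normal_density_nonneg)
  also have "char std_normal_distribution (t * \<sigma>) = of_real (exp (- (a * t\<^sup>2)))"
    by (simp add: char_std_normal_distribution power_mult_distrib \<sigma> mult.commute)
  finally show ?thesis unfolding exp_of_real[symmetric] exp_add[symmetric] by simp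
qed

text \<open>
  The imaginary part of the frequency is absorbed by the tilt; what remains is the characteristic function of a
  normal distribution.
\<close>

lemma heat_complex_exp:
  assumes a: "a > 0"
  shows "(\<integral>z. heat a x z *\<^sub>R exp (\<i> * of_real z * (of_real s + \<i> * of_real c)) \<partial>lborel)
    = exp (\<i> * of_real x * (of_real s + \<i> * of_real c) - of_real a * (of_real s + \<i> * of_real c)\<^sup>2)"
proof -
  have tilt: "heat a x z *\<^sub>R exp (\<i> * of_real z * (of_real s + \<i> * of_real c))
      = of_real (exp (- c * x + a * c\<^sup>2)) * (heat a (x - 2 * a * c) z *\<^sub>R exp (\<i> * of_real (s * z)))" for z
  proof -
    have "exp (\<i> * of_real z * (of_real s + \<i> * of_real c)) = of_real (exp (- c * z)) * exp (\<i> * of_real (s * z))"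
      unfolding exp_of_real[symmetric] exp_add[symmetric]
      by (rule arg_cong[where f = exp]) (simp add: complex_eq_iff)
    then have "heat a x z *\<^sub>R exp (\<i> * of_real z * (of_real s + \<i> * of_real c))
        = of_real (heat a x z * exp (- c * z)) * exp (\<i> * of_real (s * z))"
      by (simp add: scaleR_conv_of_real)
    then show ?thesis unfolding heat_exp_tilt[OF a] by (simp add: scaleR_conv_of_real)
  qed
  have "(\<integral>z. heat a x z *\<^sub>R exp (\<i> * of_real z * (of_real s + \<i> * of_real c)) \<partial>lborel)
      = of_real (exp (- c * x + a * c\<^sup>2)) * exp (\<i> * of_real (s * (x - 2 * a * c)) - of_real (a * s\<^sup>2))"
    by (simp only: tilt integral_mult_right_zero heat_fourier[OF a])
  also have "\<dots> = exp (\<i> * of_real x * (of_real s + \<i> * of_real c) - of_real a * (of_real s + \<i> * of_real c)\<^sup>2)"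
    unfolding exp_of_real[symmetric] exp_add[symmetric]
    by (rule arg_cong[where f = exp]) (simp add: complex_eq_iff power2_eq_square algebra_simps)
  finally show ?thesis .
qed

text \<open>
  Under the contour integral the heat kernel acts on \<open>exp (\<i> z \<zeta>)\<close> as multiplication by
  \<open>exp (- a \<zeta>\<^sup>2)\<close>, which lowers \<open>b\<close> by \<open>a\<close>. The height \<open>c\<close> is admissible for both parameters.
\<close>

lemma heat_airy_shift:
  assumes a: "a > 0"
  shows "(\<integral>z. heat a x z * airy_shift b (z + y) \<partial>lborel) = airy_shift (b - a) (x + y)"
proof -
  define c where "c = b + 1"
  have c: "c > b" "c > b - a" using a by (auto simp: c_def)
  let ?z = "\<lambda>s. of_real s + \<i> * of_real c"
  define F where "F z s = indicator {0..} s *\<^sub>R (heat a x z *\<^sub>R airy_exp b (z + y) (?z s))" for z s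
  have meas: "(\<lambda>(z, s). F z s) \<in> borel_measurable (lborel \<Otimes>\<^sub>M lborel)"
    unfolding F_def case_prod_beta by measurable
  define f where "f z = exp (c ^ 3 / 3 - b * c\<^sup>2 - c * y) * (heat a x z * exp (- c * z))" for z
  define g where "g s = exp (- (c - b) * s\<^sup>2)" for s
  have f: "integrable lborel f" unfolding f_def by (intro integrable_mult_right integrable_heat_exp a)
  have g: "integrable lborel g" unfolding g_def using c by (intro integrable_gaussian) auto
  have le: "norm (F z s) \<le> f z * g s" for z s
  proof -
    have "norm (F z s) \<le> heat a x z * norm (airy_exp b (z + y) (?z s))"
      using heat_nonneg[OF a] by (auto simp: F_def indicator_def)
    also have "norm (airy_exp b (z + y) (?z s)) = exp (c ^ 3 / 3 - b * c\<^sup>2 - c * y) * exp (- c * z) * g s"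
      unfolding norm_airy_exp g_def exp_add[symmetric] by (simp add: algebra_simps)
    finally show ?thesis by (simp add: f_def algebra_simps)
  qed
  have int: "integrable (lborel \<Otimes>\<^sub>M lborel) (\<lambda>(z, s). F z s)"
  proof (rule Bochner_Integration.integrable_bound[OF _ meas])
    show "integrable (lborel \<Otimes>\<^sub>M lborel) (\<lambda>(z, s). f z * g s)"
      using f g by (intro lborel_pair.Fubini_integrable) (auto simp: abs_mult)
    show "AE w in lborel \<Otimes>\<^sub>M lborel. norm (case w of (z, s) \<Rightarrow> F z s) \<le> norm (case w of (z, s) \<Rightarrow> f z * g s)"
      using le by (auto intro!: AE_I2 order_trans[OF _ abs_ge_self])
  qed
  have inner: "(\<integral>z. F z s \<partial>lborel) = indicator {0..} s *\<^sub>R airy_exp (b - a) (x + y) (?z s)" for s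
  proof -
    have sep: "F z s = (indicator {0..} s *\<^sub>R airy_exp b y (?z s)) * (heat a x z *\<^sub>R exp (\<i> * of_real z * ?z s))" for z
      unfolding F_def airy_exp_def by (simp add: scaleR_conv_of_real algebra_simps flip: exp_add)
    have "(\<integral>z. F z s \<partial>lborel) = (indicator {0..} s *\<^sub>R airy_exp b y (?z s))
        * exp (\<i> * of_real x * ?z s - of_real a * (?z s)\<^sup>2)"
      by (simp only: sep integral_mult_right_zero heat_complex_exp[OF a])
    also have "\<dots> = indicator {0..} s *\<^sub>R airy_exp (b - a) (x + y) (?z s)"
      unfolding airy_exp_def by (simp add: algebra_simps flip: exp_add)
    finally show ?thesis .
  qed
  have iz: "(\<integral>s. F z s \<partial>lborel) = heat a x z *\<^sub>R (LINT s:{0..}|lborel. airy_exp b (z + y) (?z s))" for z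
    unfolding F_def set_lebesgue_integral_def
    by (subst integral_scaleR_right[symmetric], rule Bochner_Integration.integral_cong) (simp_all add: mult.commute)
  have "integrable lborel (\<lambda>z. \<integral>s. F z s \<partial>lborel)"
    using lborel_pair.integrable_fst[OF int] by simp
  then have "Re (\<integral>z. \<integral>s. F z s \<partial>lborel \<partial>lborel) = (\<integral>z. Re (\<integral>s. F z s \<partial>lborel) \<partial>lborel)"
    by simp
  also have "\<dots> = (\<integral>z. pi * (heat a x z * airy_shift b (z + y)) \<partial>lborel)"
    unfolding iz airy_shift_contour[OF c(1)] by (simp add: mult.left_commute)
  finally have "(\<integral>z. heat a x z * airy_shift b (z + y) \<partial>lborel) = 1 / pi * Re (\<integral>z. \<integral>s. F z s \<partial>lborel \<partial>lborel)"
    by simp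
  also have "(\<integral>z. \<integral>s. F z s \<partial>lborel \<partial>lborel) = (\<integral>s. \<integral>z. F z s \<partial>lborel \<partial>lborel)"
    by (rule lborel_pair.Fubini_integral[OF int, symmetric])
  also have "1 / pi * Re \<dots> = airy_shift (b - a) (x + y)"
    unfolding inner airy_shift_contour[OF c(2)] set_lebesgue_integral_def by simp
  finally show ?thesis .
qed

lemma heat_semigroup:
  assumes "s > 0" "r > 0"
  shows "(\<integral>z. heat s x z * heat r z y \<partial>lborel) = heat (s + r) x y"
proof -
  let ?\<sigma> = "sqrt (2 * s)" and ?\<tau> = "sqrt (2 * r)"
  have nd: "heat k u v = normal_density 0 (sqrt (2 * k)) (u - v)" if "k > 0" for k u v
    using that by (simp add: heat_def normal_density_def)
  have "(\<integral>z. heat s x z * heat r z y \<partial>lborel)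
      = (\<integral>z. normal_density 0 ?\<sigma> (x - z) * normal_density 0 ?\<tau> (z - y) \<partial>lborel)"
    using assms by (simp add: nd)
  also have "\<dots> = (\<integral>z. normal_density 0 ?\<sigma> ((x - y) - z) * normal_density 0 ?\<tau> z \<partial>lborel)"
    by (subst lborel_integral_real_affine[where c = 1 and t = y]) (auto simp: algebra_simps)
  also have "\<dots> = enn2real (\<integral>\<^sup>+z. ennreal (normal_density 0 ?\<sigma> ((x - y) - z) * normal_density 0 ?\<tau> z) \<partial>lborel)"
    by (rule integral_eq_nn_integral) auto
  also have "\<dots> = normal_density 0 (sqrt (?\<sigma>\<^sup>2 + ?\<tau>\<^sup>2)) (x - y)"
    using fun_cong[OF conv_normal_density_zero_mean[of ?\<sigma> ?\<tau>], of "x - y"] assms by simp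
  also have "\<dots> = heat (s + r) x y"
    using assms by (simp add: nd distrib_left)
  finally show ?thesis .
qed

section \<open>Composition with heat kernels\<close>

lemma weighted_space_pair_dominated:
  assumes "weighted_space M a b'" "weighted_space N a' b" and V: "dominated N M a' b' V"
  obtains K where "weighted_space_pair M N a b' a' b V K"
proof -
  interpret X: weighted_space M a b' by fact
  interpret Y: weighted_space N a' b by fact
  obtain C where C: "C > 0" "bounded_by N M a' b' C V" by (rule dominatedE[OF V])
  define I where "I = (\<integral>x. a x * b' x \<partial>M)"
  define J where "J = (\<integral>y. a' y * b y \<partial>N)"
  have IJ: "I \<ge> 0" "J \<ge> 0"
    unfolding I_def J_def using X.weight_pos Y.weight_pos by (auto intro!: integral_nonneg_AE AE_I2 simp: less_imp_le)
  have le: "\<bar>V y x\<bar> * a x \<le> C * a' y * (a x * b' x)" "b y * \<bar>V y x\<bar> \<le> C * b' x * (a' y * b y)"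
    if "y \<in> space N" "x \<in> space M" for x y
    using C(2) that X.weight_pos(1)[of x] Y.weight_pos(2)[of y]
      mult_right_mono[of "\<bar>V y x\<bar>" "C * (a' y * b' x)" "a x"] mult_right_mono[of "\<bar>V y x\<bar>" "C * (a' y * b' x)" "b y"]
    by (auto simp: algebra_simps)
  have i1: "integrable M (\<lambda>x. C * a' y * (a x * b' x))" for y using X.weight_integrable by simp
  have i2: "integrable N (\<lambda>y. C * b' x * (a' y * b y))" for x using Y.weight_integrable by simp
  have j1: "integrable M (\<lambda>x. \<bar>V y x\<bar> * a x)" if y: "y \<in> space N" for y
  proof (rule integrable_real_bound[OF i1[of y]])
    show "(\<lambda>x. \<bar>V y x\<bar> * a x) \<in> borel_measurable M"
      using y by (intro borel_measurable_times borel_measurable_abs dominated_app[OF V]) auto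
    show "\<bar>\<bar>V y x\<bar> * a x\<bar> \<le> C * a' y * (a x * b' x)" if "x \<in> space M" for x
      using le(1)[OF y that] X.weight_pos(1)[of x] by (simp add: abs_mult)
  qed
  have j2: "integrable N (\<lambda>y. b y * \<bar>V y x\<bar>)" if x: "x \<in> space M" for x
  proof (rule integrable_real_bound[OF i2[of x]])
    show "(\<lambda>y. b y * \<bar>V y x\<bar>) \<in> borel_measurable N"
      using x by (intro borel_measurable_times borel_measurable_abs dominated_app[OF V]) auto
    show "\<bar>b y * \<bar>V y x\<bar>\<bar> \<le> C * b' x * (a' y * b y)" if "y \<in> space N" for y
      using le(2)[OF that x] Y.weight_pos(2)[of y] by (simp add: abs_mult)
  qed
  show thesis
  proof (rule that, unfold_locales)
    show "(\<lambda>(y, x). V y x) \<in> borel_measurable (N \<Otimes>\<^sub>M M)" by (rule dominated_measurable[OF V])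
    show "(\<integral>x. \<bar>V y x\<bar> * a x \<partial>M) \<le> C * (I + J) * a' y" if y: "y \<in> space N" for y
    proof -
      have "(\<integral>x. \<bar>V y x\<bar> * a x \<partial>M) \<le> (\<integral>x. C * a' y * (a x * b' x) \<partial>M)"
        by (intro integral_mono j1 i1 y le)
      also have "\<dots> = C * I * a' y" by (simp add: I_def)
      also have "\<dots> \<le> C * (I + J) * a' y"
        using IJ C(1) Y.weight_pos(1)[of y] by (intro mult_right_mono mult_left_mono) auto
      finally show ?thesis .
    qed
    show "(\<integral>y. b y * \<bar>V y x\<bar> \<partial>N) \<le> C * (I + J) * b' x" if x: "x \<in> space M" for x
    proof -
      have "(\<integral>y. b y * \<bar>V y x\<bar> \<partial>N) \<le> (\<integral>y. C * b' x * (a' y * b y) \<partial>N)"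
        by (intro integral_mono j2 i2 x le)
      also have "\<dots> = C * J * b' x" by (simp add: J_def)
      also have "\<dots> \<le> C * (I + J) * b' x"
        using IJ C(1) X.weight_pos(2)[of x] by (intro mult_right_mono mult_left_mono) auto
      finally show ?thesis .
    qed
  qed (use j1 j2 in auto)
qed

lemma dominated_mult_left:
  assumes A: "dominated M N a b A" and [measurable]: "f \<in> borel_measurable M" and f: "\<And>x. \<bar>f x\<bar> \<le> 1"
    and pos: "\<And>x. a x > 0" "\<And>y. b y > 0"
  shows "dominated M N a b (\<lambda>x y. f x * A x y)"
proof -
  obtain C where C: "C > 0" "bounded_by M N a b C A" by (rule dominatedE[OF A])
  show ?thesis
  proof (rule dominatedI)
    show "(\<lambda>(x, y). f x * A x y) \<in> borel_measurable (M \<Otimes>\<^sub>M N)"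
      unfolding case_prod_beta by (intro borel_measurable_times dominated_app[OF A]) measurable
    show "\<bar>f x * A x y\<bar> \<le> C * (a x * b y)" if "x \<in> space M" "y \<in> space N" for x y
      using mult_mono[OF f[of x] bspec[OF bspec[OF C(2) that(1)] that(2)]] by (simp add: abs_mult)
  qed (rule pos)+
qed

text \<open>
  Exponential weights are preserved by the heat flow up to a constant, and they dominate the shifted Airy kernel.
\<close>

definition expw :: "real \<Rightarrow> real \<Rightarrow> real" where "expw c u = exp (- c * u)"

lemma expw_pos: "expw c u > 0" by (simp add: expw_def)

lemma dominated_airy_shift:
  assumes "c > b"
  shows "dominated lborel lborel (expw c) (expw c) (\<lambda>u v. airy_shift b (u + v))"
proof -
  obtain C where C: "C > 0" "\<forall>w. \<bar>airy_shift b w\<bar> \<le> C * exp (- c * w)" by (rule airy_shift_bound[OF assms])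
  show ?thesis
  proof (rule dominatedI)
    show "(\<lambda>(u, v). airy_shift b (u + v)) \<in> borel_measurable (lborel \<Otimes>\<^sub>M lborel)" by measurable
    show "\<bar>airy_shift b (u + v)\<bar> \<le> C * (expw c u * expw c v)" for u v
      using C(2)[rule_format, of "u + v"] by (simp add: expw_def algebra_simps flip: exp_add)
  qed (rule expw_pos)+
qed

lemma dominated_heat:
  assumes s: "s > 0" and H: "dominated lborel N (expw c) b H" and b: "\<And>v. b v > 0"
  shows "dominated lborel N (expw c) b (kcomp lborel (heat s) H)"
    and "v \<in> space N \<Longrightarrow> integrable lborel (\<lambda>z. heat s u z * H z v)"
proof -
  obtain C where C: "C > 0" "\<forall>z\<in>space lborel. \<forall>v\<in>space N. \<bar>H z v\<bar> \<le> C * (expw c z * b v)" by (rule dominatedE[OF H])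
  have le: "\<bar>heat s u z * H z v\<bar> \<le> C * b v * (heat s u z * exp (- c * z))" if "v \<in> space N" for u v z
  proof -
    have "\<bar>H z v\<bar> \<le> C * (expw c z * b v)" using C(2) that by simp
    from mult_left_mono[OF this heat_nonneg[OF s, of u z]] show ?thesis
      using heat_nonneg[OF s, of u z] by (simp add: abs_mult expw_def algebra_simps)
  qed
  have i: "integrable lborel (\<lambda>z. C * b v * (heat s u z * exp (- c * z)))" for u v
    using integrable_heat_exp[OF s] by simp
  show int: "integrable lborel (\<lambda>z. heat s u z * H z v)" if v: "v \<in> space N" for u v
    by (rule integrable_real_bound[OF i[of v u] _ le[OF v]])
       (use v in \<open>auto intro!: borel_measurable_times dominated_app[OF H]\<close>)
  show "dominated lborel N (expw c) b (kcomp lborel (heat s) H)"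
  proof (rule dominatedI)
    have "(\<lambda>w. \<integral>z. heat s (fst w) z * H z (snd w) \<partial>lborel) \<in> borel_measurable (lborel \<Otimes>\<^sub>M N)"
      by (rule lborel.borel_measurable_lebesgue_integral, unfold case_prod_beta)
         (intro borel_measurable_times dominated_app[OF H] heat_measurable; measurable)
    then show "(\<lambda>(u, v). kcomp lborel (heat s) H u v) \<in> borel_measurable (lborel \<Otimes>\<^sub>M N)"
      by (simp add: kcomp_def case_prod_beta)
    show "\<bar>kcomp lborel (heat s) H u v\<bar> \<le> C * exp (s * c\<^sup>2) * (expw c u * b v)" if v: "v \<in> space N" for u v
    proof -
      have "\<bar>kcomp lborel (heat s) H u v\<bar> \<le> (\<integral>z. \<bar>heat s u z * H z v\<bar> \<partial>lborel)"
        unfolding kcomp_def by (rule integral_abs_bound)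
      also have "\<dots> \<le> (\<integral>z. C * b v * (heat s u z * exp (- c * z)) \<partial>lborel)"
        by (intro integral_mono integrable_abs int i le v)
      also have "\<dots> = C * b v * exp (- c * u + s * c\<^sup>2)"
        using heat_exp_integral[OF s, of u c] by simp
      finally show ?thesis by (simp add: expw_def exp_add exp_diff algebra_simps exp_minus divide_inverse)
    qed
  qed (use b expw_pos in auto)
qed

lemma heat_comp_semigroup:
  assumes s: "s > 0" and r: "r > 0" and H: "dominated lborel N (expw c) b H" and b: "\<And>v. b v > 0" and v: "v \<in> space N"
  shows "kcomp lborel (heat s) (kcomp lborel (heat r) H) u v = kcomp lborel (heat (s + r)) H u v"
proof -
  obtain C where C: "C > 0" "\<forall>z\<in>space lborel. \<forall>v\<in>space N. \<bar>H z v\<bar> \<le> C * (expw c z * b v)" by (rule dominatedE[OF H])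
  have meas: "(\<lambda>(z, w). heat s u z * heat r z w * H w v) \<in> borel_measurable (lborel \<Otimes>\<^sub>M lborel)"
    unfolding case_prod_beta using v
    by (intro borel_measurable_times dominated_app[OF H] heat_measurable) auto
  have "integrable (lborel \<Otimes>\<^sub>M lborel) (\<lambda>(z, w). C * b v * (heat s u z * (heat r z w * exp (- c * w))))"
  proof (rule lborel_pair.Fubini_integrable)
    show "(\<lambda>(z, w). C * b v * (heat s u z * (heat r z w * exp (- c * w)))) \<in> borel_measurable (lborel \<Otimes>\<^sub>M lborel)"
      by measurable
    have "(\<integral>w. norm (C * b v * (heat s u z * (heat r z w * exp (- c * w)))) \<partial>lborel)
        = C * b v * exp (r * c\<^sup>2) * (heat s u z * exp (- c * z))" for z
      using C(1) b[of v] heat_nonneg[OF s, of u z] heat_nonneg[OF r, of z] heat_exp_integral[OF r, of z c]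
      by (simp add: abs_mult exp_add exp_diff exp_minus divide_inverse)
    then show "integrable lborel (\<lambda>z. \<integral>w. norm (case (z, w) of (z, w) \<Rightarrow> C * b v * (heat s u z * (heat r z w * exp (- c * w)))) \<partial>lborel)"
      using integrable_heat_exp[OF s, of u c] by simp
    show "AE z in lborel. integrable lborel (\<lambda>w. case (z, w) of (z, w) \<Rightarrow> C * b v * (heat s u z * (heat r z w * exp (- c * w))))"
      using integrable_heat_exp[OF r] by simp
  qed
  then have int: "integrable (lborel \<Otimes>\<^sub>M lborel) (\<lambda>(z, w). heat s u z * heat r z w * H w v)"
  proof (rule integrable_real_bound[OF _ meas])
    have "\<bar>heat s u z * heat r z w * H w v\<bar> \<le> C * b v * (heat s u z * (heat r z w * exp (- c * w)))" for z w
    proof -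
      have "\<bar>H w v\<bar> \<le> C * (expw c w * b v)" using C(2) v by simp
      moreover have "0 \<le> heat s u z * heat r z w"
        using heat_nonneg[OF s, of u z] heat_nonneg[OF r, of z w] by simp
      ultimately have "heat s u z * heat r z w * \<bar>H w v\<bar>
          \<le> heat s u z * heat r z w * (C * (expw c w * b v))" by (rule mult_left_mono)
      then show ?thesis
        using heat_nonneg[OF s, of u z] heat_nonneg[OF r, of z w]
        by (simp add: abs_mult expw_def algebra_simps)
    qed
    then show "\<bar>case w of (z, w) \<Rightarrow> heat s u z * heat r z w * H w v\<bar>
      \<le> (case w of (z, w) \<Rightarrow> C * b v * (heat s u z * (heat r z w * exp (- c * w))))" for w
      by (simp add: case_prod_beta)
  qed
  have "kcomp lborel (heat s) (kcomp lborel (heat r) H) u v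
      = kcomp lborel (kcomp lborel (heat s) (heat r)) H u v"
    by (rule kcomp_assoc[symmetric]) (use int in \<open>auto simp: lborel.sigma_finite_measure_axioms\<close>)
  also have "kcomp lborel (heat s) (heat r) = heat (s + r)"
    by (intro ext) (simp add: kcomp_def heat_semigroup[OF s r])
  finally show ?thesis .
qed

text \<open>
  A Gaussian lies below any exponential: complete the square in \<open>\<bar>u - v\<bar>\<close>. The constant is uniform for
  times in \<open>{\<delta>..T}\<close>.
\<close>

lemma heat_exp_abs_bound:
  assumes "0 < \<delta>" "\<delta> \<le> s" "s \<le> T" "\<theta> \<ge> 0"
  shows "heat s u v \<le> 1 / sqrt (4 * pi * \<delta>) * exp (T * \<theta>\<^sup>2) * exp (- \<theta> * \<bar>u - v\<bar>)"
proof -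
  have s: "s > 0" using assms by simp
  have "0 \<le> (\<bar>u - v\<bar> - 2 * s * \<theta>)\<^sup>2" by simp
  then have "4 * s * \<theta> * \<bar>u - v\<bar> \<le> (u - v)\<^sup>2 + 4 * s\<^sup>2 * \<theta>\<^sup>2"
    by (simp add: power2_eq_square algebra_simps flip: abs_mult)
  then have "- ((u - v)\<^sup>2 / (4 * s)) \<le> s * \<theta>\<^sup>2 - \<theta> * \<bar>u - v\<bar>"
    using s by (simp add: field_simps power2_eq_square)
  also have "\<dots> \<le> T * \<theta>\<^sup>2 - \<theta> * \<bar>u - v\<bar>" using assms by (intro diff_right_mono mult_right_mono) auto
  finally have "exp (- ((u - v)\<^sup>2 / (4 * s))) \<le> exp (T * \<theta>\<^sup>2) * exp (- \<theta> * \<bar>u - v\<bar>)"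
    by (simp flip: exp_add)
  moreover have "1 / sqrt (4 * pi * s) \<le> 1 / sqrt (4 * pi * \<delta>)"
    using assms by (intro divide_left_mono) auto
  ultimately have "heat s u v \<le> 1 / sqrt (4 * pi * \<delta>) * (exp (T * \<theta>\<^sup>2) * exp (- \<theta> * \<bar>u - v\<bar>))"
    unfolding heat_def using assms by (intro mult_mono) auto
  then show ?thesis by (simp only: mult.assoc)
qed

text \<open>
  On a half line bounded below, \<open>exp (- p y)\<close> is controlled by \<open>exp (- q \<bar>y\<bar>)\<close> as soon as \<open>p \<ge> q\<close>. All
  comparisons between weights behind a cutoff are instances of this.
\<close>

lemma half_line_linear_bound:
  fixes y :: real
  assumes "y \<ge> - \<kappa>" "\<kappa> \<ge> 0" "p \<ge> q" "p + q \<ge> 0"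
  shows "- p * y \<le> (p + q) * \<kappa> - q * \<bar>y\<bar>"
proof (cases "y \<ge> 0")
  case True
  have "q * y \<le> p * y" using True assms(3) by (rule mult_right_mono[rotated])
  moreover have "(p + q) * \<kappa> \<ge> 0" using assms by simp
  ultimately show ?thesis using True by simp
next
  case False
  have "(p + q) * (- y) \<le> (p + q) * \<kappa>" using assms by (intro mult_left_mono) auto
  then show ?thesis using False by (simp add: algebra_simps)
qed

text \<open>
  By comparison with \<open>1 / (1 + y\<^sup>2)\<close>.
\<close>

lemma integrable_exp_abs:
  assumes d: "d > 0"
  shows "integrable lborel (\<lambda>y::real. exp (- d * \<bar>y\<bar>))"
proof -
  have "integrable lborel (\<lambda>x::real. inverse (1 + x\<^sup>2))"
    using integrable_inverse_1_plus_square by (simp add: set_integrable_def)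
  then have "integrable lborel (\<lambda>x::real. (1 + 2 / d\<^sup>2) * inverse (1 + x\<^sup>2))" by simp
  then show ?thesis
  proof (rule integrable_real_bound)
    show "\<bar>exp (- d * \<bar>y\<bar>)\<bar> \<le> (1 + 2 / d\<^sup>2) * inverse (1 + y\<^sup>2)" for y :: real
    proof -
      have "1 + d * \<bar>y\<bar> + (d * \<bar>y\<bar>)\<^sup>2 / 2 \<le> exp (d * \<bar>y\<bar>)"
        using d by (intro exp_lower_Taylor_quadratic) auto
      moreover have "d * \<bar>y\<bar> \<ge> 0" using d by simp
      ultimately have e: "1 + d\<^sup>2 * y\<^sup>2 / 2 \<le> exp (d * \<bar>y\<bar>)" by (simp add: power_mult_distrib)
      have "1 + y\<^sup>2 \<le> (1 + 2 / d\<^sup>2) * (1 + d\<^sup>2 * y\<^sup>2 / 2)"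
        using d by (simp add: field_simps)
      also have "\<dots> \<le> (1 + 2 / d\<^sup>2) * exp (d * \<bar>y\<bar>)"
        using e by (intro mult_left_mono) (auto intro: add_nonneg_nonneg)
      finally have "exp (- d * \<bar>y\<bar>) * (1 + y\<^sup>2) \<le> exp (- d * \<bar>y\<bar>) * ((1 + 2 / d\<^sup>2) * exp (d * \<bar>y\<bar>))"
        by (intro mult_left_mono) auto
      also have "\<dots> = 1 + 2 / d\<^sup>2" by (simp add: exp_minus field_simps)
      finally have *: "exp (- d * \<bar>y\<bar>) * (1 + y\<^sup>2) \<le> 1 + 2 / d\<^sup>2" .
      have "1 + y\<^sup>2 > 0" by (simp add: add_pos_nonneg)
      then have "exp (- d * \<bar>y\<bar>) \<le> (1 + 2 / d\<^sup>2) * inverse (1 + y\<^sup>2)"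
        using * by (simp add: pos_le_divide_eq flip: divide_inverse)
      then show ?thesis by simp
    qed
  qed measurable
qed

section \<open>The last-exceedance decomposition\<close>

lemma dominated_zero: "(\<And>x. a x > 0) \<Longrightarrow> (\<And>y. b y > 0) \<Longrightarrow> dominated M N a b (\<lambda>x y. 0)"
  by (rule dominatedI[where C = 0]) auto

lemma dominated_sum:
  assumes "finite J" "\<And>j. j \<in> J \<Longrightarrow> dominated M N a b (A j)" "\<And>x. a x > 0" "\<And>y. b y > 0"
  shows "dominated M N a b (\<lambda>x y. \<Sum>j\<in>J. A j x y)"
  using assms(1,2)
proof (induction J rule: finite_induct)
  case empty
  then show ?case by (simp, intro dominated_zero assms(3,4))
next
  case (insert j J)
  then show ?case using dominated_add[of M N a b "A j" "\<lambda>x y. \<Sum>j\<in>J. A j x y"] assms(3,4) by simp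
qed

locale airy_times =
  fixes n :: nat and t x :: "nat \<Rightarrow> real"
  assumes n_pos: "n \<ge> 1" and t_mono: "strict_mono_on {1..n} t"
begin

text \<open>
  The given times, preceded by the auxiliary time \<open>t 1 - 1\<close>.
\<close>

definition tau :: "nat \<Rightarrow> real" where "tau i = (if i = 0 then t 1 - 1 else t i)"

lemma tau_pos [simp]: "i > 0 \<Longrightarrow> tau i = t i"
  by (simp add: tau_def)

lemma tau_0: "tau 0 = t 1 - 1"
  by (simp add: tau_def)

lemma tau_less: "i < j \<Longrightarrow> j \<le> n \<Longrightarrow> tau i < tau j"
  using strict_mono_onD[OF t_mono, of 1 j] strict_mono_onD[OF t_mono, of i j]
  by (cases "i = 0"; cases "j = 1") (auto simp: tau_def)

lemma t_less_iff: "i \<in> {1..n} \<Longrightarrow> j \<in> {1..n} \<Longrightarrow> t i < t j \<longleftrightarrow> i < j"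
  using strict_mono_onD[OF t_mono, of i j] strict_mono_onD[OF t_mono, of j i]
  by (cases i j rule: linorder_cases) auto

lemma t_inj: "inj_on t {1..n}"
  using t_mono strict_mono_on_imp_inj_on by blast

abbreviation below :: "nat \<Rightarrow> real \<Rightarrow> real" where "below j z \<equiv> indicator {..x j} z"
abbreviation above :: "nat \<Rightarrow> real \<Rightarrow> real" where "above j z \<equiv> indicator {x j<..} z"

lemma below_add_above: "below j z + above j z = 1"
  by (auto simp: indicator_def)

text \<open>
  Heat flow from \<open>tau (n - k)\<close> to \<open>tau n\<close> that stays below the levels \<open>x j\<close> at all times after the
  starting time, applied to \<open>exp (- (tau n - r) \<Delta>) B0\<close>. The recursion runs over the number \<open>k\<close> of
  remaining steps; \<open>surv\<close> is indexed by the starting time. The reference time \<open>r\<close> is \<open>tau 0\<close> in the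
  factorisation and \<open>t 1\<close> in the kernel on the line.
\<close>

primrec surv_aux :: "real \<Rightarrow> nat \<Rightarrow> real \<Rightarrow> real \<Rightarrow> real" where
  "surv_aux r 0 = (\<lambda>u v. airy_shift (tau n - r) (u + v))"
| "surv_aux r (Suc k) = kcomp lborel (heat (tau (n - k) - tau (n - Suc k)))
     (\<lambda>z v. below (n - k) z * surv_aux r k z v)"

definition surv :: "real \<Rightarrow> nat \<Rightarrow> real \<Rightarrow> real \<Rightarrow> real" where
  "surv r i = surv_aux r (n - i)"

lemma surv_top: "surv r n = (\<lambda>u v. airy_shift (tau n - r) (u + v))"
  by (simp add: surv_def)

lemma surv_step:
  assumes "i < n"
  shows "surv r i = kcomp lborel (heat (tau (Suc i) - tau i)) (\<lambda>z v. below (Suc i) z * surv r (Suc i) z v)"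
proof -
  have "n - i = Suc (n - Suc i)" "n - (n - Suc i) = Suc i" "n - Suc (n - Suc i) = i" using assms by auto
  then show ?thesis by (simp only: surv_def surv_aux.simps)
qed

lemma dominated_below:
  "dominated lborel lborel (expw c) (expw c) A \<Longrightarrow> dominated lborel lborel (expw c) (expw c) (\<lambda>z v. below j z * A z v)"
  by (rule dominated_mult_left) (auto simp: expw_pos)

lemma dominated_above:
  "dominated lborel lborel (expw c) (expw c) A \<Longrightarrow> dominated lborel lborel (expw c) (expw c) (\<lambda>z v. above j z * A z v)"
  by (rule dominated_mult_left) (auto simp: expw_pos)

lemma surv_dominated:
  assumes c: "c > tau n - r" and i: "i \<le> n"
  shows "dominated lborel lborel (expw c) (expw c) (surv r i)"
  using i
proof (induction rule: inc_induct)
  case base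
  then show ?case using dominated_airy_shift[OF c] by (simp add: surv_top)
next
  case (step i)
  have "tau (Suc i) - tau i > 0" using tau_less[of i "Suc i"] step by simp
  then show ?case
    unfolding surv_step[OF step(2)] by (rule dominated_heat(1)[OF _ dominated_below[OF step.IH] expw_pos])
qed

text \<open>
  Changing the reference time is composition with a heat kernel on the right: the flow acts on the first variable
  only, and on \<open>exp (- (tau n - r) \<Delta>) B0\<close>, a function of the sum of both variables, left and right heat flow agree.
\<close>

lemma surv_change_reference:
  assumes r: "r < r'" and i: "i \<le> n"
  shows "surv r' i u y = kcomp lborel (surv r i) (heat (r' - r)) u y"
  using i
proof (induction arbitrary: u rule: inc_induct)
  case base
  have "kcomp lborel (surv r n) (heat (r' - r)) u y
      = (\<integral>v. heat (r' - r) y v * airy_shift (tau n - r) (v + u) \<partial>lborel)"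
    by (simp add: kcomp_def surv_top heat_sym[of _ _ y] mult.commute add.commute)
  also have "\<dots> = airy_shift (tau n - r') (u + y)"
    using heat_airy_shift[of "r' - r" y "tau n - r" u] r by (simp add: add.commute)
  finally show ?case by (simp add: surv_top)
next
  case (step i)
  let ?s = "tau (Suc i) - tau i"
  let ?A = "\<lambda>z v. below (Suc i) z * surv r (Suc i) z v"
  have s: "?s > 0" using tau_less[of i "Suc i"] step by simp
  define c where "c = tau n - r + 1"
  have A: "dominated lborel lborel (expw c) (expw c) ?A"
    by (intro dominated_below surv_dominated) (use step in \<open>auto simp: c_def\<close>)
  obtain C where C: "C > 0" "\<forall>z\<in>space lborel. \<forall>v\<in>space lborel. \<bar>?A z v\<bar> \<le> C * (expw c z * expw c v)"
    by (rule dominatedE[OF A])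
  have "surv r' i u y = kcomp lborel (heat ?s) (\<lambda>z v. below (Suc i) z * surv r' (Suc i) z v) u y"
    using surv_step[OF step(2)] by simp
  also have "(\<lambda>z. below (Suc i) z * surv r' (Suc i) z y) = (\<lambda>z. kcomp lborel ?A (heat (r' - r)) z y)"
    by (simp add: step.IH kcomp_def mult.assoc)
  then have "kcomp lborel (heat ?s) (\<lambda>z v. below (Suc i) z * surv r' (Suc i) z v) u y
      = kcomp lborel (heat ?s) (kcomp lborel ?A (heat (r' - r))) u y"
    unfolding kcomp_def[of lborel "heat ?s"] by (simp add: fun_eq_iff)
  also have "\<dots> = kcomp lborel (kcomp lborel (heat ?s) ?A) (heat (r' - r)) u y"
  proof (rule kcomp_assoc[symmetric])
    show "integrable (lborel \<Otimes>\<^sub>M lborel) (\<lambda>(z, w). heat ?s u z * ?A z w * heat (r' - r) w y)"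
    proof (rule integrable_pair_product_bound)
      show "(\<lambda>(z, w). heat ?s u z * ?A z w * heat (r' - r) w y) \<in> borel_measurable (lborel \<Otimes>\<^sub>M lborel)"
        unfolding case_prod_beta
        by (intro borel_measurable_times[OF borel_measurable_times] dominated_app[OF A] heat_measurable) measurable
      show "integrable lborel (\<lambda>z. heat ?s u z * exp (- c * z))" by (rule integrable_heat_exp[OF s])
      show "integrable lborel (\<lambda>w. heat (r' - r) y w * exp (- c * w))"
        using r by (intro integrable_heat_exp) auto
      fix z w
      have "\<bar>?A z w\<bar> \<le> C * (expw c z * expw c w)" using C(2) by simp
      then have "heat ?s u z * \<bar>?A z w\<bar> * heat (r' - r) w y
          \<le> heat ?s u z * (C * (expw c z * expw c w)) * heat (r' - r) w y"
        using s r heat_nonneg by (intro mult_right_mono mult_left_mono) auto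
      then show "\<bar>case (z, w) of (z, w) \<Rightarrow> heat ?s u z * ?A z w * heat (r' - r) w y\<bar>
          \<le> C * (heat ?s u z * exp (- c * z) * (heat (r' - r) y w * exp (- c * w)))"
        using s r heat_nonneg[of ?s u z] heat_nonneg[of "r' - r" w y]
        by (simp add: abs_mult expw_def heat_sym[of _ y] algebra_simps)
    qed (fact lborel.sigma_finite_measure_axioms)+
  qed (fact lborel.sigma_finite_measure_axioms)+
  also have "\<dots> = kcomp lborel (surv r i) (heat (r' - r)) u y"
    using surv_step[OF step(2)] by simp
  finally show ?case .
qed

text \<open>
  The operator of the theorem, started at the \<open>i\<close>-th barrier.
\<close>

lemma barrier_foldr:
  assumes "1 \<le> i" "i \<le> n"
  shows "foldr (\<lambda>i R. Pbar (x i) \<circ> heat_op (- (t i - t (Suc i))) \<circ> R) [i..<n] (Pbar (x n))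
      (\<lambda>z. heat_B0 (t n - t 1) z y) u = below i u * surv (t 1) i u y"
  using assms(2,1)
proof (induction arbitrary: u rule: inc_induct)
  case base
  then show ?case by (simp add: Pbar_def surv_top heat_B0_eq_airy_shift)
next
  case (step i)
  let ?f = "foldr (\<lambda>i R. Pbar (x i) \<circ> heat_op (- (t i - t (Suc i))) \<circ> R) [Suc i..<n] (Pbar (x n)) (\<lambda>z. heat_B0 (t n - t 1) z y)"
  have "t (Suc i) - t i \<noteq> 0" using tau_less[of i "Suc i"] step by simp
  then have "heat_op (- (t i - t (Suc i))) ?f u = (\<integral>z. heat (t (Suc i) - t i) u z * ?f z \<partial>lborel)"
    by (simp add: heat_op_def heat_def)
  also have "\<dots> = surv (t 1) i u y"
  proof -
    have IH: "?f z = below (Suc i) z * surv (t 1) (Suc i) z y" for z by (rule step.IH) simp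
    show ?thesis unfolding IH surv_step[OF step(2)] kcomp_def using step by simp
  qed
  finally have hop: "heat_op (- (t i - t (Suc i))) ?f u = surv (t 1) i u y" .
  have "foldr (\<lambda>i R. Pbar (x i) \<circ> heat_op (- (t i - t (Suc i))) \<circ> R) [i..<n] (Pbar (x n))
      (\<lambda>z. heat_B0 (t n - t 1) z y) u = Pbar (x i) (heat_op (- (t i - t (Suc i))) ?f) u"
    by (simp only: upt_conv_Cons[OF step(2)] foldr.simps o_apply)
  also have "\<dots> = below i u * surv (t 1) i u y" by (simp only: Pbar_def hop)
  finally show ?case .
qed

lemma airy1_kernel_eq:
  "airy1_kernel n t x u y = - (airy_shift 0 (u + y) - below 1 u * surv (t 1) 1 u y)"
  using barrier_foldr[of 1 y u] n_pos
  by (simp add: airy1_kernel_def barrier_op_def B0_def airy_Ai_eq_airy_shift)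

definition exceed :: "nat \<Rightarrow> real \<Rightarrow> real \<Rightarrow> real" where
  "exceed j z v = above j z * surv (tau 0) j z v"

lemma exceed_dominated:
  assumes "c > tau n - tau 0" "j \<le> n"
  shows "dominated lborel lborel (expw c) (expw c) (exceed j)"
  unfolding exceed_def[abs_def] by (intro dominated_above surv_dominated assms)

text \<open>
  The free flow from \<open>tau i\<close> either stays below all later levels or exceeds one of them for a last time; after
  that time \<open>tau j\<close> it stays below. One step of the proof lets the flow run to the next time, where
  \<open>1 = below + above\<close> splits off the term with \<open>j = Suc i\<close>, and the semigroup property merges the
  first step with the later ones.
\<close>

theorem airy_shift_decomposition:
  assumes "i \<le> n"
  shows "airy_shift (tau i - tau 0) (u + v)
    = surv (tau 0) i u v + (\<Sum>j\<in>{Suc i..n}. kcomp lborel (heat (tau j - tau i)) (exceed j) u v)"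
  using assms
proof (induction arbitrary: u rule: inc_induct)
  case base
  then show ?case by (simp add: surv_top)
next
  case (step i)
  let ?s = "tau (Suc i) - tau i" and ?B = "\<lambda>z v. below (Suc i) z * surv (tau 0) (Suc i) z v"
  let ?E = "\<lambda>j. kcomp lborel (heat (tau j - tau (Suc i))) (exceed j)"
  have s: "?s > 0" using tau_less[of i "Suc i"] step by simp
  define c where "c = tau n - tau 0 + 1"
  have c: "c > tau n - tau 0" by (simp add: c_def)
  have B: "dominated lborel lborel (expw c) (expw c) ?B"
    by (intro dominated_below surv_dominated c) (use step in auto)
  have E: "dominated lborel lborel (expw c) (expw c) (exceed j)" if "j \<le> n" for j
    by (rule exceed_dominated[OF c that])
  have rs: "tau j - tau (Suc i) > 0" if "j \<in> {Suc (Suc i)..n}" for j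
    using tau_less[of "Suc i" j] that by simp
  have EE: "dominated lborel lborel (expw c) (expw c) (?E j)" if "j \<in> {Suc (Suc i)..n}" for j
    using that by (intro dominated_heat(1)[OF rs E expw_pos]) auto
  have IH: "airy_shift (tau (Suc i) - tau 0) (z + v) = ?B z v + exceed (Suc i) z v + (\<Sum>j\<in>{Suc (Suc i)..n}. ?E j z v)" for z
  proof -
    have "surv (tau 0) (Suc i) z v = ?B z v + exceed (Suc i) z v"
      unfolding exceed_def distrib_right[symmetric] below_add_above by simp
    then show ?thesis using step.IH[of z] by simp
  qed
  have "airy_shift (tau i - tau 0) (u + v) = (\<integral>z. heat ?s u z * airy_shift (tau (Suc i) - tau 0) (z + v) \<partial>lborel)"
    using heat_airy_shift[OF s, of u "tau (Suc i) - tau 0" v] by simp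
  also have "\<dots> = (\<integral>z. heat ?s u z * ?B z v + heat ?s u z * exceed (Suc i) z v
      + (\<Sum>j\<in>{Suc (Suc i)..n}. heat ?s u z * ?E j z v) \<partial>lborel)"
    unfolding IH by (simp only: distrib_left sum_distrib_left)
  also have "\<dots> = kcomp lborel (heat ?s) ?B u v + kcomp lborel (heat ?s) (exceed (Suc i)) u v
      + (\<Sum>j\<in>{Suc (Suc i)..n}. kcomp lborel (heat ?s) (?E j) u v)"
  proof -
    have "integrable lborel (\<lambda>z. heat ?s u z * ?B z v)" "integrable lborel (\<lambda>z. heat ?s u z * exceed (Suc i) z v)"
      "\<And>j. j \<in> {Suc (Suc i)..n} \<Longrightarrow> integrable lborel (\<lambda>z. heat ?s u z * ?E j z v)"
      using dominated_heat(2)[OF s B expw_pos] dominated_heat(2)[OF s E[of "Suc i"] expw_pos] dominated_heat(2)[OF s EE expw_pos] step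
      by auto
    then show ?thesis
      unfolding kcomp_def[of lborel "heat ?s"]
      by (subst Bochner_Integration.integral_add Bochner_Integration.integral_sum; (intro Bochner_Integration.integrable_add Bochner_Integration.integrable_sum)?; simp)+
  qed
  also have "kcomp lborel (heat ?s) ?B u v = surv (tau 0) i u v"
    using surv_step[OF step(2)] by simp
  also have "(\<Sum>j\<in>{Suc (Suc i)..n}. kcomp lborel (heat ?s) (?E j) u v)
      = (\<Sum>j\<in>{Suc (Suc i)..n}. kcomp lborel (heat (tau j - tau i)) (exceed j) u v)"
  proof (intro sum.cong refl)
    fix j assume j: "j \<in> {Suc (Suc i)..n}"
    have "kcomp lborel (heat ?s) (?E j) u v = kcomp lborel (heat (?s + (tau j - tau (Suc i)))) (exceed j) u v"
      by (rule heat_comp_semigroup[OF s rs[OF j] E expw_pos]) (use j in auto)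
    then show "kcomp lborel (heat ?s) (?E j) u v = kcomp lborel (heat (tau j - tau i)) (exceed j) u v" by simp
  qed
  also have "surv (tau 0) i u v + kcomp lborel (heat ?s) (exceed (Suc i)) u v
        + (\<Sum>j\<in>{Suc (Suc i)..n}. kcomp lborel (heat (tau j - tau i)) (exceed j) u v)
      = surv (tau 0) i u v + (\<Sum>j\<in>{Suc i..n}. kcomp lborel (heat (tau j - tau i)) (exceed j) u v)"
    using step by (subst sum.atLeast_Suc_atMost[of "Suc i"]) auto
  finally show ?case .
qed

end

section \<open>The extended space and its weights\<close>

context airy_times
begin

text \<open>
  Constants for the weights: \<open>gap\<close> is a lower bound for the time increments, \<open>bnd\<close> an exponent larger than all
  times and increments, and \<open>- floor_level\<close> a lower bound for the levels.
\<close>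

definition gap :: real where
  "gap = Min (insert 1 ((\<lambda>(i, j). tau j - tau i) ` {(i, j). i < j \<and> j \<le> n}))"

lemma gap: "gap > 0" "gap \<le> 1" "i < j \<Longrightarrow> j \<le> n \<Longrightarrow> gap \<le> tau j - tau i"
proof -
  have "finite {(i, j). i < j \<and> j \<le> n}"
    by (rule finite_subset[of _ "{..n} \<times> {..n}"]) auto
  then have fin: "finite (insert 1 ((\<lambda>(i, j). tau j - tau i) ` {(i, j). i < j \<and> j \<le> n}))" by simp
  show "gap > 0" unfolding gap_def using fin tau_less by (subst Min_gr_iff) auto
  show "gap \<le> 1" unfolding gap_def using fin by (intro Min_le) auto
  show "gap \<le> tau j - tau i" if "i < j" "j \<le> n"
    unfolding gap_def using that by (intro Min_le[OF fin] insertI2 image_eqI[of _ _ "(i, j)"]) auto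
qed

definition bnd :: real where "bnd = 3 + 2 * (\<Sum>i\<le>n. \<bar>tau i\<bar>)"

lemma abs_tau_le: "i \<le> n \<Longrightarrow> \<bar>tau i\<bar> \<le> (\<Sum>i\<le>n. \<bar>tau i\<bar>)"
  by (rule member_le_sum) auto

lemma bnd: "bnd \<ge> 3" "i \<le> n \<Longrightarrow> \<bar>tau i\<bar> + 2 \<le> bnd" "i \<le> n \<Longrightarrow> j \<le> n \<Longrightarrow> tau j - tau i + 2 \<le> bnd"
proof -
  have 0: "(\<Sum>i\<le>n. \<bar>tau i\<bar>) \<ge> 0" by (simp add: sum_nonneg)
  show "bnd \<ge> 3" using 0 by (simp add: bnd_def)
  show "i \<le> n \<Longrightarrow> \<bar>tau i\<bar> + 2 \<le> bnd" using abs_tau_le[of i] 0 by (simp add: bnd_def)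
  show "tau j - tau i + 2 \<le> bnd" if "i \<le> n" "j \<le> n"
    using abs_tau_le[OF that(1)] abs_tau_le[OF that(2)] by (simp add: bnd_def)
qed

definition floor_level :: real where "floor_level = (\<Sum>j\<in>{1..n}. \<bar>x j\<bar>)"

lemma floor_level: "floor_level \<ge> 0" "j \<in> {1..n} \<Longrightarrow> x j \<ge> - floor_level"
proof -
  show "floor_level \<ge> 0" by (simp add: floor_level_def sum_nonneg)
  show "x j \<ge> - floor_level" if "j \<in> {1..n}"
    using member_le_sum[of j "{1..n}" "\<lambda>j. \<bar>x j\<bar>"] that by (simp add: floor_level_def)
qed

text \<open>
  Conjugation by these weights makes the kernels integrable. On the line both weights use the large exponent
  \<open>bnd\<close>, which \<open>airy_shift_bound\<close> allows, and \<open>lineL u * lineR u = exp (- \<bar>u\<bar>)\<close>. On the extended space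
  the exponent is the time coordinate itself: it increases from one time to a later one by at least \<open>gap\<close>, and
  this leaves the decay \<open>exp (- gap * \<bar>y\<bar>)\<close> for the heat kernel behind a cutoff.
\<close>

definition lineL :: "real \<Rightarrow> real" where "lineL u = exp (bnd * u - \<bar>u\<bar>)"
abbreviation "lineR \<equiv> expw bnd"

definition extM :: "(real \<times> real) measure" where "extM = count_space (t ` {1..n}) \<Otimes>\<^sub>M lborel"
definition extL :: "real \<times> real \<Rightarrow> real" where "extL \<xi> = exp (- fst \<xi> * snd \<xi>)"
definition extR :: "real \<times> real \<Rightarrow> real" where "extR \<xi> = exp (fst \<xi> * snd \<xi> - gap * \<bar>snd \<xi>\<bar>)"

lemma lineL_pos: "lineL u > 0" and extL_pos: "extL \<xi> > 0" and extR_pos: "extR \<xi> > 0"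
  by (simp_all add: lineL_def extL_def extR_def)

lemma weighted_line: "weighted_space lborel lineL lineR"
proof unfold_locales
  have "lineL u * lineR u = exp (- 1 * \<bar>u\<bar>)" for u
    by (simp add: lineL_def expw_def flip: exp_add)
  then show "integrable lborel (\<lambda>u. lineL u * lineR u)"
    using integrable_exp_abs[of 1] by simp
qed (simp_all add: lineL_pos expw_pos, simp_all add: lineL_def[abs_def] expw_def[abs_def])

lemma fst_ext: "fst \<in> borel_measurable extM"
  and snd_ext: "snd \<in> borel_measurable extM"
proof -
  have "(\<lambda>s. s) \<in> measurable (count_space (t ` {1..n})) borel" by simp
  from measurable_compose[OF measurable_fst this] show "fst \<in> borel_measurable extM" by (simp add: extM_def)
  have "snd \<in> measurable extM lborel" by (simp add: extM_def)
  then show "snd \<in> borel_measurable extM" by simp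
qed

lemma fst_ext_app: "f \<in> measurable M extM \<Longrightarrow> (\<lambda>w. fst (f w)) \<in> borel_measurable M"
  and snd_ext_app: "f \<in> measurable M extM \<Longrightarrow> (\<lambda>w. snd (f w)) \<in> borel_measurable M"
  using measurable_compose[OF _ fst_ext] measurable_compose[OF _ snd_ext] by auto

lemma space_extM: "space extM = t ` {1..n} \<times> UNIV"
  by (simp add: extM_def space_pair_measure)

lemma ext_cases:
  assumes "\<xi> \<in> space extM"
  obtains i y where "i \<in> {1..n}" "\<xi> = (t i, y)"
  using assms unfolding space_extM by auto

lemma ext_pair: "pair_sigma_finite (count_space (t ` {1..n})) (lborel :: real measure)"
proof -
  interpret A: sigma_finite_measure "count_space (t ` {1..n})" by (rule sigma_finite_measure_count_space_finite) simp
  show ?thesis by unfold_locales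
qed

lemma sigma_finite_ext: "sigma_finite_measure extM"
proof -
  interpret pair_sigma_finite "count_space (t ` {1..n})" "lborel :: real measure" by (rule ext_pair)
  show ?thesis unfolding extM_def by unfold_locales
qed

lemma integral_extM:
  assumes "integrable extM (f :: _ \<Rightarrow> real)"
  shows "(\<integral>\<xi>. f \<xi> \<partial>extM) = (\<Sum>j\<in>{1..n}. \<integral>z. f (t j, z) \<partial>lborel)"
proof -
  interpret P: pair_sigma_finite "count_space (t ` {1..n})" "lborel :: real measure" by (rule ext_pair)
  have "(\<integral>\<xi>. f \<xi> \<partial>extM) = (\<integral>s. \<integral>z. f (s, z) \<partial>lborel \<partial>count_space (t ` {1..n}))"
    using P.integral_fst'[of f] assms by (simp add: extM_def)
  also have "\<dots> = (\<Sum>s\<in>t ` {1..n}. \<integral>z. f (s, z) \<partial>lborel)"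
    by (rule lebesgue_integral_count_space_finite) simp
  also have "\<dots> = (\<Sum>j\<in>{1..n}. \<integral>z. f (t j, z) \<partial>lborel)"
    by (rule sum.reindex[OF t_inj, unfolded o_def])
  finally show ?thesis .
qed

lemma weighted_ext: "weighted_space extM extL extR"
proof -
  interpret P: pair_sigma_finite "count_space (t ` {1..n})" "lborel :: real measure" by (rule ext_pair)
  interpret sigma_finite_measure extM by (rule sigma_finite_ext)
  note [measurable] = fst_ext snd_ext
  show ?thesis
  proof unfold_locales
    show L: "extL \<in> borel_measurable extM" unfolding extL_def[abs_def] by measurable
    show R: "extR \<in> borel_measurable extM" unfolding extR_def[abs_def] by measurable
    have eq: "extL \<xi> * extR \<xi> = exp (- gap * \<bar>snd \<xi>\<bar>)" for \<xi>
      by (simp add: extL_def extR_def flip: exp_add)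
    show "integrable extM (\<lambda>\<xi>. extL \<xi> * extR \<xi>)"
      unfolding extM_def
    proof (rule integrable_pair_product_bound[where C = 1 and f = "\<lambda>_. 1" and g = "\<lambda>y. exp (- gap * \<bar>y\<bar>)"])
      show "(\<lambda>\<xi>. extL \<xi> * extR \<xi>) \<in> borel_measurable (count_space (t ` {1..n}) \<Otimes>\<^sub>M lborel)"
        using L R unfolding extM_def by simp
      show "integrable (count_space (t ` {1..n})) (\<lambda>_. 1 :: real)" by (simp add: integrable_count_space)
    qed (unfold_locales, use integrable_exp_abs[OF gap(1)] in \<open>simp_all add: eq\<close>)
  qed (rule extL_pos extR_pos)+
qed

text \<open>
  The cutoff as a finite sum of products, which makes its measurability evident.
\<close>

definition active :: "real \<times> real \<Rightarrow> real" where
  "active \<xi> = (\<Sum>j\<in>{1..n}. indicator {t j} (fst \<xi>) * above j (snd \<xi>))"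

lemma sum_indicator_time:
  fixes g :: "nat \<Rightarrow> real"
  assumes "i \<in> {1..n}"
  shows "(\<Sum>j\<in>{1..n}. indicator {t j} (t i) * g j) = g i"
proof -
  have "(\<Sum>j\<in>{1..n}. indicator {t j} (t i) * g j) = (\<Sum>j\<in>{1..n}. if j = i then g j else 0)"
  proof (intro sum.cong refl)
    fix j assume "j \<in> {1..n}"
    then show "indicator {t j} (t i) * g j = (if j = i then g j else 0)"
      using inj_on_eq_iff[OF t_inj, of i j] assms by (cases "i = j") auto
  qed
  then show ?thesis using assms by simp
qed

lemma active_at: "i \<in> {1..n} \<Longrightarrow> active (t i, y) = above i y"
  by (simp only: active_def fst_conv snd_conv sum_indicator_time)

lemma active_measurable: "f \<in> measurable M extM \<Longrightarrow> (\<lambda>w. active (f w)) \<in> borel_measurable M"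
  unfolding active_def[abs_def]
  by (intro borel_measurable_sum borel_measurable_times borel_measurable_indicator'
      measurable_compose[OF fst_ext_app] measurable_compose[OF snd_ext_app]) auto

text \<open>
  The pieces of the factorisation: \<open>hop\<close> is the strictly triangular part \<open>N\<close>, \<open>entry\<close> the row \<open>W\<close>,
  \<open>exit\<close> the column \<open>U\<close>, and \<open>source\<close> the part \<open>B\<close> of the extended kernel.
\<close>

definition hop :: "real \<times> real \<Rightarrow> real \<times> real \<Rightarrow> real" where
  "hop \<xi> \<xi>' = active \<xi> * ((if fst \<xi> < fst \<xi>' then heat (fst \<xi>' - fst \<xi>) (snd \<xi>) (snd \<xi>') else 0) * active \<xi>')"

definition entry :: "real \<Rightarrow> real \<times> real \<Rightarrow> real" where
  "entry v \<xi> = heat (fst \<xi> - tau 0) v (snd \<xi>) * active \<xi>"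

definition exit :: "real \<times> real \<Rightarrow> real \<Rightarrow> real" where
  "exit \<xi> v = (\<Sum>j\<in>{1..n}. indicator {t j} (fst \<xi>) * exceed j (snd \<xi>) v)"

definition source :: "real \<times> real \<Rightarrow> real \<times> real \<Rightarrow> real" where
  "source \<xi> \<xi>' = active \<xi> * (airy_shift (fst \<xi> - fst \<xi>') (snd \<xi> + snd \<xi>') * active \<xi>')"

lemma exit_at: "i \<in> {1..n} \<Longrightarrow> exit (t i, y) v = exceed i y v"
  by (simp only: exit_def fst_conv snd_conv sum_indicator_time)

lemma heat_measurable3:
  assumes [measurable]: "s \<in> borel_measurable M" "f \<in> borel_measurable M" "g \<in> borel_measurable M"
  shows "(\<lambda>w. heat (s w) (f w) (g w)) \<in> borel_measurable M"
  unfolding heat_def by measurable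

text \<open>
  With \<open>\<theta> = \<bar>t i\<bar>\<close> in the Gaussian bound, \<open>exp (- \<theta> * \<bar>y - y'\<bar>) \<le> exp (- t i * (y - y'))\<close>. Compared with the
  weight \<open>exp (t j * y')\<close> this leaves \<open>exp (- (t j - t i) * y')\<close>, which decays since \<open>t j - t i \<ge> gap\<close>.
\<close>

lemma hop_dominated: "dominated extM extM extL extR hop"
proof (rule dominatedI)
  show "(\<lambda>(\<xi>, \<xi>'). hop \<xi> \<xi>') \<in> borel_measurable (extM \<Otimes>\<^sub>M extM)"
    unfolding hop_def case_prod_beta
    by (intro borel_measurable_times active_measurable measurable_If heat_measurable3 borel_measurable_diff
        fst_ext_app snd_ext_app borel_measurable_less) auto
  define K where "K = 1 / sqrt (4 * pi * gap) * exp (bnd * bnd\<^sup>2)"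
  have K: "K \<ge> 0" using gap(1) by (simp add: K_def)
  fix \<xi> \<xi>' assume "\<xi> \<in> space extM" "\<xi>' \<in> space extM"
  then obtain i y j y' where ij: "i \<in> {1..n}" "j \<in> {1..n}" and \<xi>: "\<xi> = (t i, y)" "\<xi>' = (t j, y')"
    by (auto elim!: ext_cases)
  show "\<bar>hop \<xi> \<xi>'\<bar> \<le> K * exp (bnd * floor_level) * (extL \<xi> * extR \<xi>')"
  proof (cases "i < j \<and> y > x i \<and> y' > x j")
    case False
    then have "hop \<xi> \<xi>' = 0"
      using ij t_less_iff[OF ij] by (auto simp: hop_def \<xi> active_at)
    then show ?thesis using K extL_pos[of \<xi>] extR_pos[of \<xi>'] by simp
  next
    case True
    have tij: "gap \<le> t j - t i" "t j - t i + 2 \<le> bnd" using gap(3)[of i j] bnd(3)[of i j] True ij by auto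
    have ti: "\<bar>t i\<bar> \<le> bnd" using bnd(2)[of i] ij by auto
    have h: "heat (t j - t i) y y' \<le> 1 / sqrt (4 * pi * gap) * exp (bnd * \<bar>t i\<bar>\<^sup>2) * exp (- \<bar>t i\<bar> * \<bar>y - y'\<bar>)"
      by (rule heat_exp_abs_bound) (use gap(1) tij in auto)
    also have "\<dots> \<le> K * exp (- \<bar>t i\<bar> * \<bar>y - y'\<bar>)"
    proof -
      have "\<bar>t i\<bar>\<^sup>2 \<le> bnd\<^sup>2" by (intro power_mono ti) simp
      then have "bnd * \<bar>t i\<bar>\<^sup>2 \<le> bnd * bnd\<^sup>2" using bnd(1) by (intro mult_left_mono) auto
      then have "1 / sqrt (4 * pi * gap) * exp (bnd * \<bar>t i\<bar>\<^sup>2) \<le> K"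
        unfolding K_def using gap(1) by (intro mult_left_mono) auto
      then show ?thesis by (intro mult_right_mono) auto
    qed
    also have "\<dots> \<le> K * exp (bnd * floor_level + (- t i * y + (t j * y' - gap * \<bar>y'\<bar>)))"
    proof (intro mult_left_mono K)
      have "- (t j - t i) * y' \<le> (t j - t i + gap) * floor_level - gap * \<bar>y'\<bar>"
        by (rule half_line_linear_bound) (use True floor_level(2)[OF ij(2)] floor_level(1) tij gap in auto)
      moreover have "(t j - t i + gap) * floor_level \<le> bnd * floor_level"
        using tij gap(2) floor_level(1) by (intro mult_right_mono) auto
      moreover have "t i * (y - y') \<le> \<bar>t i\<bar> * \<bar>y - y'\<bar>"
        by (metis abs_ge_self abs_mult)
      ultimately show "exp (- \<bar>t i\<bar> * \<bar>y - y'\<bar>) \<le> exp (bnd * floor_level + (- t i * y + (t j * y' - gap * \<bar>y'\<bar>)))"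
        by (simp add: algebra_simps)
    qed
    also have "\<dots> = K * exp (bnd * floor_level) * (extL \<xi> * extR \<xi>')"
      unfolding exp_add by (simp add: extL_def extR_def \<xi>)
    finally have "heat (t j - t i) y y' \<le> K * exp (bnd * floor_level) * (extL \<xi> * extR \<xi>')" .
    moreover have "\<bar>hop \<xi> \<xi>'\<bar> = heat (t j - t i) y y'"
      using True ij t_less_iff[OF ij] heat_nonneg[of "t j - t i" y y'] by (simp add: hop_def \<xi> active_at)
    ultimately show ?thesis by simp
  qed
qed (rule extL_pos extR_pos)+

text \<open>
  The exponent of \<open>lineL\<close> is Lipschitz continuous with constant \<open>bnd + 1\<close>.
\<close>

lemma lineL_shift: "exp (- (bnd + 1) * \<bar>v - y\<bar>) \<le> lineL v * exp (- (bnd * y - \<bar>y\<bar>))"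
proof -
  have "bnd * (y - v) \<le> bnd * \<bar>v - y\<bar>" using bnd(1) by (intro mult_left_mono) auto
  moreover have "\<bar>v\<bar> \<le> \<bar>y\<bar> + \<bar>v - y\<bar>" by simp
  ultimately have "- (bnd + 1) * \<bar>v - y\<bar> \<le> (bnd * v - \<bar>v\<bar>) + - (bnd * y - \<bar>y\<bar>)"
    by (simp add: algebra_simps)
  then show ?thesis unfolding lineL_def exp_add[symmetric] by simp
qed

text \<open>
  With the Gaussian bound at rate \<open>bnd + 1\<close>, \<open>lineL_shift\<close> separates the two variables. The factor that
  depends on \<open>y\<close> only has to be compared with \<open>extR\<close> behind the cutoff.
\<close>

lemma entry_dominated: "dominated lborel extM lineL extR entry"
proof (rule dominatedI)
  show "(\<lambda>(v, \<xi>). entry v \<xi>) \<in> borel_measurable (lborel \<Otimes>\<^sub>M extM)"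
    unfolding entry_def case_prod_beta
    by (intro borel_measurable_times active_measurable heat_measurable3 borel_measurable_diff
        fst_ext_app snd_ext_app) auto
  define K where "K = 1 / sqrt (4 * pi * gap) * exp (bnd * (bnd + 1)\<^sup>2)"
  have K: "K \<ge> 0" using gap(1) by (simp add: K_def)
  fix v \<xi> assume "\<xi> \<in> space extM"
  then obtain j y where j: "j \<in> {1..n}" and \<xi>: "\<xi> = (t j, y)" by (rule ext_cases)
  show "\<bar>entry v \<xi>\<bar> \<le> K * exp (2 * bnd * floor_level) * (lineL v * extR \<xi>)"
  proof (cases "y > x j")
    case False
    then have "entry v \<xi> = 0" using j by (simp add: entry_def \<xi> active_at)
    then show ?thesis using K lineL_pos[of v] extR_pos[of \<xi>] by simp
  next
    case True
    have tj: "gap \<le> t j - tau 0" "t j - tau 0 + 2 \<le> bnd" "\<bar>t j\<bar> + 2 \<le> bnd"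
      using gap(3)[of 0 j] bnd(3)[of 0 j] bnd(2)[of j] j by auto
    have "heat (t j - tau 0) v y \<le> 1 / sqrt (4 * pi * gap) * exp (bnd * (bnd + 1)\<^sup>2) * exp (- (bnd + 1) * \<bar>v - y\<bar>)"
      by (rule heat_exp_abs_bound) (use gap(1) tj bnd(1) in auto)
    also have "\<dots> \<le> K * (lineL v * exp (- (bnd * y - \<bar>y\<bar>)))"
      unfolding K_def[symmetric] by (intro mult_left_mono lineL_shift K)
    also have "\<dots> \<le> K * (lineL v * exp (2 * bnd * floor_level + (t j * y - gap * \<bar>y\<bar>)))"
    proof (intro mult_left_mono K less_imp_le[OF lineL_pos])
      have "- (bnd + t j) * y \<le> (bnd + t j + (1 + gap)) * floor_level - (1 + gap) * \<bar>y\<bar>"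
        by (rule half_line_linear_bound) (use True floor_level(2)[OF j] floor_level(1) tj gap bnd(1) in auto)
      moreover have "(bnd + t j + (1 + gap)) * floor_level \<le> 2 * bnd * floor_level"
        using tj gap(2) floor_level(1) by (intro mult_right_mono) auto
      ultimately show "exp (- (bnd * y - \<bar>y\<bar>)) \<le> exp (2 * bnd * floor_level + (t j * y - gap * \<bar>y\<bar>))"
        by (simp add: algebra_simps)
    qed
    also have "\<dots> = K * exp (2 * bnd * floor_level) * (lineL v * extR \<xi>)"
      unfolding exp_add by (simp add: extR_def \<xi>)
    finally show ?thesis
      using True j tj gap(1) heat_nonneg[of "t j - tau 0" v y] by (simp add: entry_def \<xi> active_at)
  qed
qed (rule lineL_pos extR_pos)+

lemma bnd_reference: "bnd > tau n - tau 0"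
  using bnd(3)[of 0 n] by simp

lemma exceed_dominated_bnd: "j \<le> n \<Longrightarrow> dominated lborel lborel lineR lineR (exceed j)"
  by (rule exceed_dominated[OF bnd_reference])

lemma exit_dominated: "dominated extM lborel extL lineR exit"
  unfolding exit_def[abs_def]
proof (rule dominated_sum)
  fix j assume j: "j \<in> {1..n}"
  have D: "dominated lborel lborel lineR lineR (exceed j)" using exceed_dominated_bnd j by simp
  obtain C where C: "C > 0" "bounded_by lborel lborel lineR lineR C (exceed j)"
    by (rule dominatedE[OF D])
  show "dominated extM lborel extL lineR (\<lambda>\<xi> v. indicator {t j} (fst \<xi>) * exceed j (snd \<xi>) v)"
  proof (rule dominatedI)
    show "(\<lambda>(\<xi>, v). indicator {t j} (fst \<xi>) * exceed j (snd \<xi>) v) \<in> borel_measurable (extM \<Otimes>\<^sub>M lborel)"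
      unfolding case_prod_beta
      by (intro borel_measurable_times dominated_app[OF D] borel_measurable_indicator'
          measurable_compose[OF fst_ext_app]) (auto simp: snd_ext_app)
    fix \<xi> v assume "\<xi> \<in> space extM"
    then obtain i y where i: "i \<in> {1..n}" and \<xi>: "\<xi> = (t i, y)" by (rule ext_cases)
    show "\<bar>indicator {t j} (fst \<xi>) * exceed j (snd \<xi>) v\<bar> \<le> C * exp (2 * bnd * floor_level) * (extL \<xi> * lineR v)"
    proof (cases "i = j \<and> y > x j")
      case False
      then have zero: "indicator {t j} (fst \<xi>) * exceed j (snd \<xi>) v = 0"
        using inj_on_eq_iff[OF t_inj i j] by (cases "i = j") (auto simp: \<xi> exceed_def)
      show ?thesis unfolding zero using C(1) extL_pos[of \<xi>] expw_pos[of bnd v] by simp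
    next
      case True
      have tj: "\<bar>t j\<bar> + 2 \<le> bnd" using bnd(2)[of j] j by auto
      have "- (bnd - t j) * y \<le> (bnd - t j + 0) * floor_level - 0 * \<bar>y\<bar>"
        by (rule half_line_linear_bound) (use True floor_level(2)[OF j] floor_level(1) tj in auto)
      moreover have "(bnd - t j) * floor_level \<le> 2 * bnd * floor_level"
        using tj floor_level(1) by (intro mult_right_mono) auto
      ultimately have "lineR y \<le> exp (2 * bnd * floor_level) * extL \<xi>"
        using True unfolding expw_def extL_def \<xi> exp_add[symmetric] by (simp add: algebra_simps)
      then have "C * (lineR y * lineR v) \<le> C * ((exp (2 * bnd * floor_level) * extL \<xi>) * lineR v)"
        using C(1) expw_pos[of bnd v] by (intro mult_left_mono mult_right_mono) auto
      moreover have "\<bar>exceed j y v\<bar> \<le> C * (lineR y * lineR v)" using C(2) by simp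
      ultimately show ?thesis using True by (simp add: \<xi> mult.assoc)
    qed
  qed (rule extL_pos expw_pos)+
qed (auto simp: extL_pos expw_pos)

text \<open>
  With the heat kernel at time 1 on its left this is \<open>entry \<circ> exit\<close>; with the same factor on its right it is
  minus the kernel of the theorem.
\<close>

definition lineK :: "real \<Rightarrow> real \<Rightarrow> real" where
  "lineK u v = airy_shift (tau 1 - tau 0) (u + v) - below 1 u * surv (tau 0) 1 u v"

lemma lineK_eq: "lineK u v = exceed 1 u v + (\<Sum>j\<in>{2..n}. kcomp lborel (heat (tau j - tau 1)) (exceed j) u v)"
proof -
  have "surv (tau 0) 1 u v = below 1 u * surv (tau 0) 1 u v + exceed 1 u v"
    unfolding exceed_def distrib_right[symmetric] below_add_above by simp
  then show ?thesis
    unfolding lineK_def using airy_shift_decomposition[OF n_pos, of u v] by (simp add: numeral_2_eq_2)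
qed

text \<open>
  The definition of \<open>lineK\<close> is a difference of two terms that are not dominated for \<open>u \<rightarrow> -\<infinity>\<close>. The
  decomposition shows the cancellation: every remaining term passes through a half line \<open>(x j, \<infinity>)\<close>.
\<close>

lemma lineK_dominated: "dominated lborel lborel lineL lineR lineK"
proof -
  have E1: "dominated lborel lborel lineL lineR (exceed 1)"
  proof -
    have D: "dominated lborel lborel lineR lineR (exceed 1)" using exceed_dominated_bnd n_pos by simp
    obtain C where C: "C > 0" "bounded_by lborel lborel lineR lineR C (exceed 1)"
      by (rule dominatedE[OF D])
    show ?thesis
    proof (rule dominatedI)
      show "(\<lambda>(u, v). exceed 1 u v) \<in> borel_measurable (lborel \<Otimes>\<^sub>M lborel)" by (rule dominated_measurable[OF D])
      show "\<bar>exceed 1 u v\<bar> \<le> C * exp ((2 * bnd + 1) * floor_level) * (lineL u * lineR v)" for u v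
      proof (cases "u > x 1")
        case False
        then have "exceed 1 u v = 0" by (simp add: exceed_def)
        then show ?thesis using C(1) lineL_pos[of u] expw_pos[of bnd v] by simp
      next
        case True
        have "- (2 * bnd) * u \<le> (2 * bnd + 1) * floor_level - 1 * \<bar>u\<bar>"
          by (rule half_line_linear_bound) (use True floor_level(2)[of 1] floor_level(1) n_pos bnd(1) in auto)
        then have "lineR u \<le> exp ((2 * bnd + 1) * floor_level) * lineL u"
          unfolding expw_def lineL_def exp_add[symmetric] by (simp add: algebra_simps)
        then have "C * (lineR u * lineR v) \<le> C * ((exp ((2 * bnd + 1) * floor_level) * lineL u) * lineR v)"
          using C(1) expw_pos[of bnd v] by (intro mult_left_mono mult_right_mono) auto
        moreover have "\<bar>exceed 1 u v\<bar> \<le> C * (lineR u * lineR v)" using C(2) by simp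
        ultimately show ?thesis by (simp add: mult.assoc)
      qed
    qed (rule lineL_pos expw_pos)+
  qed
  have Ej: "dominated lborel lborel lineL lineR (kcomp lborel (heat (tau j - tau 1)) (exceed j))" if j: "j \<in> {2..n}" for j
  proof -
    define K where "K = 1 / sqrt (4 * pi * gap) * exp (bnd * (bnd + 1)\<^sup>2)"
    have K: "K \<ge> 0" using gap(1) by (simp add: K_def)
    let ?A = "\<lambda>u z. heat (tau j - tau 1) u z * above j z"
    have tj: "gap \<le> tau j - tau 1" "tau j - tau 1 + 2 \<le> bnd"
      using gap(3)[of 1 j] bnd(3)[of 1 j] j n_pos by auto
    have A: "dominated lborel lborel lineL lineL ?A"
    proof (rule dominatedI)
      show "(\<lambda>(u, z). ?A u z) \<in> borel_measurable (lborel \<Otimes>\<^sub>M lborel)" by measurable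
      show "\<bar>?A u z\<bar> \<le> K * exp ((2 * bnd + 2) * floor_level) * (lineL u * lineL z)" for u z
      proof (cases "z > x j")
        case False
        then show ?thesis using K lineL_pos[of u] lineL_pos[of z] by simp
      next
        case True
        have "heat (tau j - tau 1) u z \<le> 1 / sqrt (4 * pi * gap) * exp (bnd * (bnd + 1)\<^sup>2) * exp (- (bnd + 1) * \<bar>u - z\<bar>)"
          by (rule heat_exp_abs_bound) (use gap(1) tj bnd(1) in auto)
        also have "\<dots> \<le> K * (lineL u * exp (- (bnd * z - \<bar>z\<bar>)))"
          unfolding K_def[symmetric] by (intro mult_left_mono lineL_shift K)
        also have "\<dots> \<le> K * (lineL u * (exp ((2 * bnd + 2) * floor_level) * lineL z))"
        proof (intro mult_left_mono K less_imp_le[OF lineL_pos])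
          have "- (2 * bnd) * z \<le> (2 * bnd + 2) * floor_level - 2 * \<bar>z\<bar>"
            by (rule half_line_linear_bound) (use True floor_level(2)[of j] floor_level(1) j bnd(1) in auto)
          then show "exp (- (bnd * z - \<bar>z\<bar>)) \<le> exp ((2 * bnd + 2) * floor_level) * lineL z"
            unfolding lineL_def exp_add[symmetric] by (simp add: algebra_simps)
        qed
        finally show ?thesis
          using True tj gap(1) heat_nonneg[of "tau j - tau 1" u z] by (simp add: algebra_simps)
      qed
    qed (rule lineL_pos)+
    have "kcomp lborel ?A (surv (tau 0) j) = kcomp lborel (heat (tau j - tau 1)) (exceed j)"
      by (simp add: kcomp_def exceed_def[abs_def] fun_eq_iff mult.assoc)
    moreover have "dominated lborel lborel lineL lineR (kcomp lborel ?A (surv (tau 0) j))"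
    proof (rule dominated_kcomp(1)[OF A])
      show "dominated lborel lborel lineR lineR (surv (tau 0) j)"
        using j by (intro surv_dominated bnd_reference) auto
      show "integrable lborel (\<lambda>z. lineL z * lineR z)"
        using weighted_line by (rule weighted_space.weight_integrable)
    qed (rule lineL_pos expw_pos lborel.sigma_finite_measure_axioms)+
    ultimately show ?thesis by simp
  qed
  have "dominated lborel lborel lineL lineR
      (\<lambda>u v. exceed 1 u v + (\<Sum>j\<in>{2..n}. kcomp lborel (heat (tau j - tau 1)) (exceed j) u v))"
    by (intro dominated_add dominated_sum E1 Ej lineL_pos expw_pos finite_atLeastAtMost)
  moreover have "(\<lambda>u v. exceed 1 u v + (\<Sum>j\<in>{2..n}. kcomp lborel (heat (tau j - tau 1)) (exceed j) u v)) = lineK"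
    by (simp add: lineK_eq fun_eq_iff)
  ultimately show ?thesis by simp
qed

end

section \<open>Factorisation of the extended kernel\<close>

context airy_times
begin

lemma hop_exit:
  assumes i: "i \<in> {1..n}"
  shows "kcomp extM hop exit (t i, y) v
    = above i y * (\<Sum>j\<in>{Suc i..n}. kcomp lborel (heat (tau j - tau i)) (exceed j) y v)"
proof -
  interpret E: weighted_space extM extL extR by (rule weighted_ext)
  have sp: "(t i, y) \<in> space extM" using i by (simp add: space_extM)
  have "integrable extM (\<lambda>\<xi>. hop (t i, y) \<xi> * exit \<xi> v)"
    by (rule dominated_kcomp(2)[OF hop_dominated exit_dominated extL_pos expw_pos _ E.sigma_finite_measure_axioms sp])
       (use E.weight_integrable in \<open>simp_all add: mult.commute\<close>)
  then have "kcomp extM hop exit (t i, y) v = (\<Sum>j\<in>{1..n}. \<integral>z. hop (t i, y) (t j, z) * exit (t j, z) v \<partial>lborel)"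
    unfolding kcomp_def by (rule integral_extM)
  also have "\<dots> = (\<Sum>j\<in>{1..n}. if i < j then above i y * kcomp lborel (heat (tau j - tau i)) (exceed j) y v else 0)"
  proof (intro sum.cong refl)
    fix j assume j: "j \<in> {1..n}"
    have "hop (t i, y) (t j, z) * exit (t j, z) v
        = (if i < j then above i y * (heat (tau j - tau i) y z * exceed j z v) else 0)" for z
      using i j t_less_iff[OF i j] by (auto simp: hop_def active_at exit_at exceed_def indicator_def)
    then show "(\<integral>z. hop (t i, y) (t j, z) * exit (t j, z) v \<partial>lborel)
        = (if i < j then above i y * kcomp lborel (heat (tau j - tau i)) (exceed j) y v else 0)"
      by (simp add: kcomp_def)
  qed
  also have "\<dots> = (\<Sum>j\<in>{Suc i..n}. above i y * kcomp lborel (heat (tau j - tau i)) (exceed j) y v)"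
    using i by (intro sum.mono_neutral_cong_right) auto
  finally show ?thesis by (simp add: sum_distrib_left)
qed

lemma exit_plus_hop_exit:
  assumes i: "i \<in> {1..n}"
  shows "exit (t i, y) v + kcomp extM hop exit (t i, y) v = above i y * airy_shift (t i - tau 0) (y + v)"
  using airy_shift_decomposition[of i y v] i
  by (simp add: hop_exit[OF i] exit_at[OF i] exceed_def distrib_left)

definition resolvent :: "real \<times> real \<Rightarrow> real \<times> real \<Rightarrow> real" where
  "resolvent = kcomp lborel exit entry"

lemma line_integrable: "integrable lborel (\<lambda>u. lineR u * lineL u)"
  using weighted_space.weight_integrable[OF weighted_line] by (simp add: mult.commute)

lemma ext_integrable: "integrable extM (\<lambda>\<xi>. extR \<xi> * extL \<xi>)"
  using weighted_space.weight_integrable[OF weighted_ext] by (simp add: mult.commute)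

lemma resolvent_dominated: "dominated extM extM extL extR resolvent"
  unfolding resolvent_def
  by (rule dominated_kcomp(1)[OF exit_dominated entry_dominated extL_pos extR_pos line_integrable lborel.sigma_finite_measure_axioms])

text \<open>
  This is \<open>I + N - B = (I + N) (I - U W)\<close>. By the decomposition, \<open>U + N \<circ> U\<close> is the column
  \<open>Q i b i\<close>, and composing it with \<open>W\<close> lets the heat flow change its reference time from \<open>tau 0\<close> to \<open>t j\<close>.
\<close>

lemma source_factorisation:
  assumes \<xi>: "\<xi> \<in> space extM" and \<xi>': "\<xi>' \<in> space extM"
  shows "source \<xi> \<xi>' = resolvent \<xi> \<xi>' + kcomp extM hop resolvent \<xi> \<xi>'"
proof -
  obtain i y where i: "i \<in> {1..n}" "\<xi> = (t i, y)" using \<xi> by (rule ext_cases)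
  obtain j z where j: "j \<in> {1..n}" "\<xi>' = (t j, z)" using \<xi>' by (rule ext_cases)
  have s: "t j - tau 0 > 0" using tau_less[of 0 j] j by simp
  have HE: "dominated extM lborel extL lineR (kcomp extM hop exit)"
    by (rule dominated_kcomp(1)[OF hop_dominated exit_dominated extL_pos expw_pos ext_integrable sigma_finite_ext])
  have i1: "integrable lborel (\<lambda>v. exit \<xi> v * entry v \<xi>')"
    using dominated_kcomp(2)[OF exit_dominated entry_dominated extL_pos extR_pos line_integrable lborel.sigma_finite_measure_axioms \<xi> \<xi>'] .
  have i2: "integrable lborel (\<lambda>v. kcomp extM hop exit \<xi> v * entry v \<xi>')"
    using dominated_kcomp(2)[OF HE entry_dominated extL_pos extR_pos line_integrable lborel.sigma_finite_measure_axioms \<xi> \<xi>'] .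
  have "kcomp extM hop resolvent \<xi> \<xi>' = kcomp lborel (kcomp extM hop exit) entry \<xi> \<xi>'"
    unfolding resolvent_def
    by (rule dominated_assoc[OF hop_dominated exit_dominated entry_dominated sigma_finite_ext ext_integrable
          lborel.sigma_finite_measure_axioms line_integrable extR_pos extL_pos expw_pos extL_pos \<xi> \<xi>', symmetric])
  then have "resolvent \<xi> \<xi>' + kcomp extM hop resolvent \<xi> \<xi>'
      = (\<integral>v. (exit \<xi> v + kcomp extM hop exit \<xi> v) * entry v \<xi>' \<partial>lborel)"
    using i1 i2 by (simp add: resolvent_def kcomp_def[of lborel] distrib_right)
  also have "\<dots> = (\<integral>v. (above i y * above j z) * (heat (t j - tau 0) z v * airy_shift (t i - tau 0) (v + y)) \<partial>lborel)"
    unfolding i(2) exit_plus_hop_exit[OF i(1)] j(2) entry_def fst_conv snd_conv active_at[OF j(1)]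
      heat_sym[of _ z] add.commute[of y] by (simp only: mult_ac)
  also have "\<dots> = (above i y * above j z) * airy_shift (t i - tau 0 - (t j - tau 0)) (z + y)"
    using heat_airy_shift[OF s, of z "t i - tau 0" y] by simp
  also have "\<dots> = source \<xi> \<xi>'"
    by (simp add: source_def i(2) j(2) active_at[OF i(1)] active_at[OF j(1)] add.commute)
  finally show ?thesis by simp
qed

lemma cutoff_ext:
  assumes "i \<in> {1..n}"
  shows "cutoff n t x (t i, y) = above i y"
proof -
  have "(t i, y) \<in> {(t j, y) | j y. j \<in> {1..n} \<and> y > x j} \<longleftrightarrow> y > x i"
    using assms inj_on_eq_iff[OF t_inj assms] by blast
  then show ?thesis unfolding cutoff_def by (simp add: indicator_def)
qed

lemma ext_kernel_eq:
  assumes "\<xi> \<in> space extM" "\<xi>' \<in> space extM"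
  shows "- (sqrt (cutoff n t x \<xi>) * K1_ext \<xi> \<xi>' * sqrt (cutoff n t x \<xi>')) = hop \<xi> \<xi>' - source \<xi> \<xi>'"
proof -
  obtain i y where i: "i \<in> {1..n}" "\<xi> = (t i, y)" using assms(1) by (rule ext_cases)
  obtain j z where j: "j \<in> {1..n}" "\<xi>' = (t j, z)" using assms(2) by (rule ext_cases)
  have sq: "sqrt (above k w) = above k w" for k w by (simp add: indicator_def)
  have "airy_Ai (y + z + (t j - t i)\<^sup>2) * exp ((t j - t i) * (y + z) + 2 / 3 * (t j - t i) ^ 3)
      = airy_shift (t i - t j) (y + z)"
  proof -
    have "(t j - t i) * (y + z) + 2 / 3 * (t j - t i) ^ 3 = - 2 * (t i - t j) ^ 3 / 3 - (y + z) * (t i - t j)"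
      by (simp add: power3_eq_cube field_simps)
    then show ?thesis by (simp add: airy_shift_def power2_commute[of "t j"] mult.commute)
  qed
  moreover have "(z - y)\<^sup>2 = (y - z)\<^sup>2" by (rule power2_commute)
  ultimately show ?thesis
    unfolding i j cutoff_ext[OF i(1)] cutoff_ext[OF j(1)] sq hop_def source_def
    using i j by (simp add: K1_ext_def active_at heat_def algebra_simps)
qed

text \<open>
  A permutation maps the index of a latest point to a point that is not later, where \<open>hop\<close> vanishes. So all
  minors of positive size are 0.
\<close>

lemma fredholm_det_hop: "fredholm_det extM hop = 1"
proof -
  have "moment extM (replicate m hop) = 0" if m: "m > 0" for m
  proof -
    have "mixed_minor (replicate m hop) \<xi> = 0" for \<xi>
      unfolding mixed_minor_def fdet_mat_leibniz length_replicate
    proof (intro sum.neutral ballI)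
      fix p assume "p \<in> {p. p permutes {..<m}}"
      then have p: "p permutes {..<m}" by simp
      have "Max ((\<lambda>j. fst (\<xi> j)) ` {..<m}) \<in> (\<lambda>j. fst (\<xi> j)) ` {..<m}" using m by (intro Max_in) auto
      then obtain i where "i < m" "fst (\<xi> i) = Max ((\<lambda>j. fst (\<xi> j)) ` {..<m})" by auto
      then have i: "i < m" "\<forall>j<m. fst (\<xi> j) \<le> fst (\<xi> i)" by (auto intro!: Max_ge)
      have "p i < m" using permutes_in_image[OF p] i(1) by auto
      then have "hop (\<xi> i) (\<xi> (p i)) = 0" using i(2) by (auto simp: hop_def not_less)
      then show "of_int (sign p) * (\<Prod>i<m. (replicate m hop ! i) (\<xi> i) (\<xi> (p i))) = 0"
        using i(1) by (auto intro!: prod_zero)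
    qed
    then show ?thesis by (simp add: moment_def)
  qed
  then have "(\<lambda>m. moment extM (replicate m hop) / fact m) = (\<lambda>m. if m = 0 then 1 else 0)"
    using weighted_space.moment_Nil[OF weighted_ext] by auto
  then show ?thesis
    unfolding fredholm_det_eq_moments using sums_single[of 0 "\<lambda>_. 1 :: real"] by (simp add: sums_iff)
qed

lemma entry_exit:
  "kcomp extM entry exit v w = airy_shift 0 (v + w) - surv (tau 0) 0 v w"
proof -
  have "integrable extM (\<lambda>\<xi>. entry v \<xi> * exit \<xi> w)"
    by (rule dominated_kcomp(2)[OF entry_dominated exit_dominated lineL_pos expw_pos ext_integrable sigma_finite_ext]) auto
  then have "kcomp extM entry exit v w = (\<Sum>j\<in>{1..n}. \<integral>z. entry v (t j, z) * exit (t j, z) w \<partial>lborel)"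
    unfolding kcomp_def by (rule integral_extM)
  also have "\<dots> = (\<Sum>j\<in>{1..n}. kcomp lborel (heat (tau j - tau 0)) (exceed j) v w)"
  proof (intro sum.cong refl)
    fix j assume j: "j \<in> {1..n}"
    have "entry v (t j, z) * exit (t j, z) w = heat (tau j - tau 0) v z * exceed j z w" for z
      using j by (auto simp: entry_def active_at exit_at exceed_def indicator_def)
    then show "(\<integral>z. entry v (t j, z) * exit (t j, z) w \<partial>lborel) = kcomp lborel (heat (tau j - tau 0)) (exceed j) v w"
      by (simp add: kcomp_def)
  qed
  also have "\<dots> = airy_shift 0 (v + w) - surv (tau 0) 0 v w"
    using airy_shift_decomposition[of 0 v w] by simp
  finally show ?thesis .
qed

lemma tau_1_0: "tau 1 - tau 0 = 1"
  by (simp add: tau_def)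

lemma unit_heat_nonneg: "heat 1 u v \<ge> 0"
  by (rule heat_nonneg) simp

lemma airy_shift_bnd: "dominated lborel lborel lineR lineR (\<lambda>u v. airy_shift 1 (u + v))"
  using bnd(1) by (intro dominated_airy_shift) simp

lemma surv_bnd: "dominated lborel lborel lineR lineR (\<lambda>u v. below 1 u * surv (tau 0) 1 u v)"
  using n_pos by (intro dominated_below surv_dominated bnd_reference) simp

lemma heat_lineK: "kcomp lborel (heat 1) lineK v w = airy_shift 0 (v + w) - surv (tau 0) 0 v w"
proof -
  have "kcomp lborel (heat 1) lineK v w
      = (\<integral>z. heat 1 v z * airy_shift 1 (z + w) - heat 1 v z * (below 1 z * surv (tau 0) 1 z w) \<partial>lborel)"
    unfolding kcomp_def lineK_def tau_1_0 right_diff_distrib ..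
  also have "\<dots> = (\<integral>z. heat 1 v z * airy_shift 1 (z + w) \<partial>lborel)
      - (\<integral>z. heat 1 v z * (below 1 z * surv (tau 0) 1 z w) \<partial>lborel)"
    by (intro Bochner_Integration.integral_diff dominated_heat(2)[OF _ airy_shift_bnd expw_pos]
        dominated_heat(2)[OF _ surv_bnd expw_pos]) auto
  also have "(\<integral>z. heat 1 v z * airy_shift 1 (z + w) \<partial>lborel) = airy_shift 0 (v + w)"
    using heat_airy_shift[of 1 v 1 w] by simp
  also have "(\<integral>z. heat 1 v z * (below 1 z * surv (tau 0) 1 z w) \<partial>lborel) = surv (tau 0) 0 v w"
    using surv_step[of 0 "tau 0"] n_pos tau_1_0 by (simp add: kcomp_def)
  finally show ?thesis .
qed

lemma integrable_dominated_heat_right: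
  assumes "dominated lborel lborel lineR lineR A"
  shows "integrable lborel (\<lambda>v. A u v * heat 1 v y)"
proof -
  obtain C where C: "C > 0" "bounded_by lborel lborel lineR lineR C A"
    by (rule dominatedE[OF assms])
  have "integrable lborel (\<lambda>v. C * lineR u * (heat 1 y v * exp (- bnd * v)))"
    by (intro integrable_mult_right integrable_heat_exp) simp
  then show ?thesis
  proof (rule integrable_real_bound)
    show "(\<lambda>v. A u v * heat 1 v y) \<in> borel_measurable lborel"
      by (intro borel_measurable_times dominated_app[OF assms] heat_measurable) auto
    show "\<bar>A u v * heat 1 v y\<bar> \<le> C * lineR u * (heat 1 y v * exp (- bnd * v))" for v
    proof -
      have "\<bar>A u v\<bar> \<le> C * (lineR u * lineR v)" using C(2) by simp
      from mult_right_mono[OF this unit_heat_nonneg[of v y]]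
      show ?thesis
        using unit_heat_nonneg[of v y]
        by (simp add: abs_mult expw_def heat_sym[of _ y] algebra_simps)
    qed
  qed
qed

lemma lineK_heat: "kcomp lborel lineK (heat 1) u y = - airy1_kernel n t x u y"
proof -
  have "kcomp lborel lineK (heat 1) u y
      = (\<integral>v. airy_shift 1 (u + v) * heat 1 v y - below 1 u * surv (tau 0) 1 u v * heat 1 v y \<partial>lborel)"
    unfolding kcomp_def lineK_def tau_1_0 left_diff_distrib ..
  also have "\<dots> = (\<integral>v. airy_shift 1 (u + v) * heat 1 v y \<partial>lborel)
      - (\<integral>v. below 1 u * surv (tau 0) 1 u v * heat 1 v y \<partial>lborel)"
    by (intro Bochner_Integration.integral_diff integrable_dominated_heat_right airy_shift_bnd surv_bnd)
  also have "(\<integral>v. airy_shift 1 (u + v) * heat 1 v y \<partial>lborel) = airy_shift 0 (u + y)"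
    using heat_airy_shift[of 1 y 1 u] by (simp add: heat_sym[of _ y] mult.commute add.commute)
  also have "(\<integral>v. below 1 u * surv (tau 0) 1 u v * heat 1 v y \<partial>lborel) = below 1 u * surv (t 1) 1 u y"
    using surv_change_reference[of "tau 0" "t 1" 1 u y] n_pos by (simp add: kcomp_def tau_0 mult.assoc)
  finally show ?thesis by (simp add: airy1_kernel_eq)
qed

lemma lineL_le: "lineL u \<le> exp ((bnd - 1) * u)" "lineL u \<le> exp ((bnd + 1) * u)"
  by (simp_all add: lineL_def algebra_simps)

text \<open>
  \<open>lineL\<close> is the minimum of two exponentials, and the heat kernel multiplies an exponential by a constant;
  \<open>p\<close> selects the exponential that is smaller at \<open>y\<close>.
\<close>

lemma heat_pair: "weighted_space_pair lborel lborel lineL lineR lineL lineR (heat 1) (exp ((bnd + 1)\<^sup>2))"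
proof -
  interpret L: weighted_space lborel lineL lineR by (rule weighted_line)
  have int: "integrable lborel (\<lambda>z. heat 1 y z * exp (p * z))"
    and val: "(\<integral>z. heat 1 y z * exp (p * z) \<partial>lborel) = exp (p * y + p\<^sup>2)" for y p
    using integrable_heat_exp[of 1 y "- p"] heat_exp_integral[of 1 y "- p"] by simp_all
  have le: "\<bar>heat 1 y z\<bar> * lineL z \<le> heat 1 y z * exp (p * z)" if "p = bnd - 1 \<or> p = bnd + 1" for y z p
    using that lineL_le[of z] unit_heat_nonneg[of y z] by (auto intro: mult_left_mono)
  have i: "integrable lborel (\<lambda>z. \<bar>heat 1 y z\<bar> * lineL z)" for y
  proof (rule integrable_real_bound[OF int[of y "bnd - 1"]])
    show "(\<lambda>z. \<bar>heat 1 y z\<bar> * lineL z) \<in> borel_measurable lborel"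
      by (intro borel_measurable_times borel_measurable_abs heat_measurable L.weight_measurable) auto
    show "\<bar>\<bar>heat 1 y z\<bar> * lineL z\<bar> \<le> heat 1 y z * exp ((bnd - 1) * z)" for z
      using le[of "bnd - 1" y z] lineL_pos[of z] by (simp add: abs_mult)
  qed
  have R: "lineR y * \<bar>heat 1 y z\<bar> = heat 1 z y * exp (- bnd * y)" for y z
    using unit_heat_nonneg[of y z] by (simp add: expw_def heat_sym[of _ y])
  show ?thesis
  proof unfold_locales
    show "(\<lambda>(y, z). heat 1 y z) \<in> borel_measurable (lborel \<Otimes>\<^sub>M lborel)" by measurable
    show "integrable lborel (\<lambda>z. \<bar>heat 1 y z\<bar> * lineL z)" for y by (rule i)
    show "(\<integral>z. \<bar>heat 1 y z\<bar> * lineL z \<partial>lborel) \<le> exp ((bnd + 1)\<^sup>2) * lineL y" for y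
    proof -
      define p where "p = (if y \<ge> 0 then bnd - 1 else bnd + 1)"
      have p: "p = bnd - 1 \<or> p = bnd + 1" by (simp add: p_def)
      have "(\<integral>z. \<bar>heat 1 y z\<bar> * lineL z \<partial>lborel) \<le> (\<integral>z. heat 1 y z * exp (p * z) \<partial>lborel)"
        by (intro integral_mono i int le p)
      also have "\<dots> = exp (p * y + p\<^sup>2)" by (rule val)
      also have "\<dots> \<le> exp ((bnd + 1)\<^sup>2) * lineL y"
      proof -
        have "p * y = bnd * y - \<bar>y\<bar>" by (simp add: p_def algebra_simps)
        moreover have "p\<^sup>2 \<le> (bnd + 1)\<^sup>2" using p bnd(1) by (intro power_mono) auto
        ultimately show ?thesis unfolding lineL_def exp_add[symmetric] by simp
      qed
      finally show ?thesis .
    qed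
    show "integrable lborel (\<lambda>y. lineR y * \<bar>heat 1 y z\<bar>)" for z
      unfolding R by (intro integrable_heat_exp) simp
    show "(\<integral>y. lineR y * \<bar>heat 1 y z\<bar> \<partial>lborel) \<le> exp ((bnd + 1)\<^sup>2) * lineR z" for z
    proof -
      have "bnd\<^sup>2 \<le> (bnd + 1)\<^sup>2" using bnd(1) by (intro power_mono) auto
      then have "exp (- bnd * z + bnd\<^sup>2) \<le> exp ((bnd + 1)\<^sup>2) * lineR z"
        unfolding expw_def exp_add[symmetric] by simp
      then show ?thesis unfolding R using heat_exp_integral[of 1 z bnd] by simp
    qed
  qed
qed

text \<open>
  The chain of determinants: multiplicativity splits off \<open>I + N\<close>, whose determinant is 1; commuting
  \<open>exit\<close> with \<open>entry\<close> moves the problem from the extended space to the line; commuting \<open>lineK\<close>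
  with the heat kernel at time 1 removes the auxiliary time.
\<close>

theorem airy1_ext_det_eq:
  "fredholm_det_defined lborel (airy1_kernel n t x) \<and> airy1_ext_det n t x = fredholm_det lborel (airy1_kernel n t x)"
proof -
  interpret E: weighted_space extM extL extR by (rule weighted_ext)
  interpret L: weighted_space lborel lineL lineR by (rule weighted_line)
  interpret H: weighted_space_pair lborel lborel lineL lineR lineL lineR "heat 1" "exp ((bnd + 1)\<^sup>2)" by (rule heat_pair)
  obtain K where "weighted_space_pair extM lborel extL extR lineL lineR entry K"
    by (rule weighted_space_pair_dominated[OF weighted_ext weighted_line entry_dominated])
  then interpret P: weighted_space_pair extM lborel extL extR lineL lineR entry K .
  let ?R = "\<lambda>\<xi> \<xi>'. - resolvent \<xi> \<xi>'" and ?U = "\<lambda>\<xi> v. - exit \<xi> v" and ?K = "\<lambda>u v. - lineK u v"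
  have U: "dominated extM lborel extL lineR ?U" by (rule dominated_uminus[OF exit_dominated])
  have K: "dominated lborel lborel lineL lineR ?K" by (rule dominated_uminus[OF lineK_dominated])
  have "airy1_ext_det n t x = fredholm_det extM (\<lambda>\<xi> \<xi>'. hop \<xi> \<xi>' - source \<xi> \<xi>')"
    unfolding airy1_ext_det_def extM_def[symmetric] by (intro fredholm_det_cong ext_kernel_eq)
  also have "\<dots> = fredholm_det extM (\<lambda>\<xi> \<xi>'. ?R \<xi> \<xi>' + hop \<xi> \<xi>' + kcomp extM hop ?R \<xi> \<xi>')"
    by (intro fredholm_det_cong) (simp add: source_factorisation kcomp_def[of extM])
  also have "\<dots> = fredholm_det extM ?R * fredholm_det extM hop"
    by (rule E.fredholm_det_multiplicative[OF dominated_uminus[OF resolvent_dominated] hop_dominated])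
  also have "\<dots> = fredholm_det extM (kcomp lborel ?U entry)"
    by (simp add: fredholm_det_hop resolvent_def kcomp_def[abs_def])
  also have "\<dots> = fredholm_det lborel (kcomp extM entry ?U)"
    by (rule P.fredholm_det_comp_commute[OF U])
  also have "kcomp extM entry ?U = kcomp lborel (heat 1) ?K"
  proof (intro ext)
    fix v w
    have "kcomp extM entry ?U v w = - kcomp extM entry exit v w"
      "kcomp lborel (heat 1) ?K v w = - kcomp lborel (heat 1) lineK v w"
      by (simp_all add: kcomp_def)
    then show "kcomp extM entry ?U v w = kcomp lborel (heat 1) ?K v w"
      by (simp add: entry_exit heat_lineK)
  qed
  also have "fredholm_det lborel (kcomp lborel (heat 1) ?K) = fredholm_det lborel (kcomp lborel ?K (heat 1))"
    by (rule H.fredholm_det_comp_commute[OF K, symmetric])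
  also have eq: "kcomp lborel ?K (heat 1) = airy1_kernel n t x"
  proof (intro ext)
    fix u y
    have "kcomp lborel ?K (heat 1) u y = - kcomp lborel lineK (heat 1) u y"
      by (simp add: kcomp_def)
    then show "kcomp lborel ?K (heat 1) u y = airy1_kernel n t x u y"
      by (simp add: lineK_heat)
  qed
  finally have "airy1_ext_det n t x = fredholm_det lborel (airy1_kernel n t x)" .
  moreover have "fredholm_det_defined lborel (airy1_kernel n t x)"
    using L.fredholm_det_defined_adm[OF H.dominated_comp_right[OF K]] unfolding eq .
  ultimately show ?thesis by simp
qed

end

theorem theorem1:
  fixes M :: "'w measure" and A :: "real \<Rightarrow> 'w \<Rightarrow> real"
    and n :: nat and t x :: "nat \<Rightarrow> real"
  assumes "airy1_process M A" and "n \<ge> 1" and "strict_mono_on {1..n} t"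
  shows "fredholm_det_defined lborel (airy1_kernel n t x) \<and>
         \<P>(\<omega> in M. \<forall>i\<in>{1..n}. A (t i) \<omega> \<le> x i) = fredholm_det lborel (airy1_kernel n t x)"
proof -
  interpret airy_times n t x by unfold_locales (use assms in auto)
  have "\<P>(\<omega> in M. \<forall>i\<in>{1..n}. A (t i) \<omega> \<le> x i) = airy1_ext_det n t x"
    using assms unfolding airy1_process_def by blast
  then show ?thesis using airy1_ext_det_eq by simp
qed

end
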